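(* The following affirmations are equivalent: (1) For every $p\in\mathbb{N}$, the Universal Tiling Conjecture UTC($p$) is true. (2) Every bounded Lebesgue measurable spectral set $\Omega\subset\mathbb{R}$ (of positive measure) tiles $\mathbb{R}$ by translations. Moreover, if these statements are true and if $\Omega\subset\mathbb{R}$, $|\Omega|=1$, is a bounded Lebesgue measurable set which has a spectrum with period $p$, then $\Omega$ tiles $\mathbb{R}$ by a subset $\mathcal{T}$ of $\frac1p\mathbb{Z}$.
   Context: $\mathbb{N}=\{1,2,3,\dots\}$; $|\Omega|$ denotes Lebesgue measure. For $\lambda\in\mathbb{R}$, $e_\lambda(x):=e^{2\pi i\lambda x}$, $x\in\mathbb{R}$. Spectral sets in $\mathbb{R}$: a Lebesgue measurable set $\Omega\subset\mathbb{R}$ of finite (positive) Lebesgue measure is spectral if there exists $\Lambda\subset\mathbb{R}$ such that $\{e_\lambda:\lambda\in\Lambda\}$ (restricted to $\Omega$) is an orthogonal basis for $L^2(\Omega)$; then $\Lambda$ is called a spectrum for $\Omega$. Tiling of $\mathbb{R}$: $\Omega$ tiles $\mathbb{R}$ by $\mathcal{T}\subset\mathbb{R}$ if $\{\Omega+t:t\in\mathcal{T}\}$ is a partition of $\mathbb{R}$ up to Lebesgue measure zero; $\Omega$ tiles $\mathbb{R}$ by translations if such a $\mathcal{T}$ exists. Period: a spectrum $\Lambda$ has period $p\neq 0$ if $\Lambda+p=\Lambda$. It is known that every spectrum $\Lambda$ of a spectral set $\Omega$ has a period, and that every period is an integer multiple of $1/|\Omega|$; periods are taken positive, so for $|\Omega|=1$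 a period $p$ is a positive integer. Finite spectral sets: a finite set $A\subset\mathbb{R}$ is spectral if there is a finite set $\Lambda\subset\mathbb{R}$ such that the family $(e_\lambda)_{\lambda\in\Lambda}$ is an orthogonal basis for $L^2(\delta_A)$, where $\delta_A:=\sum_{a\in A}\delta_a$ and $\delta_a$ is the Dirac measure at $a$; then $\Lambda$ is called a spectrum for $A$. Tiling of $\mathbb{Z}$: $A\subset\mathbb{Z}$ tiles $\mathbb{Z}$ by $\mathcal{T}\subset\mathbb{Z}$ if $\{A+t:t\in\mathcal{T}\}$ is a partition of $\mathbb{Z}$. Universal Tiling Conjecture UTC($p$), for a fixed $p\in\mathbb{N}$: Let $\Gamma=\{\lambda_0=0,\lambda_1,\dots,\lambda_{p-1}\}$ be a subset of $\mathbb{R}$ with $p$ elements, and assume $\Gamma$ has a spectrum of the form $\frac1pA$ with $A\subset\mathbb{Z}$. Then for every finite family $A_1,\dots,A_n$ of subsets of $\mathbb{Z}$ such that $\frac1pA_i$ is a spectrum for $\Gamma$ for all $i$, there exists a common tiling set $\mathcal{T}\subset\mathbb{Z}$ such that $A_i$ tiles $\mathbb{Z}$ by $\mathcal{T}$ for all $i\in\{1,\dots,n\}$. *)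

theory Defs
  imports "HOL-Probability.Giry_Monad"
begin

text \<open>Elements of \<open>L\<^sup>2(M)\<close> are represented by complex-valued functions rather than by
  classes modulo equality almost everywhere.\<close>

definition square_integrable :: "'a measure \<Rightarrow> ('a \<Rightarrow> complex) \<Rightarrow> bool" where
  "square_integrable M f \<longleftrightarrow>
     f \<in> borel_measurable M \<and> integrable M (\<lambda>x. (cmod (f x))\<^sup>2)"

definition L2_inner :: "'a measure \<Rightarrow> ('a \<Rightarrow> complex) \<Rightarrow> ('a \<Rightarrow> complex) \<Rightarrow> complex" where
  "L2_inner M f g = (\<integral>x. f x * cnj (g x) \<partial>M)"

text \<open>Completeness is density of the complex linear span in the norm of \<open>L\<^sup>2(M)\<close>; all integrands
  below are integrable, so no integral takes the default value \<open>0\<close>.\<close>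

definition L2_orthogonal_basis :: "'a measure \<Rightarrow> 'i set \<Rightarrow> ('i \<Rightarrow> 'a \<Rightarrow> complex) \<Rightarrow> bool" where
  "L2_orthogonal_basis M I b \<longleftrightarrow>
     (\<forall>i\<in>I. square_integrable M (b i) \<and> L2_inner M (b i) (b i) \<noteq> 0) \<and>
     pairwise (\<lambda>i j. L2_inner M (b i) (b j) = 0) I \<and>
     (\<forall>f. square_integrable M f \<longrightarrow>
        (\<forall>\<epsilon>>0. \<exists>F c. finite F \<and> F \<subseteq> I \<and>
           (\<integral>x. (cmod (f x - (\<Sum>i\<in>F. c i * b i x)))\<^sup>2 \<partial>M) < \<epsilon>))"

definition expo :: "real \<Rightarrow> real \<Rightarrow> complex" where
  "expo l x = exp (2 * of_real pi * \<i> * of_real l * of_real x)"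

definition is_spectrum :: "real set \<Rightarrow> real set \<Rightarrow> bool" where
  "is_spectrum \<Omega> \<Lambda> \<longleftrightarrow>
     \<Omega> \<in> lmeasurable \<and> measure lebesgue \<Omega> > 0 \<and>
     L2_orthogonal_basis (lebesgue_on \<Omega>) \<Lambda> expo"

definition spectral_set :: "real set \<Rightarrow> bool" where
  "spectral_set \<Omega> \<longleftrightarrow> (\<exists>\<Lambda>. is_spectrum \<Omega> \<Lambda>)"

text \<open>A period is a positive real number; integrality for \<open>\<Omega>\<close> of measure 1 is not built in.\<close>

definition has_period :: "real set \<Rightarrow> real \<Rightarrow> bool" where
  "has_period \<Lambda> p \<longleftrightarrow> p > 0 \<and> (+) p ` \<Lambda> = \<Lambda>"

text \<open>A tiling is read as a family indexed by \<open>T\<close>: distinct translation parameters give disjoint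
  translates (up to null sets in \<open>\<real>\<close>).\<close>

definition tiles_real :: "real set \<Rightarrow> real set \<Rightarrow> bool" where
  "tiles_real \<Omega> T \<longleftrightarrow>
     pairwise (\<lambda>s t. ((+) s ` \<Omega>) \<inter> ((+) t ` \<Omega>) \<in> null_sets lebesgue) T \<and>
     - (\<Union>t\<in>T. (+) t ` \<Omega>) \<in> null_sets lebesgue"

definition tiles_int :: "int set \<Rightarrow> int set \<Rightarrow> bool" where
  "tiles_int A T \<longleftrightarrow>
     disjoint_family_on (\<lambda>t. (+) t ` A) T \<and> (\<Union>t\<in>T. (+) t ` A) = UNIV"

definition dirac_sum :: "real set \<Rightarrow> real measure" where
  "dirac_sum A = measure_of UNIV (sets borel) (\<lambda>B. \<Sum>a\<in>A. emeasure (return borel a) B)"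

lemma space_dirac_sum [simp]: "space (dirac_sum A) = UNIV"
  unfolding dirac_sum_def by (rule space_measure_of) simp

lemma sets_dirac_sum [simp, measurable_cong]: "sets (dirac_sum A) = sets borel"
  using sets.sets_measure_of_eq[of "borel :: real measure"] unfolding dirac_sum_def by simp

lemma emeasure_dirac_sum:
  assumes "B \<in> sets borel"
  shows "emeasure (dirac_sum A) B = (\<Sum>a\<in>A. indicator B a)"
proof -
  have "emeasure (dirac_sum A) B = (\<Sum>a\<in>A. emeasure (return borel a) B)"
    unfolding dirac_sum_def
  proof (rule emeasure_measure_of_sigma)
    show "sigma_algebra UNIV (sets (borel :: real measure))"
      using sets.sigma_algebra_axioms[of "borel :: real measure"] by simp
    show "positive (sets borel) (\<lambda>B. \<Sum>a\<in>A. emeasure (return borel a) B)"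
      by (simp add: positive_def)
    show "countably_additive (sets borel) (\<lambda>B. \<Sum>a\<in>A. emeasure (return borel a) B)"
    proof (rule countably_additiveI)
      fix C :: "nat \<Rightarrow> real set"
      assume C: "range C \<subseteq> sets borel" "disjoint_family C"
      have "(\<Sum>i. \<Sum>a\<in>A. emeasure (return borel a) (C i)) =
            (\<Sum>a\<in>A. \<Sum>i. emeasure (return borel a) (C i))"
        by (rule suminf_sum) auto
      also have "\<dots> = (\<Sum>a\<in>A. emeasure (return borel a) (\<Union>i. C i))"
        using C by (intro sum.cong refl suminf_emeasure) auto
      finally show "(\<Sum>i. \<Sum>a\<in>A. emeasure (return borel a) (C i)) =
            (\<Sum>a\<in>A. emeasure (return borel a) (\<Union>i. C i))" .
    qed
  qed (use assms in auto)
  with assms show ?thesis by simp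
qed

definition is_finite_spectrum :: "real set \<Rightarrow> real set \<Rightarrow> bool" where
  "is_finite_spectrum A \<Lambda> \<longleftrightarrow>
     finite A \<and> finite \<Lambda> \<and> L2_orthogonal_basis (dirac_sum A) \<Lambda> expo"

definition scaled_int :: "real \<Rightarrow> int set \<Rightarrow> real set" where
  "scaled_int p A = (\<lambda>k. of_int k / p) ` A"

definition UTC :: "nat \<Rightarrow> bool" where
  "UTC p \<longleftrightarrow>
     (\<forall>\<Gamma>. finite \<Gamma> \<and> card \<Gamma> = p \<and> 0 \<in> \<Gamma> \<and>
          (\<exists>A. is_finite_spectrum \<Gamma> (scaled_int (real p) A)) \<longrightarrow>
        (\<forall>(n::nat) A. (\<forall>i\<in>{1..n}. is_finite_spectrum \<Gamma> (scaled_int (real p) (A i))) \<longrightarrow>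
           (\<exists>T. \<forall>i\<in>{1..n}. tiles_int (A i) T)))"

end

theory Submission
  imports Defs "HOL-Complex_Analysis.Complex_Analysis" "HOL-Real_Asymp.Real_Asymp"
begin

text \<open>
  A spectrum \<open>\<Lambda>\<close> of a bounded set \<open>\<Omega>\<close> has locally finite differences (they are zeros of the entire
  Fourier transform of \<open>\<Omega>\<close>) and bounded gaps, and its restriction to a long enough window determines
  everything to the right of that window, because a finite trigonometric sum with positive separated
  frequencies and bounded coefficients cannot approximate 1 in \<open>L\<^sup>2(\<Omega>)\<close>. By pigeonhole \<open>\<Lambda>\<close> has a
  period \<open>T\<close>. Write \<open>\<Omega>\<close> as a family of fibres \<open>{k. x + k / T \<in> \<Omega>}\<close> over \<open>x \<in> [0, 1/T)\<close>; almost every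
  fibre is a spectrum, up to scaling, of the finite set \<open>\<Lambda> \<inter> [0, T)\<close>, and only finitely many
  fibres occur. The Universal Tiling Conjecture gives them a common tiling set, which tiles the line
  with \<open>\<Omega>\<close>.

  Conversely, given \<open>A\<^sub>1, \<dots>, A\<^sub>n\<close>, let \<open>\<Omega>\<close> have the \<open>A\<^sub>i\<close> as its fibres over the cells of an equal
  subdivision of \<open>[0, 1/p)\<close>. It is spectral, hence tiles; the tiling can be read off on the grid of
  cells, and comparing sums of elements over consecutive residue classes shows that all translation
  parameters lie in a single residue class modulo the number of cells, so the quotients tile with
  every \<open>A\<^sub>i\<close>.
\<close>

section \<open>Orthogonal bases of \<open>L\<^sup>2\<close>\<close>

text \<open>Determinism to the right is a quantitative Hardy space uniqueness statement. A sum with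
  positive frequencies extends analytically to the upper half plane and is small high up, so
  \<open>1 - sum\<close> is about 1 there; a function that is tiny on a set of positive measure
  cannot do this. The set may have gaps of any shape, so no orthogonality on an interval is
  available, and the lower bound must be uniform over all finite sums.

  The period \<open>T\<close> fixes \<open>q = 1 / T\<close>. Orthogonality to all shifts of a
  frequency by multiples of \<open>T\<close> says that functions folded modulo \<open>q\<close> have
  at most one nonzero Fourier coefficient, hence are constant almost everywhere; this gives almost
  all fibres the common cardinality \<open>p = |S| T\<close>. Rescaling the frequencies by
  \<open>|S|\<close> brings the fibres to the form \<open>A / p\<close> of the conjecture.

  In the converse the obstacle is that different translates may place different \<open>A i\<close>
  over the same cell, so a common tiling set cannot be read off directly. Normalised element sums,
  with the first set repeated in the last cell, make such mixing visible in a count modulo the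
  period of the tiling.\<close>

lemma expo_cis: "expo l x = cis (2 * pi * l * x)"
  unfolding expo_def cis_conv_exp by (rule arg_cong[where f = exp]) simp

lemma norm_expo [simp]: "cmod (expo l x) = 1"
  by (simp add: expo_cis)

lemma expo_0 [simp]: "expo 0 x = 1" "expo l 0 = 1"
  by (simp_all add: expo_def)

lemma cnj_expo: "cnj (expo l x) = expo (- l) x"
  by (simp add: expo_cis cis_cnj)

lemma expo_mult: "expo l x * expo m x = expo (l + m) x"
  by (simp add: expo_cis cis_mult algebra_simps)

lemma expo_add_right: "expo l (x + y) = expo l x * expo l y"
  by (simp add: expo_cis cis_mult algebra_simps)

lemma expo_mult_cnj: "expo l x * cnj (expo m x) = expo (l - m) x"
  by (simp add: cnj_expo expo_mult)

lemma expo_commute: "expo l x = expo x l"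
  by (simp add: expo_cis mult.commute mult.left_commute)

lemma expo_Ints: "l * x \<in> \<int> \<Longrightarrow> expo l x = 1"
proof -
  assume "l * x \<in> \<int>"
  then obtain k where k: "l * x = of_int k" by (auto elim: Ints_cases)
  have "expo l x = cis (2 * pi * of_int k)"
    by (simp add: expo_cis mult.assoc k)
  then show ?thesis by (simp add: cis_multiple_2pi)
qed

lemma continuous_on_expo [continuous_intros]: "continuous_on S (expo l)"
  unfolding expo_def by (intro continuous_intros)

lemma measurable_expo [measurable]: "expo l \<in> borel_measurable borel"
  by (intro borel_measurable_continuous_onI continuous_on_expo)

lemma measurable_expo_lebesgue [measurable]:
  "expo l \<in> borel_measurable (lebesgue_on S)" "expo l \<in> borel_measurable lebesgue"
  "expo l \<in> borel_measurable lborel"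
proof -
  show 1: "expo l \<in> borel_measurable lborel" by measurable
  show "expo l \<in> borel_measurable lebesgue"
    by (rule measurable_completion[OF 1])
  then show "expo l \<in> borel_measurable (lebesgue_on S)"
    by (rule measurable_restrict_space1)
qed

section \<open>Square-integrable functions, inner products and orthogonal sums\<close>

definition L2_norm_sq :: "'a measure \<Rightarrow> ('a \<Rightarrow> complex) \<Rightarrow> real" where
  "L2_norm_sq M f = (\<integral>x. (cmod (f x))\<^sup>2 \<partial>M)"

lemma L2_norm_sq_nonneg [simp]: "L2_norm_sq M f \<ge> 0"
  by (simp add: L2_norm_sq_def)

lemma square_integrableD:
  assumes "square_integrable M f"
  shows "f \<in> borel_measurable M" "integrable M (\<lambda>x. (cmod (f x))\<^sup>2)"
  using assms by (auto simp: square_integrable_def)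

lemma square_integrable_mult:
  assumes "square_integrable M f" "square_integrable M g"
  shows "integrable M (\<lambda>x. f x * g x)"
proof (rule Bochner_Integration.integrable_bound)
  show "integrable M (\<lambda>x. (cmod (f x))\<^sup>2 + (cmod (g x))\<^sup>2)"
    using assms by (auto simp: square_integrable_def)
  show "(\<lambda>x. f x * g x) \<in> borel_measurable M"
    using assms by (auto simp: square_integrable_def)
  have "cmod (f x * g x) \<le> norm ((cmod (f x))\<^sup>2 + (cmod (g x))\<^sup>2)" for x
  proof -
    have "0 \<le> cmod (f x) * cmod (g x)" by simp
    then show ?thesis
      using sum_squares_bound[of "cmod (f x)" "cmod (g x)"] unfolding norm_mult real_norm_def by linarith
  qed
  then show "AE x in M. cmod (f x * g x) \<le> norm ((cmod (f x))\<^sup>2 + (cmod (g x))\<^sup>2)" by simp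
qed

lemma borel_measurable_cnj_comp:
  "f \<in> borel_measurable M \<Longrightarrow> (\<lambda>x. cnj (f x)) \<in> borel_measurable M"
  by (rule borel_measurable_continuous_on[where f = cnj]) (auto intro: continuous_intros)

lemma square_integrable_cnj:
  "square_integrable M f \<Longrightarrow> square_integrable M (\<lambda>x. cnj (f x))"
  by (simp add: square_integrable_def borel_measurable_cnj_comp)

lemma integrable_inner:
  assumes "square_integrable M f" "square_integrable M g"
  shows "integrable M (\<lambda>x. f x * cnj (g x))"
  using square_integrable_mult[OF assms(1) square_integrable_cnj[OF assms(2)]] .

lemma square_integrable_scale:
  "square_integrable M f \<Longrightarrow> square_integrable M (\<lambda>x. c * f x)"
  by (auto simp: square_integrable_def norm_mult power_mult_distrib)

lemma square_integrable_add:
  assumes "square_integrable M f" "square_integrable M g"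
  shows "square_integrable M (\<lambda>x. f x + g x)"
  unfolding square_integrable_def
proof
  show "(\<lambda>x. f x + g x) \<in> borel_measurable M"
    using assms by (auto simp: square_integrable_def)
  have "integrable M (\<lambda>x. 2 * ((cmod (f x))\<^sup>2 + (cmod (g x))\<^sup>2))"
    using assms by (auto simp: square_integrable_def)
  then show "integrable M (\<lambda>x. (cmod (f x + g x))\<^sup>2)"
  proof (rule Bochner_Integration.integrable_bound)
    show "(\<lambda>x. (cmod (f x + g x))\<^sup>2) \<in> borel_measurable M"
      using assms by (auto simp: square_integrable_def)
    have "(cmod (f x + g x))\<^sup>2 \<le> 2 * ((cmod (f x))\<^sup>2 + (cmod (g x))\<^sup>2)" for x
    proof -
      have "(cmod (f x + g x))\<^sup>2 \<le> (cmod (f x) + cmod (g x))\<^sup>2"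
        by (intro power_mono norm_triangle_ineq norm_ge_zero)
      also have "\<dots> \<le> 2 * ((cmod (f x))\<^sup>2 + (cmod (g x))\<^sup>2)"
        using sum_squares_bound[of "cmod (f x)" "cmod (g x)"] by (simp add: power2_sum)
      finally show ?thesis .
    qed
    then show "AE x in M. norm ((cmod (f x + g x))\<^sup>2) \<le>
        norm (2 * ((cmod (f x))\<^sup>2 + (cmod (g x))\<^sup>2))" by simp
  qed
qed

lemma square_integrable_zero [simp]: "square_integrable M (\<lambda>x. 0)"
  by (simp add: square_integrable_def)

lemma square_integrable_sum:
  "(\<And>i. i \<in> F \<Longrightarrow> square_integrable M (f i)) \<Longrightarrow> square_integrable M (\<lambda>x. \<Sum>i\<in>F. f i x)"
  by (induction F rule: infinite_finite_induct) (auto intro: square_integrable_add)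

lemma square_integrable_diff:
  assumes "square_integrable M f" "square_integrable M g"
  shows "square_integrable M (\<lambda>x. f x - g x)"
  using square_integrable_add[OF assms(1) square_integrable_scale[OF assms(2), of "-1"]] by simp

lemma (in finite_measure) square_integrable_bounded:
  assumes "f \<in> borel_measurable M" "\<And>x. x \<in> space M \<Longrightarrow> cmod (f x) \<le> C"
  shows "square_integrable M f"
  unfolding square_integrable_def
proof
  show "integrable M (\<lambda>x. (cmod (f x))\<^sup>2)"
    by (rule integrable_const_bound[where B = "C\<^sup>2"])
      (use assms in \<open>auto intro!: AE_I2 power_mono\<close>)
qed (rule assms)

lemma L2_inner_self: "L2_inner M f f = of_real (L2_norm_sq M f)"
  by (simp add: L2_inner_def L2_norm_sq_def complex_norm_square[symmetric] del: of_real_power)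

lemma L2_inner_add_left:
  assumes "square_integrable M f" "square_integrable M g" "square_integrable M h"
  shows "L2_inner M (\<lambda>x. f x + g x) h = L2_inner M f h + L2_inner M g h"
  using assms by (simp add: L2_inner_def distrib_right integrable_inner)

lemma L2_inner_scale_left: "L2_inner M (\<lambda>x. c * f x) h = c * L2_inner M f h"
  by (simp add: L2_inner_def mult.assoc)

lemma L2_inner_diff_left:
  assumes "square_integrable M f" "square_integrable M g" "square_integrable M h"
  shows "L2_inner M (\<lambda>x. f x - g x) h = L2_inner M f h - L2_inner M g h"
  using assms by (simp add: L2_inner_def left_diff_distrib integrable_inner)

lemma L2_inner_sum_left:
  assumes "\<And>i. i \<in> F \<Longrightarrow> square_integrable M (f i)" "square_integrable M h"
  shows "L2_inner M (\<lambda>x. \<Sum>i\<in>F. f i x) h = (\<Sum>i\<in>F. L2_inner M (f i) h)"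
  using assms by (simp add: L2_inner_def sum_distrib_right integrable_inner)

lemma L2_inner_cnj: "L2_inner M g f = cnj (L2_inner M f g)"
proof -
  have "(\<lambda>x. g x * cnj (f x)) = (\<lambda>x. cnj (f x * cnj (g x)))"
    by (auto simp: mult.commute)
  then show ?thesis
    unfolding L2_inner_def by (simp only: Bochner_Integration.integral_cnj)
qed

lemma L2_inner_zero_sym: "L2_inner M g f = 0 \<longleftrightarrow> L2_inner M f g = 0"
  by (metis L2_inner_cnj complex_cnj_zero)

lemma L2_inner_add_right:
  assumes "square_integrable M f" "square_integrable M g" "square_integrable M h"
  shows "L2_inner M h (\<lambda>x. f x + g x) = L2_inner M h f + L2_inner M h g"
  using L2_inner_add_left[OF assms] by (metis L2_inner_cnj complex_cnj_add)

lemma L2_inner_scale_right: "L2_inner M h (\<lambda>x. c * f x) = cnj c * L2_inner M h f"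
  by (metis L2_inner_cnj L2_inner_scale_left complex_cnj_mult)

lemma L2_pythagoras:
  assumes f: "square_integrable M f" and g: "square_integrable M g" and "L2_inner M f g = 0"
  shows "L2_norm_sq M (\<lambda>x. f x + g x) = L2_norm_sq M f + L2_norm_sq M g"
proof -
  note fg = square_integrable_add[OF f g]
  have "L2_inner M g f = 0"
    using assms(3) L2_inner_zero_sym[of M f g] by simp
  then have "L2_inner M (\<lambda>x. f x + g x) (\<lambda>x. f x + g x) = L2_inner M f f + L2_inner M g g"
    using assms(3) L2_inner_add_right[OF f g f] L2_inner_add_right[OF f g g]
    by (simp add: L2_inner_add_left[OF f g fg])
  then show ?thesis
    by (simp only: L2_inner_self of_real_add[symmetric] of_real_eq_iff)
qed

lemma L2_norm_sq_scale: "L2_norm_sq M (\<lambda>x. c * f x) = (cmod c)\<^sup>2 * L2_norm_sq M f"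
  by (simp add: L2_norm_sq_def norm_mult power_mult_distrib)

lemma L2_norm_sq_orthogonal_sum:
  assumes "finite F" "\<And>i. i \<in> F \<Longrightarrow> square_integrable M (b i)"
    and "pairwise (\<lambda>i j. L2_inner M (b i) (b j) = 0) F"
  shows "L2_norm_sq M (\<lambda>x. \<Sum>i\<in>F. c i * b i x) = (\<Sum>i\<in>F. (cmod (c i))\<^sup>2 * L2_norm_sq M (b i))"
  using assms
proof (induction F)
  case empty
  then show ?case by (simp add: L2_norm_sq_def)
next
  case (insert j F)
  have "L2_inner M (\<lambda>x. \<Sum>i\<in>F. c i * b i x) (\<lambda>x. c j * b j x) =
      (\<Sum>i\<in>F. L2_inner M (\<lambda>x. c i * b i x) (\<lambda>x. c j * b j x))"
    using insert.prems by (intro L2_inner_sum_left) (auto intro: square_integrable_scale)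
  also have "\<dots> = 0"
  proof (intro sum.neutral ballI)
    fix i assume i: "i \<in> F"
    then have "L2_inner M (b j) (b i) = 0"
      using insert.prems insert.hyps by (auto simp: pairwise_def)
    then show "L2_inner M (\<lambda>x. c i * b i x) (\<lambda>x. c j * b j x) = 0"
      using i insert.prems insert.hyps L2_inner_zero_sym
      by (auto simp: L2_inner_scale_left L2_inner_scale_right pairwise_def)
  qed
  finally have "L2_inner M (\<lambda>x. c j * b j x) (\<lambda>x. \<Sum>i\<in>F. c i * b i x) = 0"
    using L2_inner_zero_sym by blast
  then have "L2_norm_sq M (\<lambda>x. c j * b j x + (\<Sum>i\<in>F. c i * b i x)) =
     L2_norm_sq M (\<lambda>x. c j * b j x) + L2_norm_sq M (\<lambda>x. \<Sum>i\<in>F. c i * b i x)"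
    using insert.prems
    by (intro L2_pythagoras) (auto intro!: square_integrable_sum square_integrable_scale)
  then show ?case
    using insert.prems insert.hyps
    by (simp add: L2_norm_sq_scale insert.IH pairwise_insert)
qed

text \<open>The factor 2 comes from \<open>(a + b)\<^sup>2 \<le> 2 a\<^sup>2 + 2 b\<^sup>2\<close>
  and stands in for Minkowski's inequality; the applications choose their error terms small enough
  to absorb it.\<close>

lemma L2_norm_sq_add_le:
  assumes "square_integrable M f" "square_integrable M g"
  shows "L2_norm_sq M (\<lambda>x. f x + g x) \<le> 2 * L2_norm_sq M f + 2 * L2_norm_sq M g"
proof -
  have "L2_norm_sq M (\<lambda>x. f x + g x) \<le> (\<integral>x. 2 * (cmod (f x))\<^sup>2 + 2 * (cmod (g x))\<^sup>2 \<partial>M)"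
    unfolding L2_norm_sq_def
  proof (rule integral_mono)
    show "integrable M (\<lambda>x. (cmod (f x + g x))\<^sup>2)"
      using square_integrable_add[OF assms] by (simp add: square_integrable_def)
    show "integrable M (\<lambda>x. 2 * (cmod (f x))\<^sup>2 + 2 * (cmod (g x))\<^sup>2)"
      using assms by (simp add: square_integrable_def)
    fix x
    have "(cmod (f x + g x))\<^sup>2 \<le> (cmod (f x) + cmod (g x))\<^sup>2"
      by (intro power_mono norm_triangle_ineq norm_ge_zero)
    also have "\<dots> \<le> 2 * (cmod (f x))\<^sup>2 + 2 * (cmod (g x))\<^sup>2"
      using sum_squares_bound[of "cmod (f x)" "cmod (g x)"] by (simp add: power2_sum)
    finally show "(cmod (f x + g x))\<^sup>2 \<le> 2 * (cmod (f x))\<^sup>2 + 2 * (cmod (g x))\<^sup>2" .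
  qed
  also have "\<dots> = 2 * L2_norm_sq M f + 2 * L2_norm_sq M g"
    using assms by (simp add: L2_norm_sq_def square_integrable_def)
  finally show ?thesis .
qed

section \<open>Fourier coefficients with respect to an orthogonal basis\<close>

definition fourier_coeff :: "'a measure \<Rightarrow> ('i \<Rightarrow> 'a \<Rightarrow> complex) \<Rightarrow> ('a \<Rightarrow> complex) \<Rightarrow> 'i \<Rightarrow> complex" where
  "fourier_coeff M b f i = L2_inner M f (b i) / L2_inner M (b i) (b i)"

context
  fixes M :: "'a measure" and I :: "'i set" and b :: "'i \<Rightarrow> 'a \<Rightarrow> complex"
  assumes basis: "L2_orthogonal_basis M I b"
begin

lemma basis_square_integrable: "i \<in> I \<Longrightarrow> square_integrable M (b i)"
  using basis unfolding L2_orthogonal_basis_def by blast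

lemma basis_orthogonal: "i \<in> I \<Longrightarrow> j \<in> I \<Longrightarrow> i \<noteq> j \<Longrightarrow> L2_inner M (b i) (b j) = 0"
  using basis unfolding L2_orthogonal_basis_def pairwise_def by blast

lemma partial_sum_square_integrable:
  "F \<subseteq> I \<Longrightarrow> square_integrable M (\<lambda>x. \<Sum>i\<in>F. c i * b i x)"
  by (intro square_integrable_sum square_integrable_scale basis_square_integrable) auto

lemma inner_partial_sum:
  assumes "finite F" "F \<subseteq> I" "j \<in> F"
  shows "L2_inner M (\<lambda>x. \<Sum>i\<in>F. c i * b i x) (b j) = c j * L2_inner M (b j) (b j)"
proof -
  have "L2_inner M (\<lambda>x. \<Sum>i\<in>F. c i * b i x) (b j) = (\<Sum>i\<in>F. c i * L2_inner M (b i) (b j))"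
    using assms by (subst L2_inner_sum_left)
      (auto simp: L2_inner_scale_left intro!: square_integrable_scale basis_square_integrable)
  also have "\<dots> = (\<Sum>i\<in>F. if i = j then c j * L2_inner M (b j) (b j) else 0)"
    using assms by (intro sum.cong) (auto simp: basis_orthogonal subsetD)
  finally show ?thesis using assms by simp
qed

lemma residual_orthogonal:
  assumes f: "square_integrable M f" and F: "finite F" "F \<subseteq> I" "j \<in> F"
  shows "L2_inner M (\<lambda>x. f x - (\<Sum>i\<in>F. fourier_coeff M b f i * b i x)) (b j) = 0"
proof -
  have "L2_inner M (b j) (b j) \<noteq> 0"
    using basis F unfolding L2_orthogonal_basis_def by blast
  with F show ?thesis
    by (subst L2_inner_diff_left[OF f partial_sum_square_integrable basis_square_integrable])
      (auto simp: inner_partial_sum simp: fourier_coeff_def[of M b f j])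
qed

lemma residual_orthogonal_sum:
  assumes f: "square_integrable M f" and F: "finite F" "F \<subseteq> I"
  shows "L2_inner M (\<lambda>x. f x - (\<Sum>i\<in>F. fourier_coeff M b f i * b i x)) (\<lambda>x. \<Sum>i\<in>F. c i * b i x) = 0"
proof -
  have g: "square_integrable M (\<lambda>x. f x - (\<Sum>i\<in>F. fourier_coeff M b f i * b i x))"
    by (intro square_integrable_diff f partial_sum_square_integrable F)
  have "L2_inner M (\<lambda>x. \<Sum>i\<in>F. c i * b i x) (\<lambda>x. f x - (\<Sum>i\<in>F. fourier_coeff M b f i * b i x)) =
     (\<Sum>j\<in>F. c j * L2_inner M (b j) (\<lambda>x. f x - (\<Sum>i\<in>F. fourier_coeff M b f i * b i x)))"
    using F by (subst L2_inner_sum_left[OF _ g])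
      (auto simp: L2_inner_scale_left intro!: square_integrable_scale basis_square_integrable)
  also have "\<dots> = 0"
  proof (intro sum.neutral ballI)
    fix j assume "j \<in> F"
    then have "L2_inner M (b j) (\<lambda>x. f x - (\<Sum>i\<in>F. fourier_coeff M b f i * b i x)) = 0"
      using residual_orthogonal[OF f F] L2_inner_zero_sym by blast
    then show "c j * L2_inner M (b j) (\<lambda>x. f x - (\<Sum>i\<in>F. fourier_coeff M b f i * b i x)) = 0"
      by simp
  qed
  finally show ?thesis using L2_inner_zero_sym by blast
qed

text \<open>Pythagoras for the partial sum and the residual; dropping the residual gives Bessel's
  inequality.\<close>

lemma residual_norm:
  assumes f: "square_integrable M f" and F: "finite F" "F \<subseteq> I"
  shows "L2_norm_sq M f = L2_norm_sq M (\<lambda>x. f x - (\<Sum>i\<in>F. fourier_coeff M b f i * b i x)) +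
    (\<Sum>i\<in>F. (cmod (fourier_coeff M b f i))\<^sup>2 * L2_norm_sq M (b i))"
proof -
  have "L2_norm_sq M (\<lambda>x. (f x - (\<Sum>i\<in>F. fourier_coeff M b f i * b i x)) + (\<Sum>i\<in>F. fourier_coeff M b f i * b i x)) =
     L2_norm_sq M (\<lambda>x. f x - (\<Sum>i\<in>F. fourier_coeff M b f i * b i x)) +
     L2_norm_sq M (\<lambda>x. \<Sum>i\<in>F. fourier_coeff M b f i * b i x)"
    by (intro L2_pythagoras square_integrable_diff f partial_sum_square_integrable F residual_orthogonal_sum)
  also have "L2_norm_sq M (\<lambda>x. \<Sum>i\<in>F. fourier_coeff M b f i * b i x) =
     (\<Sum>i\<in>F. (cmod (fourier_coeff M b f i))\<^sup>2 * L2_norm_sq M (b i))"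
    using F by (intro L2_norm_sq_orthogonal_sum) (auto simp: pairwise_def basis_orthogonal subsetD basis_square_integrable)
  finally show ?thesis by simp
qed

text \<open>Best approximation: keeping the finite set \<open>F\<close> that completeness supplies
  but changing its coefficients to Fourier coefficients can only reduce the error, since the
  difference of the two sums is orthogonal to the residual.\<close>

lemma fourier_approx:
  assumes f: "square_integrable M f" and "\<epsilon> > 0"
  obtains F where "finite F" "F \<subseteq> I"
    "L2_norm_sq M (\<lambda>x. f x - (\<Sum>i\<in>F. fourier_coeff M b f i * b i x)) < \<epsilon>"
proof -
  obtain F c where F: "finite F" "F \<subseteq> I" and lt: "L2_norm_sq M (\<lambda>x. f x - (\<Sum>i\<in>F. c i * b i x)) < \<epsilon>"
    using basis assms unfolding L2_orthogonal_basis_def L2_norm_sq_def by blast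
  have "L2_norm_sq M (\<lambda>x. f x - (\<Sum>i\<in>F. c i * b i x)) =
     L2_norm_sq M (\<lambda>x. (f x - (\<Sum>i\<in>F. fourier_coeff M b f i * b i x)) + (\<Sum>i\<in>F. (fourier_coeff M b f i - c i) * b i x))"
    by (simp add: left_diff_distrib sum_subtractf)
  also have "\<dots> = L2_norm_sq M (\<lambda>x. f x - (\<Sum>i\<in>F. fourier_coeff M b f i * b i x)) +
       L2_norm_sq M (\<lambda>x. \<Sum>i\<in>F. (fourier_coeff M b f i - c i) * b i x)"
    by (intro L2_pythagoras square_integrable_diff f partial_sum_square_integrable F residual_orthogonal_sum)
  finally have "L2_norm_sq M (\<lambda>x. f x - (\<Sum>i\<in>F. fourier_coeff M b f i * b i x)) < \<epsilon>"
    using lt L2_norm_sq_nonneg[of M "\<lambda>x. \<Sum>i\<in>F. (fourier_coeff M b f i - c i) * b i x"] by linarith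
  with F that show ?thesis by blast
qed

lemma orthogonal_to_basis:
  assumes f: "square_integrable M f" and orth: "\<And>i. i \<in> I \<Longrightarrow> L2_inner M f (b i) = 0"
  shows "L2_norm_sq M f = 0"
proof (rule ccontr)
  assume "L2_norm_sq M f \<noteq> 0"
  then have "L2_norm_sq M f > 0"
    using L2_norm_sq_nonneg[of M f] by linarith
  then obtain F where F: "F \<subseteq> I" "L2_norm_sq M (\<lambda>x. f x - (\<Sum>i\<in>F. fourier_coeff M b f i * b i x)) < L2_norm_sq M f"
    by (rule fourier_approx[OF f])
  \<comment> \<open>All Fourier coefficients vanish, so the residual is \<open>f\<close> itself and
    cannot be smaller than \<open>f\<close>.\<close>
  have "(\<lambda>x. f x - (\<Sum>i\<in>F. fourier_coeff M b f i * b i x)) = f"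
    using F(1) orth by (auto simp: fourier_coeff_def fun_eq_iff intro!: sum.neutral)
  with F show False by simp
qed

end

lemma L2_norm_sq_eq_0:
  assumes "square_integrable M f" "L2_norm_sq M f = 0"
  shows "AE x in M. f x = 0"
  using assms integral_nonneg_eq_0_iff_AE[of M "\<lambda>x. (cmod (f x))\<^sup>2"]
  by (auto simp: square_integrable_def L2_norm_sq_def)

section \<open>Poisson kernel and trigonometric sums with separated frequencies\<close>

definition separated :: "real \<Rightarrow> real set \<Rightarrow> bool" where
  "separated d F \<longleftrightarrow> (\<forall>x\<in>F. \<forall>y\<in>F. x \<noteq> y \<longrightarrow> d \<le> \<bar>x - y\<bar>)"

lemma separated_subset: "separated d F \<Longrightarrow> G \<subseteq> F \<Longrightarrow> separated d G"
  by (auto simp: separated_def)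

lemma separated_mono: "separated d F \<Longrightarrow> e \<le> d \<Longrightarrow> separated e F"
  by (force simp: separated_def)

text \<open>Telescoping: an element \<open>c\<close> contributes at most
  \<open>(1 / (c - d) - 1 / c) / d\<close>, the mean of the inverse square over the gap of length
  \<open>d\<close> to its left. The bound \<open>b\<close> is carried along so that the induction
  can remove the largest element \<open>c\<close> and continue with the bound
  \<open>c - d\<close>.\<close>

lemma sum_inverse_squares_above:
  assumes "finite F" "d > 0" "L > d"
  shows "separated d F \<Longrightarrow> \<forall>x\<in>F. L \<le> x \<Longrightarrow> \<forall>x\<in>F. x \<le> b \<Longrightarrow> L - d \<le> b \<Longrightarrow>
    (\<Sum>x\<in>F. 1 / x\<^sup>2) \<le> (1 / (L - d) - 1 / b) / d"
  using assms(1)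
proof (induction F arbitrary: b rule: finite_linorder_max_induct)
  case empty
  then show ?case
    using assms by (auto simp: field_simps)
next
  case (insert c A)
  have c: "L \<le> c" "c \<le> b" using insert.prems by auto
  have "\<forall>x\<in>A. x \<le> c - d"
    using insert.hyps insert.prems by (fastforce simp: separated_def)
  then have "(\<Sum>x\<in>A. 1 / x\<^sup>2) \<le> (1 / (L - d) - 1 / (c - d)) / d"
    using insert.prems c by (intro insert.IH) (auto intro: separated_subset)
  moreover have "1 / c\<^sup>2 \<le> (1 / (c - d) - 1 / c) / d"
  proof -
    have "(1 / (c - d) - 1 / c) / d = 1 / (c * (c - d))"
      using c assms by (simp add: field_simps)
    also have "\<dots> \<ge> 1 / c\<^sup>2"
      using c assms by (intro divide_left_mono) (auto simp: power2_eq_square)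
    finally show ?thesis .
  qed
  moreover have "1 / b \<le> 1 / c"
    using c assms by (intro divide_left_mono) auto
  moreover have "c \<notin> A" using insert.hyps by auto
  ultimately have "(\<Sum>x\<in>insert c A. 1 / x\<^sup>2) \<le> (1 / (L - d) - 1 / (c - d)) / d + (1 / (c - d) - 1 / c) / d"
    using insert.hyps by simp
  also have "\<dots> = (1 / (L - d) - 1 / c) / d"
    by (simp add: diff_divide_distrib)
  also have "\<dots> \<le> (1 / (L - d) - 1 / b) / d"
    using \<open>1 / b \<le> 1 / c\<close> assms by (intro divide_right_mono) auto
  finally show ?case .
qed

lemma sum_inverse_squares_pos:
  assumes "finite F" "d > 0" "L > d" "separated d F" "\<forall>x\<in>F. L \<le> x"
  shows "(\<Sum>x\<in>F. 1 / x\<^sup>2) \<le> 1 / (d * (L - d))"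
proof -
  define b where "b = Max (insert L F)"
  have b: "\<forall>x\<in>F. x \<le> b" "L \<le> b"
    using assms by (auto simp: b_def)
  have "(\<Sum>x\<in>F. 1 / x\<^sup>2) \<le> (1 / (L - d) - 1 / b) / d"
    using assms b by (intro sum_inverse_squares_above) auto
  also have "\<dots> \<le> (1 / (L - d)) / d"
    using assms b by (intro divide_right_mono) auto
  finally show ?thesis by (simp add: mult.commute)
qed

lemma sum_inverse_squares:
  assumes "finite F" "d > 0" "L > d" "separated d F" "\<forall>x\<in>F. L \<le> \<bar>x\<bar>"
  shows "(\<Sum>x\<in>F. 1 / x\<^sup>2) \<le> 2 / (d * (L - d))"
proof -
  define P where "P = {x\<in>F. x > 0}"
  define N where "N = {x\<in>F. x < 0}"
  have "F = P \<union> N" "P \<inter> N = {}" using assms by (force simp: P_def N_def)+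
  moreover have fin: "finite P" "finite N" using assms by (auto simp: P_def N_def)
  ultimately have "(\<Sum>x\<in>F. 1 / x\<^sup>2) = (\<Sum>x\<in>P. 1 / x\<^sup>2) + (\<Sum>x\<in>N. 1 / x\<^sup>2)"
    by (simp add: sum.union_disjoint)
  also have "(\<Sum>x\<in>P. 1 / x\<^sup>2) \<le> 1 / (d * (L - d))"
    using assms fin by (intro sum_inverse_squares_pos) (auto simp: P_def separated_def)
  also have "(\<Sum>x\<in>N. 1 / x\<^sup>2) = (\<Sum>x\<in>uminus ` N. 1 / x\<^sup>2)"
    by (subst sum.reindex) auto
  also have "\<dots> \<le> 1 / (d * (L - d))"
    using assms fin by (intro sum_inverse_squares_pos) (auto simp: N_def separated_def abs_minus_commute)
  finally show ?thesis by simp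
qed

lemma sum_inverse_squares_centered:
  assumes "finite F" "d > 0" "separated d F" "y \<in> F"
  shows "(\<Sum>x\<in>F - {y}. 1 / (x - y)\<^sup>2) \<le> 8 / d\<^sup>2"
proof -
  have "(\<Sum>x\<in>F - {y}. 1 / (x - y)\<^sup>2) = (\<Sum>x\<in>(\<lambda>x. x - y) ` (F - {y}). 1 / x\<^sup>2)"
    by (subst sum.reindex) (auto simp: inj_on_def)
  \<comment> \<open>\<open>sum_inverse_squares\<close> wants a threshold strictly above the
    separation, so it is applied with separation \<open>d / 2\<close> and threshold
    \<open>d\<close>; this produces the constant 8.\<close>
  also have "\<dots> \<le> 2 / (d / 2 * (d - d / 2))"
    using assms by (intro sum_inverse_squares) (force simp: separated_def)+
  also have "\<dots> = 8 / d\<^sup>2" by (simp add: power2_eq_square)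
  finally show ?thesis .
qed

text \<open>Trades exponential damping for inverse squares, whose sums over separated sets are
  already controlled.\<close>

lemma exp_minus_le_inverse_square:
  fixes t :: real
  assumes "t > 0"
  shows "exp (- t) \<le> 2 / t\<^sup>2"
proof -
  have "t\<^sup>2 / 2 \<le> exp t"
    using exp_lower_Taylor_quadratic[of t] assms by linarith
  then have "1 / exp t \<le> 1 / (t\<^sup>2 / 2)"
    using assms by (intro divide_left_mono) auto
  then show ?thesis by (simp add: exp_minus inverse_eq_divide)
qed

section \<open>Poisson kernel and Poisson formula in the upper half plane\<close>

definition poisson :: "real \<Rightarrow> real \<Rightarrow> real" where
  "poisson Y x = Y / (pi * (x\<^sup>2 + Y\<^sup>2))"

lemma poisson_pos: "Y > 0 \<Longrightarrow> poisson Y x > 0"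
  by (simp add: poisson_def add_nonneg_pos)

lemma continuous_on_poisson [continuous_intros]:
  "Y > 0 \<Longrightarrow> continuous_on S g \<Longrightarrow> continuous_on S (\<lambda>x. poisson Y (g x))"
  unfolding poisson_def
  by (intro continuous_intros) (auto simp: sum_power2_eq_zero_iff)

lemma measurable_poisson [measurable]: "poisson Y \<in> borel_measurable borel"
  unfolding poisson_def by measurable

lemma poisson_le: "Y \<ge> 1 \<Longrightarrow> poisson Y x \<le> 1"
proof -
  assume Y: "Y \<ge> 1"
  have "Y * 1 \<le> Y * Y" using Y by (intro mult_left_mono) auto
  then have "Y \<le> 1 * (x\<^sup>2 + Y\<^sup>2)" by (simp add: power2_eq_square add_increasing)
  also have "\<dots> \<le> pi * (x\<^sup>2 + Y\<^sup>2)"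
    using pi_ge_two by (intro mult_right_mono) auto
  finally have "Y \<le> pi * (x\<^sup>2 + Y\<^sup>2)" .
  then show ?thesis
    using Y unfolding poisson_def by (intro divide_le_eq_1[THEN iffD2]) (auto simp: add_nonneg_pos)
qed

lemma poisson_integral:
  assumes Y: "Y > 0"
  shows "integrable lborel (poisson Y)" "integral\<^sup>L lborel (poisson Y) = 1"
proof -
  define F where "F x = arctan (x / Y) / pi" for x
  have D: "DERIV F x :> poisson Y x" for x
  proof -
    have nz: "x\<^sup>2 + Y\<^sup>2 \<noteq> 0"
      using Y by (simp add: sum_power2_eq_zero_iff)
    have "DERIV F x :> inverse (1 + (x / Y)\<^sup>2) * (1 / Y) / pi"
      using Y unfolding F_def by (auto intro!: derivative_eq_intros)
    also have "inverse (1 + (x / Y)\<^sup>2) * (1 / Y) / pi = poisson Y x"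
    proof -
      have "1 + (x / Y)\<^sup>2 = (x\<^sup>2 + Y\<^sup>2) / Y\<^sup>2"
        using Y by (simp add: field_simps)
      then show ?thesis
        using Y nz by (simp add: poisson_def power2_eq_square)
    qed
    finally show ?thesis .
  qed
  have lim1: "((F \<circ> real_of_ereal) \<longlongrightarrow> - 1 / 2) (at_right (-\<infinity>))"
  proof -
    have "filterlim (\<lambda>x. x / Y) at_bot at_bot"
      using filterlim_tendsto_pos_mult_at_bot[OF tendsto_const _ filterlim_ident, of "inverse Y"] Y
      by (simp add: divide_inverse mult.commute)
    then have "(F \<longlongrightarrow> (- (pi / 2)) / pi) at_bot"
      unfolding F_def by (intro tendsto_divide filterlim_compose[OF tendsto_arctan_at_bot] tendsto_const) auto
    then show ?thesis by (simp add: ereal_tendsto_simps1)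
  qed
  have lim2: "((F \<circ> real_of_ereal) \<longlongrightarrow> 1 / 2) (at_left \<infinity>)"
  proof -
    have "filterlim (\<lambda>x. x / Y) at_top at_top"
      using filterlim_tendsto_pos_mult_at_top[OF tendsto_const _ filterlim_ident, of "inverse Y"] Y
      by (simp add: divide_inverse mult.commute)
    then have "(F \<longlongrightarrow> (pi / 2) / pi) at_top"
      unfolding F_def by (intro tendsto_divide filterlim_compose[OF tendsto_arctan_at_top] tendsto_const) auto
    then show ?thesis by (simp add: ereal_tendsto_simps1)
  qed
  note FTC = interval_integral_FTC_nonneg[of "-\<infinity>" "\<infinity>" F "poisson Y", OF _ D _ _ lim1 lim2]
  have "isCont (poisson Y) x" for x
    using continuous_on_poisson[OF Y continuous_on_id, of UNIV] by (simp add: continuous_on_eq_continuous_at)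
  then show "integrable lborel (poisson Y)" "integral\<^sup>L lborel (poisson Y) = 1"
    using FTC poisson_pos[OF Y, THEN less_imp_le]
    by (auto simp: set_integrable_def interval_lebesgue_integral_def set_lebesgue_integral_def)
qed

text \<open>The segment \<open>[- R, R]\<close> is closed by the upper half circle, where quadratic
  decay leaves a contribution of order \<open>1 / R\<close>. Holomorphy slightly below the axis puts
  the whole contour inside a convex open set on which Cauchy's theorem applies.\<close>

lemma integral_real_line_eq_0:
  fixes h :: "complex \<Rightarrow> complex"
  assumes s: "s > 0" and hol: "h holomorphic_on {z. Im z > - s}"
    and Y: "Y > 0" and B: "\<And>z. Im z \<ge> 0 \<Longrightarrow> cmod z > Y \<Longrightarrow> cmod (h z) \<le> C / (cmod z - Y)\<^sup>2"
    and int: "integrable lborel (\<lambda>x. h (of_real x))"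
  shows "(\<integral>x. h (of_real x) \<partial>lborel) = 0"
proof -
  let ?S = "{z. Im z > - s}"
  have cont: "continuous_on UNIV (\<lambda>x. h (of_real x))"
    by (intro continuous_on_compose2[OF holomorphic_on_imp_continuous_on[OF hol]] continuous_intros)
      (use s in auto)
  have arc_bound: "cmod (integral {- R..R} (\<lambda>x. h (of_real x))) \<le> C / (R - Y)\<^sup>2 * R * pi"
    if R: "R > Y" for R
  proof -
    have C: "C \<ge> 0"
    proof -
      have "0 \<le> cmod (h (of_real R))" by simp
      also have "\<dots> \<le> C / (cmod (of_real R) - Y)\<^sup>2" using R Y by (intro B) auto
      finally show ?thesis using R Y by (simp add: zero_le_divide_iff)
    qed
    define l where "l = linepath (of_real (- R)) (of_real R :: complex)"
    define a where "a = part_circlepath 0 R 0 pi"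
    have Im_l: "Im z = 0" if "z \<in> path_image l" for z
      using that by (auto simp: l_def linepath_def path_image_def)
    have im_a: "cmod z = R \<and> Im z \<ge> 0" if "z \<in> path_image a" for z
    proof -
      from that obtain t where t: "0 \<le> t" "t \<le> pi" "z = of_real R * exp (\<i> * of_real t)"
        using R Y unfolding a_def by (auto simp: path_image_part_circlepath' closed_segment_eq_real_ivl cis_conv_exp)
      then have "z = of_real R * cis t" by (simp add: cis_conv_exp)
      then show ?thesis using t R Y by (auto simp: norm_mult sin_ge_zero)
    qed
    have sub: "path_image l \<subseteq> ?S" "path_image a \<subseteq> ?S"
      using Im_l im_a s by force+
    have ends: "pathfinish l = pathstart a" "pathfinish a = pathstart l"
      by (auto simp: l_def a_def exp_pi_i' exp_eq_polar)
    have conv: "convex ?S"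
      using convex_halfspace_Im_gt .
    have "(h has_contour_integral 0) (l +++ a)"
      using sub ends by (intro Cauchy_theorem_convex_simple[OF hol conv])
        (auto simp: path_image_join l_def a_def intro!: valid_path_join)
    moreover have hol': "h contour_integrable_on l" "h contour_integrable_on a"
      using sub hol by (auto intro!: contour_integrable_holomorphic_simple[of h ?S] open_halfspace_Im_gt simp: l_def a_def)
    ultimately have "contour_integral l h + contour_integral a h = 0"
      using ends contour_integral_join[OF hol'] by (simp add: l_def a_def contour_integral_unique)
    then have "cmod (contour_integral l h) = cmod (contour_integral a h)"
      by (simp add: add_eq_0_iff2)
    also have "\<dots> \<le> C / (R - Y)\<^sup>2 * R * \<bar>pi - 0\<bar>"
      unfolding a_def
    proof (rule contour_integral_bound_part_circlepath)
      show "h contour_integrable_on part_circlepath 0 R 0 pi" using hol' by (simp add: a_def)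
      show "cmod (h z) \<le> C / (R - Y)\<^sup>2" if "z \<in> path_image (part_circlepath 0 R 0 pi)" for z
        using im_a[of z] that B[of z] R Y by (auto simp: a_def)
    qed (use R Y C in auto)
    also have "contour_integral l h = integral {- R..R} (\<lambda>x. h (of_real x))"
      unfolding l_def using R Y by (subst contour_integral_linepath_Reals_eq) auto
    finally show ?thesis by simp
  qed
  have "(\<lambda>n. \<integral>x. indicator {- real n..real n} x *\<^sub>R h (of_real x) \<partial>lborel) \<longlonglongrightarrow> (\<integral>x. h (of_real x) \<partial>lborel)"
  proof (rule integral_dominated_convergence)
    show "(\<lambda>x. h (of_real x)) \<in> borel_measurable lborel"
      using int by auto
    show "(\<lambda>x. indicator {- real n..real n} x *\<^sub>R h (of_real x)) \<in> borel_measurable lborel" for n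
      using int by (intro borel_measurable_scaleR) auto
    show "integrable lborel (\<lambda>x. cmod (h (of_real x)))" using int by auto
    show "AE x in lborel. (\<lambda>n. indicator {- real n..real n} x *\<^sub>R h (of_real x)) \<longlonglongrightarrow> h (of_real x)"
    proof (rule AE_I2)
      fix x :: real
      obtain N where N: "\<bar>x\<bar> \<le> real N" using real_arch_simple by blast
      have "eventually (\<lambda>n. indicator {- real n..real n} x *\<^sub>R h (of_real x) = h (of_real x)) sequentially"
        using eventually_ge_at_top[of N] by eventually_elim (use N in \<open>auto simp: indicator_def\<close>)
      then show "(\<lambda>n. indicator {- real n..real n} x *\<^sub>R h (of_real x)) \<longlonglongrightarrow> h (of_real x)"
        by (rule tendsto_eventually)
    qed
    show "AE x in lborel. norm (indicator {- real n..real n} x *\<^sub>R h (of_real x)) \<le> cmod (h (of_real x))" for n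
      by (auto simp: indicator_def)
  qed
  moreover have "(\<lambda>n. \<integral>x. indicator {- real n..real n} x *\<^sub>R h (of_real x) \<partial>lborel) \<longlonglongrightarrow> 0"
  proof (rule Lim_null_comparison)
    show "(\<lambda>n. C / (real n - Y)\<^sup>2 * real n * pi) \<longlonglongrightarrow> 0"
      by real_asymp
    show "\<forall>\<^sub>F n in sequentially. norm (\<integral>x. indicator {- real n..real n} x *\<^sub>R h (of_real x) \<partial>lborel)
        \<le> C / (real n - Y)\<^sup>2 * real n * pi"
    proof -
      obtain N where N: "Y < real N" using reals_Archimedean2 by blast
      show ?thesis using eventually_ge_at_top[of N]
      proof eventually_elim
        case (elim n)
        have "(\<integral>x. indicator {- real n..real n} x *\<^sub>R h (of_real x) \<partial>lborel) =
            integral {- real n..real n} (\<lambda>x. h (of_real x))"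
          using set_borel_integral_eq_integral(2)[of "{- real n..real n}" "\<lambda>x. h (of_real x)"]
            borel_integrable_compact[of "{- real n..real n}" "\<lambda>x. h (of_real x)"] cont
          by (auto simp: set_lebesgue_integral_def set_integrable_def scaleR_conv_of_real
              intro: continuous_on_subset)
        then show ?case using arc_bound[of "real n"] N elim by simp
      qed
    qed
  qed
  ultimately show ?thesis by (rule LIMSEQ_unique)
qed

text \<open>The quotient \<open>(f z - f (\<i> Y)) / (z\<^sup>2 + Y\<^sup>2)\<close> has only a
  removable singularity in the upper half plane and decays quadratically, so its integral over the
  line is 0; up to the factor \<open>pi / Y\<close> this is the formula. Holomorphy below the axis
  spares a discussion of boundary values.\<close>

theorem poisson_formula:
  fixes f :: "complex \<Rightarrow> complex"
  assumes s: "s > 0" and hol: "f holomorphic_on {z. Im z > - s}"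
    and Y: "Y > 0" and B: "\<And>z. Im z \<ge> 0 \<Longrightarrow> cmod (f z) \<le> C"
  shows "integrable lborel (\<lambda>x. of_real (poisson Y x) * f (of_real x))"
    and "(\<integral>x. of_real (poisson Y x) * f (of_real x) \<partial>lborel) = f (\<i> * of_real Y)"
proof -
  let ?a = "\<i> * of_real Y"
  \<comment> \<open>The second zero \<open>- \<i> Y\<close> of the denominator must stay outside the
    domain, hence the cut at \<open>Y\<close>.\<close>
  define s' where "s' = min s Y"
  have s': "s' > 0" "s' \<le> Y" using s Y by (auto simp: s'_def)
  let ?S = "{z. Im z > - s'}"
  have hol': "f holomorphic_on ?S"
    by (rule holomorphic_on_subset[OF hol]) (auto simp: s'_def)
  have op: "open ?S" using open_halfspace_Im_gt .
  \<comment> \<open>The case split removes the singularity at \<open>\<i> Y\<close> by filling in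
    the derivative.\<close>
  define h where "h z = (if z = ?a then deriv f ?a else (f z - f ?a) / (z - ?a)) / (z + ?a)" for z
  have nz: "z + ?a \<noteq> 0" if "z \<in> ?S" for z
  proof
    assume "z + ?a = 0"
    then have "Im (z + ?a) = 0" by simp
    then show False using that s' by simp
  qed
  have holh: "h holomorphic_on ?S"
    unfolding h_def using nz
    by (intro holomorphic_intros pole_lemma_open[OF hol' op]) auto
  have C: "C \<ge> 0" using order_trans[OF norm_ge_zero B[of 0]] by simp
  have hx: "h (of_real x) = (f (of_real x) - f ?a) / of_real (x\<^sup>2 + Y\<^sup>2)" for x
  proof -
    have "of_real x \<noteq> ?a" using Y by (auto simp: complex_eq_iff)
    moreover have "(of_real x - ?a) * (of_real x + ?a) = of_real (x\<^sup>2 + Y\<^sup>2)"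
      by (simp add: complex_eq_iff power2_eq_square algebra_simps)
    ultimately show ?thesis by (simp add: h_def)
  qed
  have cont: "continuous_on UNIV (\<lambda>x. f (of_real x))"
    by (intro continuous_on_compose2[OF holomorphic_on_imp_continuous_on[OF hol']] continuous_intros)
      (use s' in auto)
  show int1: "integrable lborel (\<lambda>x. of_real (poisson Y x) * f (of_real x))"
  proof (rule Bochner_Integration.integrable_bound)
    show "integrable lborel (\<lambda>x. C * poisson Y x)" using poisson_integral[OF Y] by simp
    show "(\<lambda>x. of_real (poisson Y x) * f (of_real x)) \<in> borel_measurable lborel"
      using borel_measurable_continuous_onI[OF cont] by simp
    have "cmod (of_real (poisson Y x) * f (of_real x)) \<le> norm (C * poisson Y x)" for x
      using B[of "of_real x"] poisson_pos[OF Y, of x] C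
      by (auto simp: norm_mult abs_mult mult.commute intro!: mult_mono)
    then show "AE x in lborel. cmod (of_real (poisson Y x) * f (of_real x)) \<le> norm (C * poisson Y x)"
      by simp
  qed
  have int2: "integrable lborel (\<lambda>x. of_real (poisson Y x) * f ?a)"
    using poisson_integral[OF Y] by (intro integrable_mult_left integrable_of_real) auto
  have hp: "h (of_real x) = of_real (pi / Y) * (of_real (poisson Y x) * f (of_real x) - of_real (poisson Y x) * f ?a)" for x
  proof -
    have "of_real (pi / Y) * of_real (poisson Y x) = (1 / of_real (x\<^sup>2 + Y\<^sup>2) :: complex)"
      unfolding of_real_mult[symmetric] poisson_def using Y by simp
    then have "h (of_real x) = (f (of_real x) - f ?a) * (of_real (pi / Y) * of_real (poisson Y x))"
      unfolding hx by simp
    then show ?thesis by (simp only: algebra_simps)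
  qed
  have inth: "integrable lborel (\<lambda>x. h (of_real x))"
    unfolding hp using int1 int2 by (intro integrable_mult_right Bochner_Integration.integrable_diff)
  have "(\<integral>x. h (of_real x) \<partial>lborel) = 0"
  proof (rule integral_real_line_eq_0[OF s'(1) holh Y _ inth])
    fix z assume z: "Im z \<ge> 0" "cmod z > Y"
    have na: "cmod ?a = Y" using Y by (simp add: norm_mult)
    then have "z \<noteq> ?a" using z by auto
    have 1: "cmod (f z - f ?a) \<le> 2 * C"
      using norm_triangle_ineq4[of "f z" "f ?a"] B[of z] B[of ?a] z Y by simp
    have 2: "cmod (z - ?a) \<ge> cmod z - Y" "cmod (z + ?a) \<ge> cmod z - Y"
      using norm_triangle_ineq2[of z ?a] norm_diff_ineq[of z ?a] unfolding na by auto
    have "cmod (h z) = cmod (f z - f ?a) / (cmod (z - ?a) * cmod (z + ?a))"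
      using \<open>z \<noteq> ?a\<close> by (simp add: h_def norm_divide norm_mult)
    also have "\<dots> \<le> 2 * C / ((cmod z - Y) * (cmod z - Y))"
      using 1 2 z C by (intro frac_le mult_mono) auto
    finally show "cmod (h z) \<le> 2 * C / (cmod z - Y)\<^sup>2" by (simp add: power2_eq_square)
  qed
  then have "(\<integral>x. of_real (poisson Y x) * f (of_real x) \<partial>lborel) = (\<integral>x. of_real (poisson Y x) * f ?a \<partial>lborel)"
    unfolding hp using int1 int2 Y by simp
  also have "\<dots> = (\<integral>x. complex_of_real (poisson Y x) \<partial>lborel) * f ?a"
    by (rule integral_mult_left_zero)
  also have "\<dots> = f ?a"
    using poisson_integral[OF Y] by simp
  finally show "(\<integral>x. of_real (poisson Y x) * f (of_real x) \<partial>lborel) = f ?a" .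
qed

text \<open>For a nonnegative frequency \<open>\<mu>\<close>, \<open>exp (2 pi \<i> \<mu> z)\<close>
  is bounded in the upper half plane, and the Poisson formula evaluates it at \<open>\<i> Y\<close>;
  conjugation gives the negative frequencies.\<close>

lemma poisson_expo:
  assumes Y: "Y > 0"
  shows "integrable lborel (\<lambda>x. of_real (poisson Y x) * expo \<mu> x)"
    and "(\<integral>x. of_real (poisson Y x) * expo \<mu> x \<partial>lborel) = of_real (exp (- (2 * pi * Y * \<bar>\<mu>\<bar>)))"
proof -
  have *: "integrable lborel (\<lambda>x. of_real (poisson Y x) * expo \<mu> x) \<and>
      (\<integral>x. of_real (poisson Y x) * expo \<mu> x \<partial>lborel) = of_real (exp (- (2 * pi * Y * \<mu>)))"
    if \<mu>: "\<mu> \<ge> 0" for \<mu>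
  proof -
    define f where "f z = exp (2 * of_real pi * \<i> * of_real \<mu> * z)" for z
    have hol: "f holomorphic_on {z. Im z > - 1}"
      unfolding f_def by (intro holomorphic_intros)
    have B: "cmod (f z) \<le> 1" if "Im z \<ge> 0" for z
      using that \<mu> by (simp add: f_def)
    have e: "f (of_real x) = expo \<mu> x" for x by (simp add: f_def expo_def)
    have "f (\<i> * of_real Y) = exp (of_real (- (2 * pi * Y * \<mu>)))"
      unfolding f_def by (rule arg_cong[where f = exp]) (simp add: complex_eq_iff)
    then have "f (\<i> * of_real Y) = of_real (exp (- (2 * pi * Y * \<mu>)))"
      by (simp only: exp_of_real)
    then show ?thesis
      using poisson_formula[OF _ hol Y B] by (simp add: e)
  qed
  have "integrable lborel (\<lambda>x. of_real (poisson Y x) * expo \<mu> x) \<and>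
      (\<integral>x. of_real (poisson Y x) * expo \<mu> x \<partial>lborel) = of_real (exp (- (2 * pi * Y * \<bar>\<mu>\<bar>)))"
  proof (cases "\<mu> \<ge> 0")
    case True
    then show ?thesis using * by simp
  next
    case False
    have e: "(\<lambda>x. of_real (poisson Y x) * expo \<mu> x) = (\<lambda>x. cnj (of_real (poisson Y x) * expo (- \<mu>) x))"
      by (simp add: cnj_expo)
    show ?thesis
      unfolding e Bochner_Integration.integral_cnj using False *[of "- \<mu>"] by (simp del: complex_cnj_mult)
  qed
  then show "integrable lborel (\<lambda>x. of_real (poisson Y x) * expo \<mu> x)"
    and "(\<integral>x. of_real (poisson Y x) * expo \<mu> x \<partial>lborel) = of_real (exp (- (2 * pi * Y * \<bar>\<mu>\<bar>)))"
    by auto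
qed

section \<open>Bessel inequality for separated frequencies in the Poisson weight\<close>

lemma cmod_trig_sum_sq:
  "of_real ((cmod (\<Sum>\<mu>\<in>F. c \<mu> * expo \<mu> x))\<^sup>2) =
    (\<Sum>\<mu>\<in>F. \<Sum>\<nu>\<in>F. c \<mu> * cnj (c \<nu>) * expo (\<mu> - \<nu>) x)"
proof -
  have "complex_of_real ((cmod (\<Sum>\<mu>\<in>F. c \<mu> * expo \<mu> x))\<^sup>2) =
      (\<Sum>\<mu>\<in>F. c \<mu> * expo \<mu> x) * (\<Sum>\<nu>\<in>F. cnj (c \<nu>) * cnj (expo \<nu> x))"
    unfolding complex_norm_square by simp
  also have "\<dots> = (\<Sum>\<mu>\<in>F. \<Sum>\<nu>\<in>F. c \<mu> * cnj (c \<nu>) * (expo \<mu> x * cnj (expo \<nu> x)))"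
    by (simp add: sum_product mult_ac)
  finally show ?thesis by (simp add: expo_mult_cnj)
qed

text \<open>Schur test. The Gram matrix of the exponentials in the Poisson weight has entries
  \<open>exp (- 2 pi Y |\<mu> - \<nu>|)\<close>; a row sums to 1 from the diagonal plus at most
  \<open>4 / (pi Y d)\<^sup>2\<close> from the inverse square estimate.\<close>

lemma poisson_bessel:
  assumes Y: "Y > 0" and F: "finite F" "separated d F" "d > 0"
  shows "integrable lborel (\<lambda>x. poisson Y x * (cmod (\<Sum>\<mu>\<in>F. c \<mu> * expo \<mu> x))\<^sup>2)"
    and "(\<integral>x. poisson Y x * (cmod (\<Sum>\<mu>\<in>F. c \<mu> * expo \<mu> x))\<^sup>2 \<partial>lborel) \<le>
      (1 + 4 / (pi * Y * d)\<^sup>2) * (\<Sum>\<mu>\<in>F. (cmod (c \<mu>))\<^sup>2)"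
proof -
  define E where "E t = exp (- (2 * pi * Y * \<bar>t\<bar>))" for t
  let ?G = "\<lambda>x. poisson Y x * (cmod (\<Sum>\<mu>\<in>F. c \<mu> * expo \<mu> x))\<^sup>2"
  have eq: "of_real (?G x) = (\<Sum>\<mu>\<in>F. \<Sum>\<nu>\<in>F. c \<mu> * cnj (c \<nu>) * (of_real (poisson Y x) * expo (\<mu> - \<nu>) x))" for x
    unfolding of_real_mult cmod_trig_sum_sq by (simp add: sum_distrib_left mult_ac)
  have int: "integrable lborel (\<lambda>x. complex_of_real (?G x))"
    unfolding eq using poisson_expo(1)[OF Y] by (intro Bochner_Integration.integrable_sum integrable_mult_right)
  then show "integrable lborel ?G"
    using integrable_Re[OF int] by (simp del: of_real_mult of_real_power)
  have "complex_of_real (\<integral>x. ?G x \<partial>lborel) = (\<integral>x. of_real (?G x) \<partial>lborel)"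
    by (rule integral_complex_of_real[symmetric])
  also have "\<dots> = (\<Sum>\<mu>\<in>F. \<Sum>\<nu>\<in>F. c \<mu> * cnj (c \<nu>) * of_real (E (\<mu> - \<nu>)))"
    unfolding eq
    by (simp add: Bochner_Integration.integral_sum poisson_expo[OF Y] E_def)
  finally have "cmod (complex_of_real (\<integral>x. ?G x \<partial>lborel)) = cmod (\<Sum>\<mu>\<in>F. \<Sum>\<nu>\<in>F. c \<mu> * cnj (c \<nu>) * of_real (E (\<mu> - \<nu>)))"
    by simp
  also have "\<dots> \<le> (\<Sum>\<mu>\<in>F. \<Sum>\<nu>\<in>F. cmod (c \<mu>) * cmod (c \<nu>) * E (\<mu> - \<nu>))"
    by (intro order_trans[OF norm_sum] sum_mono) (simp add: norm_mult E_def)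
  \<comment> \<open>Each product of moduli is split into half a sum of squares; as \<open>E\<close>
    is even, both halves become the same combination of row sums.\<close>
  also have "\<dots> \<le> (\<Sum>\<mu>\<in>F. \<Sum>\<nu>\<in>F. ((cmod (c \<mu>))\<^sup>2 * E (\<mu> - \<nu>) + (cmod (c \<nu>))\<^sup>2 * E (\<mu> - \<nu>)) / 2)"
  proof (intro sum_mono)
    fix \<mu> \<nu>
    have "cmod (c \<mu>) * cmod (c \<nu>) \<le> ((cmod (c \<mu>))\<^sup>2 + (cmod (c \<nu>))\<^sup>2) / 2"
      using sum_squares_bound[of "cmod (c \<mu>)" "cmod (c \<nu>)"] by simp
    then have "cmod (c \<mu>) * cmod (c \<nu>) * E (\<mu> - \<nu>) \<le> ((cmod (c \<mu>))\<^sup>2 + (cmod (c \<nu>))\<^sup>2) / 2 * E (\<mu> - \<nu>)"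
      by (intro mult_right_mono) (auto simp: E_def)
    then show "cmod (c \<mu>) * cmod (c \<nu>) * E (\<mu> - \<nu>) \<le> ((cmod (c \<mu>))\<^sup>2 * E (\<mu> - \<nu>) + (cmod (c \<nu>))\<^sup>2 * E (\<mu> - \<nu>)) / 2"
      by (simp add: algebra_simps add_divide_distrib)
  qed
  also have "\<dots> = ((\<Sum>\<mu>\<in>F. \<Sum>\<nu>\<in>F. (cmod (c \<mu>))\<^sup>2 * E (\<mu> - \<nu>)) + (\<Sum>\<mu>\<in>F. \<Sum>\<nu>\<in>F. (cmod (c \<nu>))\<^sup>2 * E (\<mu> - \<nu>))) / 2"
    by (simp add: sum.distrib sum_divide_distrib[symmetric])
  also have "(\<Sum>\<mu>\<in>F. \<Sum>\<nu>\<in>F. (cmod (c \<nu>))\<^sup>2 * E (\<mu> - \<nu>)) = (\<Sum>\<mu>\<in>F. \<Sum>\<nu>\<in>F. (cmod (c \<mu>))\<^sup>2 * E (\<mu> - \<nu>))"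
    by (subst sum.swap) (simp add: E_def abs_minus_commute)
  also have "((\<Sum>\<mu>\<in>F. \<Sum>\<nu>\<in>F. (cmod (c \<mu>))\<^sup>2 * E (\<mu> - \<nu>)) + (\<Sum>\<mu>\<in>F. \<Sum>\<nu>\<in>F. (cmod (c \<mu>))\<^sup>2 * E (\<mu> - \<nu>))) / 2 =
     (\<Sum>\<mu>\<in>F. (cmod (c \<mu>))\<^sup>2 * (\<Sum>\<nu>\<in>F. E (\<mu> - \<nu>)))"
    unfolding sum_distrib_left using field_sum_of_halves by (simp only: add_divide_distrib)
  also have "\<dots> \<le> (\<Sum>\<mu>\<in>F. (cmod (c \<mu>))\<^sup>2 * (1 + 4 / (pi * Y * d)\<^sup>2))"
  proof (intro sum_mono mult_left_mono)
    fix \<mu> assume \<mu>: "\<mu> \<in> F"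
    have "(\<Sum>\<nu>\<in>F. E (\<mu> - \<nu>)) = E 0 + (\<Sum>\<nu>\<in>F - {\<mu>}. E (\<mu> - \<nu>))"
      using \<mu> F by (subst sum.remove) auto
    also have "(\<Sum>\<nu>\<in>F - {\<mu>}. E (\<mu> - \<nu>)) \<le> (\<Sum>\<nu>\<in>F - {\<mu>}. 1 / (2 * (pi * Y)\<^sup>2) * (1 / (\<nu> - \<mu>)\<^sup>2))"
    proof (intro sum_mono)
      fix \<nu> assume "\<nu> \<in> F - {\<mu>}"
      then have "E (\<mu> - \<nu>) \<le> 2 / (2 * pi * Y * \<bar>\<mu> - \<nu>\<bar>)\<^sup>2"
        unfolding E_def using Y by (intro exp_minus_le_inverse_square) auto
      also have "\<dots> = 1 / (2 * (pi * Y)\<^sup>2) * (1 / (\<nu> - \<mu>)\<^sup>2)"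
        by (simp add: power_mult_distrib power2_commute)
      finally show "E (\<mu> - \<nu>) \<le> 1 / (2 * (pi * Y)\<^sup>2) * (1 / (\<nu> - \<mu>)\<^sup>2)" .
    qed
    also have "\<dots> = 1 / (2 * (pi * Y)\<^sup>2) * (\<Sum>\<nu>\<in>F - {\<mu>}. 1 / (\<nu> - \<mu>)\<^sup>2)"
      by (simp add: sum_distrib_left)
    also have "\<dots> \<le> 1 / (2 * (pi * Y)\<^sup>2) * (8 / d\<^sup>2)"
      using F \<mu> by (intro mult_left_mono sum_inverse_squares_centered) auto
    also have "\<dots> = 4 / (pi * Y * d)\<^sup>2" by (simp add: power_mult_distrib)
    finally show "(\<Sum>\<nu>\<in>F. E (\<mu> - \<nu>)) \<le> 1 + 4 / (pi * Y * d)\<^sup>2" by (simp add: E_def)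
  qed auto
  finally show "(\<integral>x. ?G x \<partial>lborel) \<le> (1 + 4 / (pi * Y * d)\<^sup>2) * (\<Sum>\<mu>\<in>F. (cmod (c \<mu>))\<^sup>2)"
    by (simp add: sum_distrib_left sum_distrib_right mult.commute)
qed

section \<open>Trigonometric sums with positive frequencies\<close>

text \<open>A quadratic Taylor remainder with an integrable factor \<open>B\<close> bounds the
  difference quotient directly. This serves both the Cauchy transform and the Fourier transform of a
  bounded set.\<close>

lemma has_field_derivative_parametric_integral:
  fixes k :: "complex \<Rightarrow> 'a \<Rightarrow> complex"
  assumes r: "r > 0" and k: "\<And>z. z \<in> ball z0 r \<Longrightarrow> integrable M (k z)"
    and k': "integrable M k'" and B: "integrable M B"
    and bound: "\<And>z t. z \<in> ball z0 r \<Longrightarrow> t \<in> space M \<Longrightarrow>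
      cmod (k z t - k z0 t - (z - z0) * k' t) \<le> B t * (cmod (z - z0))\<^sup>2"
  shows "((\<lambda>z. \<integral>t. k z t \<partial>M) has_field_derivative (\<integral>t. k' t \<partial>M)) (at z0)"
  unfolding has_field_derivative_iff
proof (subst LIM_zero_iff[symmetric], rule Lim_null_comparison)
  let ?f = "\<lambda>z. \<integral>t. k z t \<partial>M" and ?D = "\<integral>t. k' t \<partial>M" and ?K = "\<integral>t. B t \<partial>M"
  show "((\<lambda>z. ?K * cmod (z - z0)) \<longlongrightarrow> 0) (at z0)"
    by (auto intro!: tendsto_eq_intros)
  have "eventually (\<lambda>z. z \<in> ball z0 r \<and> z \<noteq> z0) (at z0)"
    using eventually_at_ball'[OF r, of z0 UNIV] by (rule eventually_mono) auto
  then show "eventually (\<lambda>z. cmod ((?f z - ?f z0) / (z - z0) - ?D) \<le> ?K * cmod (z - z0)) (at z0)"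
  proof eventually_elim
    case (elim z)
    have z0: "z0 \<in> ball z0 r" using r by simp
    have int: "integrable M (\<lambda>t. k z t - k z0 t - (z - z0) * k' t)"
      using k[of z] k[OF z0] k' elim by simp
    have "cmod (?f z - ?f z0 - (z - z0) * ?D) = cmod (\<integral>t. k z t - k z0 t - (z - z0) * k' t \<partial>M)"
      using k[of z] k[OF z0] k' elim by simp
    also have "\<dots> \<le> (\<integral>t. cmod (k z t - k z0 t - (z - z0) * k' t) \<partial>M)"
      by (rule integral_norm_bound)
    also have "\<dots> \<le> (\<integral>t. B t * (cmod (z - z0))\<^sup>2 \<partial>M)"
      using int B elim by (intro integral_mono bound) auto
    also have "\<dots> = ?K * (cmod (z - z0))\<^sup>2" by simp
    finally have *: "cmod (?f z - ?f z0 - (z - z0) * ?D) \<le> ?K * (cmod (z - z0))\<^sup>2" .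
    have "(?f z - ?f z0) / (z - z0) - ?D = (?f z - ?f z0 - (z - z0) * ?D) / (z - z0)"
      using elim by (simp add: field_simps)
    then have "cmod ((?f z - ?f z0) / (z - z0) - ?D) = cmod (?f z - ?f z0 - (z - z0) * ?D) / cmod (z - z0)"
      by (simp add: norm_divide)
    also have "\<dots> \<le> ?K * (cmod (z - z0))\<^sup>2 / cmod (z - z0)"
      by (intro divide_right_mono *) simp
    also have "\<dots> = ?K * cmod (z - z0)"
      using elim by (simp add: power2_eq_square)
    finally show ?case .
  qed
qed

text \<open>The pole sits at \<open>t - \<i> s\<close>, below the real axis, and the factor
  \<open>- \<i> / pi\<close> makes the real part a Poisson kernel at height \<open>s + Im z\<close>.
  The shift by \<open>s\<close> keeps the transform holomorphic across the real axis.\<close>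

definition cauchy_kernel :: "real \<Rightarrow> complex \<Rightarrow> real \<Rightarrow> complex" where
  "cauchy_kernel s z t = (of_real (1 / pi) * - \<i>) / (of_real t - z - \<i> * of_real s)"

definition cauchy_transform :: "real set \<Rightarrow> real \<Rightarrow> complex \<Rightarrow> complex" where
  "cauchy_transform K s z = (\<integral>t. indicator K t *\<^sub>R cauchy_kernel s z t \<partial>lborel)"

context
  fixes K :: "real set" and s :: real
  assumes K: "compact K" and s: "s > 0"
begin

lemma cauchy_denominator:
  assumes "Im z > - s"
  shows "s + Im z \<le> cmod (of_real t - z - \<i> * of_real s)" "of_real t - z - \<i> * of_real s \<noteq> 0"
proof -
  show *: "s + Im z \<le> cmod (of_real t - z - \<i> * of_real s)"
    using abs_Im_le_cmod[of "of_real t - z - \<i> * of_real s"] by simp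
  then show "of_real t - z - \<i> * of_real s \<noteq> 0"
    using assms by auto
qed

lemma continuous_on_cauchy_kernel: "Im z > - s \<Longrightarrow> continuous_on S (cauchy_kernel s z)"
  unfolding cauchy_kernel_def using cauchy_denominator(2) by (intro continuous_intros) auto

lemma integrable_cauchy_kernel:
  "Im z > - s \<Longrightarrow> integrable lborel (\<lambda>t. indicator K t *\<^sub>R cauchy_kernel s z t)"
  by (intro borel_integrable_compact K continuous_on_cauchy_kernel)

lemma holomorphic_cauchy_transform: "cauchy_transform K s holomorphic_on {z. Im z > - s}"
proof (rule holomorphic_on_open[THEN iffD2])
  show "open {z. Im z > - s}" using open_halfspace_Im_gt .
  show "\<forall>z0\<in>{z. Im z > - s}. \<exists>f'. (cauchy_transform K s has_field_derivative f') (at z0)"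
  proof
    fix z0 assume "z0 \<in> {z. Im z > - s}"
    then have z0: "Im z0 > - s" by simp
    define r where "r = (Im z0 + s) / 2"
    have r: "r > 0" using z0 by (simp add: r_def)
    have near: "Im z > - s" "s + Im z \<ge> r" if "z \<in> ball z0 r" for z
    proof -
      have "\<bar>Im (z0 - z)\<bar> < r"
        using that abs_Im_le_cmod[of "z0 - z"] by (auto simp: dist_norm)
      then have "Im z0 - Im z < r" by simp
      then show "s + Im z \<ge> r" unfolding r_def by (simp add: field_simps)
      then show "Im z > - s" using r by simp
    qed
    define c :: complex where "c = of_real (1 / pi) * - \<i>"
    have c: "cmod c = 1 / pi" by (simp add: c_def norm_mult norm_divide)
    define k' where "k' t = indicator K t *\<^sub>R (c / (of_real t - z0 - \<i> * of_real s)\<^sup>2)" for t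
    define B where "B t = indicator K t *\<^sub>R (1 / (pi * r ^ 3))" for t
    have "(cauchy_transform K s has_field_derivative (\<integral>t. k' t \<partial>lborel)) (at z0)"
      unfolding cauchy_transform_def
    proof (rule has_field_derivative_parametric_integral[OF r])
      show "integrable lborel (\<lambda>t. indicator K t *\<^sub>R cauchy_kernel s z t)" if "z \<in> ball z0 r" for z
        using near[OF that] by (intro integrable_cauchy_kernel)
      show "integrable lborel k'"
        unfolding k'_def using cauchy_denominator(2)[OF z0]
        by (intro borel_integrable_compact K continuous_intros) auto
      show "integrable lborel B"
        unfolding B_def by (intro borel_integrable_compact K continuous_intros)
      fix z and t :: real assume z: "z \<in> ball z0 r"
      define a where "a = of_real t - z0 - \<i> * of_real s"
      define b where "b = of_real t - z - \<i> * of_real s"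
      have ab: "a \<noteq> 0" "b \<noteq> 0" "r \<le> cmod a" "r \<le> cmod b"
        using cauchy_denominator[OF z0, of t] cauchy_denominator[OF near(1)[OF z], of t] near(2)[OF z] r
        by (auto simp: a_def b_def r_def)
      have hab: "z - z0 = a - b" by (simp add: a_def b_def)
      have "cauchy_kernel s z t - cauchy_kernel s z0 t - (z - z0) * (c / a\<^sup>2) =
          c * (1 / b - 1 / a - (a - b) / a\<^sup>2)"
        unfolding hab cauchy_kernel_def a_def[symmetric] b_def[symmetric] c_def[symmetric]
        by (simp add: right_diff_distrib mult.commute)
      also have "1 / b - 1 / a - (a - b) / a\<^sup>2 = (a - b)\<^sup>2 / (a\<^sup>2 * b)"
        using ab by (simp add: field_simps power2_eq_square)
      finally have eq: "cauchy_kernel s z t - cauchy_kernel s z0 t - (z - z0) * (c / a\<^sup>2) =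
          c * ((z - z0)\<^sup>2 / (a\<^sup>2 * b))" unfolding hab .
      have "cmod (c * ((z - z0)\<^sup>2 / (a\<^sup>2 * b))) = (cmod (z - z0))\<^sup>2 / (pi * ((cmod a)\<^sup>2 * cmod b))"
        by (simp add: norm_divide norm_mult norm_power c)
      also have "\<dots> \<le> (cmod (z - z0))\<^sup>2 / (pi * (r\<^sup>2 * r))"
        using ab r by (intro divide_left_mono mult_left_mono mult_mono power_mono mult_pos_pos) auto
      finally have "cmod (cauchy_kernel s z t - cauchy_kernel s z0 t - (z - z0) * (c / a\<^sup>2)) \<le>
          (1 / (pi * r ^ 3)) * (cmod (z - z0))\<^sup>2"
        unfolding eq by (simp add: power3_eq_cube power2_eq_square mult_ac)
      then show "cmod (indicator K t *\<^sub>R cauchy_kernel s z t - indicator K t *\<^sub>R cauchy_kernel s z0 t - (z - z0) * k' t)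
          \<le> B t * (cmod (z - z0))\<^sup>2"
        by (simp add: k'_def B_def a_def indicator_def)
    qed
    then show "\<exists>f'. (cauchy_transform K s has_field_derivative f') (at z0)" by blast
  qed
qed

text \<open>The real part is the harmonic measure of \<open>K\<close> seen from \<open>z\<close>
  raised by \<open>s\<close>; it governs the modulus of exponentials of the transform.\<close>

lemma Re_cauchy_transform:
  assumes "Im z > - s"
  shows "Re (cauchy_transform K s z) = (\<integral>t. indicator K t * poisson (s + Im z) (t - Re z) \<partial>lborel)"
proof -
  have "Re (cauchy_kernel s z t) = poisson (s + Im z) (t - Re z)" for t
  proof -
    define w where "w = of_real t - z - \<i> * of_real s"
    have w: "Re w = t - Re z" "Im w = - (s + Im z)" by (simp_all add: w_def)
    have "cauchy_kernel s z t = (1 / pi) *\<^sub>R (- \<i> / w)"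
      unfolding cauchy_kernel_def w_def[symmetric] by (simp add: scaleR_conv_of_real)
    then have "Re (cauchy_kernel s z t) = 1 / pi * Re (- \<i> / w)"
      by (simp only: scaleR_complex.sel)
    also have "Re (- \<i> / w) = (s + Im z) / ((t - Re z)\<^sup>2 + (s + Im z)\<^sup>2)"
      unfolding Re_divide w by (simp add: power2_eq_square algebra_simps)
    finally show ?thesis by (simp add: poisson_def)
  qed
  then show ?thesis
    unfolding cauchy_transform_def integral_Re[OF integrable_cauchy_kernel[OF assms], symmetric] by simp
qed

text \<open>Serves the boundedness hypothesis of \<open>poisson_formula\<close> for exponentials of
  the transform; the size of the bound does not matter there.\<close>

lemma cmod_cauchy_transform_le:
  assumes "Im z \<ge> 0"
  shows "cmod (cauchy_transform K s z) \<le> measure lborel K / (pi * s)"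
proof -
  have Im: "Im z > - s" using assms s by simp
  have "cmod (cauchy_transform K s z) \<le> (\<integral>t. cmod (indicator K t *\<^sub>R cauchy_kernel s z t) \<partial>lborel)"
    unfolding cauchy_transform_def by (rule integral_norm_bound)
  also have "\<dots> \<le> (\<integral>t. indicator K t *\<^sub>R (1 / (pi * s)) \<partial>lborel)"
  proof (rule integral_mono)
    show "integrable lborel (\<lambda>t. cmod (indicator K t *\<^sub>R cauchy_kernel s z t))"
      by (intro integrable_norm integrable_cauchy_kernel Im)
    show "integrable lborel (\<lambda>t. indicator K t *\<^sub>R (1 / (pi * s)))"
      by (intro borel_integrable_compact K continuous_intros)
    fix t
    have "s \<le> cmod (of_real t - z - \<i> * of_real s)"
      using cauchy_denominator(1)[OF Im, of t] assms by simp
    then have "1 / (pi * cmod (of_real t - z - \<i> * of_real s)) \<le> 1 / (pi * s)"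
      using s by (intro divide_left_mono mult_left_mono mult_pos_pos) auto
    then show "cmod (indicator K t *\<^sub>R cauchy_kernel s z t) \<le> indicator K t *\<^sub>R (1 / (pi * s))"
      by (simp add: cauchy_kernel_def norm_divide norm_mult indicator_def)
  qed
  also have "\<dots> = measure lborel K / (pi * s)"
    using K by (simp add: borel_compact)
  finally show ?thesis .
qed

end

section \<open>Poisson extensions of indicator functions\<close>

lemma poisson_shift_integral:
  assumes "s > 0"
  shows "integrable lborel (\<lambda>t. poisson s (t - x))" "(\<integral>t. poisson s (t - x) \<partial>lborel) = 1"
  using lborel_integrable_real_affine[of "poisson s" 1 "- x"] lborel_integral_real_affine[of 1 "poisson s" "- x"]
    poisson_integral[OF assms] by simp_all

lemma integrable_indicator_poisson:
  assumes "s > 0" "compact K"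
  shows "integrable lborel (\<lambda>t. indicator K t * poisson s (t - x))"
proof -
  have "integrable lborel (\<lambda>t. indicator K t *\<^sub>R poisson s (t - x))"
    using assms by (intro borel_integrable_compact continuous_intros)
  then show ?thesis by simp
qed

lemma poisson_extension_bounds:
  assumes s: "s > 0" and K: "compact K"
  shows "0 \<le> (\<integral>t. indicator K t * poisson s (t - x) \<partial>lborel)"
    and "(\<integral>t. indicator K t * poisson s (t - x) \<partial>lborel) \<le> 1"
proof -
  show "0 \<le> (\<integral>t. indicator K t * poisson s (t - x) \<partial>lborel)"
    using poisson_pos[OF s] by (intro Bochner_Integration.integral_nonneg mult_nonneg_nonneg) (auto intro: less_imp_le)
  have "(\<integral>t. indicator K t * poisson s (t - x) \<partial>lborel) \<le> (\<integral>t. poisson s (t - x) \<partial>lborel)"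
  proof (rule integral_mono)
    show "integrable lborel (\<lambda>t. indicator K t * poisson s (t - x))"
      by (rule integrable_indicator_poisson[OF s K])
    show "indicator K t * poisson s (t - x) \<le> poisson s (t - x)" for t
      using poisson_pos[OF s, of "t - x"] by (simp add: indicator_def)
  qed (rule poisson_shift_integral[OF s])
  then show "(\<integral>t. indicator K t * poisson s (t - x) \<partial>lborel) \<le> 1"
    using poisson_shift_integral[OF s] by simp
qed

text \<open>Seen from \<open>x\<close>, the kernel on \<open>K\<close> is at most
  \<open>s / (pi d\<^sup>2)\<close>, with \<open>d\<close> a positive lower bound for the distance
  to \<open>K\<close>, so the integral vanishes together with \<open>s\<close>.\<close>

lemma poisson_extension_outside:
  assumes K: "compact K" and x: "x \<notin> K"
  shows "(\<lambda>n. \<integral>t. indicator K t * poisson (1 / Suc n) (t - x) \<partial>lborel) \<longlonglongrightarrow> 0"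
proof -
  obtain d where d: "d > 0" "\<And>y. y \<in> K \<Longrightarrow> d \<le> dist x y"
    using separate_point_closed[OF compact_imp_closed[OF K] x] by blast
  show ?thesis
  proof (rule Lim_null_comparison)
    show "(\<lambda>n. (1 / Suc n) / (pi * d\<^sup>2) * measure lborel K) \<longlonglongrightarrow> 0"
    proof -
      have "(\<lambda>n. 1 / Suc n * c) \<longlonglongrightarrow> 0" for c :: real
        by real_asymp
      from this[of "measure lborel K / (pi * d\<^sup>2)"] show ?thesis by simp
    qed
    show "\<forall>\<^sub>F n in sequentially. norm (\<integral>t. indicator K t * poisson (1 / Suc n) (t - x) \<partial>lborel)
        \<le> (1 / Suc n) / (pi * d\<^sup>2) * measure lborel K"
    proof (rule always_eventually, rule allI)
      fix n
      define s where "s = 1 / real (Suc n)"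
      have s: "s > 0" by (simp add: s_def)
      have "(\<integral>t. indicator K t * poisson s (t - x) \<partial>lborel) \<le> (\<integral>t. indicator K t *\<^sub>R (s / (pi * d\<^sup>2)) \<partial>lborel)"
      proof (rule integral_mono)
        show "integrable lborel (\<lambda>t. indicator K t * poisson s (t - x))"
          by (rule integrable_indicator_poisson[OF s K])
        show "integrable lborel (\<lambda>t. indicator K t *\<^sub>R (s / (pi * d\<^sup>2)))"
          by (intro borel_integrable_compact K continuous_intros)
        show "indicator K t * poisson s (t - x) \<le> indicator K t *\<^sub>R (s / (pi * d\<^sup>2))" for t
        proof (cases "t \<in> K")
          case True
          then have "d\<^sup>2 \<le> (t - x)\<^sup>2"
            using d by (intro abs_le_square_iff[THEN iffD1]) (auto simp: dist_real_def abs_minus_commute)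
          also have "\<dots> \<le> (t - x)\<^sup>2 + s\<^sup>2" by simp
          finally have "poisson s (t - x) \<le> s / (pi * d\<^sup>2)"
            unfolding poisson_def using d s by (intro divide_left_mono mult_left_mono mult_pos_pos) (auto simp: add_nonneg_pos)
          then show ?thesis using True by simp
        qed simp
      qed
      also have "\<dots> = s / (pi * d\<^sup>2) * measure lborel K"
        using K by (simp add: borel_compact)
      finally show "norm (\<integral>t. indicator K t * poisson (1 / Suc n) (t - x) \<partial>lborel)
        \<le> (1 / Suc n) / (pi * d\<^sup>2) * measure lborel K"
        using poisson_extension_bounds(1)[OF s K, of x] unfolding s_def[symmetric] by simp
    qed
  qed
qed

text \<open>Inner regularity provides a closed subset; its intersection with \<open>{- n..n}\<close>
  must have positive measure for some \<open>n\<close>. Compactness is what the Cauchy transform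
  asks for.\<close>

lemma compact_inner_pos:
  fixes S :: "real set"
  assumes S: "S \<in> lmeasurable" and pos: "measure lebesgue S > 0"
  obtains K where "compact K" "K \<subseteq> S" "measure lebesgue K > 0"
proof -
  obtain T where T: "closed T" "T \<subseteq> S" "S - T \<in> lmeasurable" "emeasure lebesgue (S - T) < ennreal (measure lebesgue S)"
    using sets_lebesgue_inner_closed[of S "measure lebesgue S"] S pos by (auto simp: fmeasurableD)
  have Tl: "T \<in> sets lebesgue" using T(1) by (simp add: borel_closed)
  have "emeasure lebesgue T \<noteq> 0"
  proof
    assume "emeasure lebesgue T = 0"
    moreover have "emeasure lebesgue S \<le> emeasure lebesgue (S - T) + emeasure lebesgue T"
      using emeasure_subadditive[of "S - T" lebesgue T] T Tl by (auto simp: fmeasurableD Un_absorb2)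
    ultimately have "emeasure lebesgue S < ennreal (measure lebesgue S)"
      using T(4) by auto
    then show False using S by (simp add: emeasure_eq_measure2)
  qed
  have "\<exists>n::nat. measure lebesgue (T \<inter> {- real n..real n}) > 0"
  proof (rule ccontr)
    assume "\<not> ?thesis"
    then have z: "measure lebesgue (T \<inter> {- real n..real n}) = 0" for n :: nat
      using measure_nonneg[of lebesgue "T \<inter> {- real n..real n}"] by (metis less_eq_real_def)
    have "T \<inter> {- real n..real n} \<in> null_sets lebesgue" for n :: nat
    proof -
      have "compact (T \<inter> {- real n..real n})" using T(1) by (simp add: closed_Int_compact)
      then have "T \<inter> {- real n..real n} \<in> lmeasurable" by (rule lmeasurable_compact)
      then show ?thesis using z[of n] by (simp add: null_sets_def emeasure_eq_measure2 fmeasurableD)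
    qed
    then have "(\<Union>n::nat. T \<inter> {- real n..real n}) \<in> null_sets lebesgue"
      by (intro null_sets_UN)
    moreover have "(\<Union>n::nat. T \<inter> {- real n..real n}) = T"
    proof -
      have "\<exists>n::nat. - real n \<le> x \<and> x \<le> real n" for x :: real
        using real_arch_simple[of "\<bar>x\<bar>"] by (meson abs_le_D1 abs_le_D2 minus_le_iff)
      then show ?thesis by auto
    qed
    ultimately show False using \<open>emeasure lebesgue T \<noteq> 0\<close> by (auto simp: null_sets_def)
  qed
  then obtain n :: nat where "measure lebesgue (T \<inter> {- real n..real n}) > 0" by blast
  moreover have "compact (T \<inter> {- real n..real n})" using T(1) by (simp add: closed_Int_compact)
  ultimately show ?thesis using that[of "T \<inter> {- real n..real n}"] T(2) by blast
qed

text \<open>The sum is evaluated at \<open>\<i> Y\<close>, where frequency \<open>\<mu>\<close> is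
  damped by \<open>exp (- 2 pi \<mu> Y)\<close>. The inequality
  \<open>c a \<le> c\<^sup>2 / 4 + a\<^sup>2\<close> spends 1/4 on the coefficients and at most 1/8
  on the damping factors.\<close>

lemma trig_sum_upper_half_plane:
  fixes c :: "real \<Rightarrow> complex"
  assumes F: "finite F" "separated d F" "d > 0" "\<forall>\<mu>\<in>F. 2 * d \<le> \<mu>"
    and c: "(\<Sum>\<mu>\<in>F. (cmod (c \<mu>))\<^sup>2) \<le> 1" and Y: "Y \<ge> 1 / d"
  shows "cmod (\<Sum>\<mu>\<in>F. c \<mu> * of_real (exp (- (2 * pi * \<mu> * Y)))) \<le> 1 / 2"
proof -
  have Y0: "Y > 0" using Y F(3) by (meson divide_pos_pos less_le_trans zero_less_one)
  have "cmod (\<Sum>\<mu>\<in>F. c \<mu> * of_real (exp (- (2 * pi * \<mu> * Y)))) \<le> (\<Sum>\<mu>\<in>F. cmod (c \<mu>) * exp (- (2 * pi * \<mu> * Y)))"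
    by (rule order_trans[OF norm_sum]) (simp add: norm_mult)
  also have "\<dots> \<le> (\<Sum>\<mu>\<in>F. (cmod (c \<mu>))\<^sup>2 / 4 + (1 / (8 * (pi * Y)\<^sup>2)) * (1 / \<mu>\<^sup>2))"
  proof (rule sum_mono)
    fix \<mu> assume "\<mu> \<in> F"
    then have \<mu>: "\<mu> > 0" using F by force
    define a where "a = exp (- (2 * pi * \<mu> * Y))"
    have "a\<^sup>2 = exp (- (4 * pi * \<mu> * Y))"
      by (simp add: a_def exp_double[symmetric] mult.assoc)
    also have "\<dots> \<le> 2 / (4 * pi * \<mu> * Y)\<^sup>2"
      using \<mu> Y0 by (intro exp_minus_le_inverse_square) auto
    also have "\<dots> = (1 / (8 * (pi * Y)\<^sup>2)) * (1 / \<mu>\<^sup>2)"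
      by (simp add: power_mult_distrib)
    finally have "a\<^sup>2 \<le> (1 / (8 * (pi * Y)\<^sup>2)) * (1 / \<mu>\<^sup>2)" .
    moreover have "cmod (c \<mu>) * a \<le> (cmod (c \<mu>))\<^sup>2 / 4 + a\<^sup>2"
      using zero_le_power2[of "cmod (c \<mu>) / 2 - a"] by (simp add: power2_diff power_divide)
    ultimately show "cmod (c \<mu>) * exp (- (2 * pi * \<mu> * Y)) \<le> (cmod (c \<mu>))\<^sup>2 / 4 + (1 / (8 * (pi * Y)\<^sup>2)) * (1 / \<mu>\<^sup>2)"
      unfolding a_def by linarith
  qed
  also have "\<dots> = (\<Sum>\<mu>\<in>F. (cmod (c \<mu>))\<^sup>2) / 4 + (1 / (8 * (pi * Y)\<^sup>2)) * (\<Sum>\<mu>\<in>F. 1 / \<mu>\<^sup>2)"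
    by (simp add: sum.distrib sum_divide_distrib sum_distrib_left)
  also have "\<dots> \<le> 1 / 4 + (1 / (8 * (pi * Y)\<^sup>2)) * (1 / (d * (2 * d - d)))"
    using c F by (intro add_mono divide_right_mono mult_left_mono sum_inverse_squares_pos) auto
  also have "(1 / (8 * (pi * Y)\<^sup>2)) * (1 / (d * (2 * d - d))) = 1 / (8 * (pi * (Y * d))\<^sup>2)"
    by (simp add: power2_eq_square mult_ac)
  also have "\<dots> \<le> 1 / (8 * (1 * 1)\<^sup>2)"
  proof -
    have "1 \<le> Y * d" using Y F(3) by (simp add: pos_divide_le_eq)
    then have "1 * 1 \<le> pi * (Y * d)" using pi_ge_two by (intro mult_mono) auto
    then show ?thesis by (intro divide_left_mono mult_left_mono power_mono) auto
  qed
  finally show ?thesis by simp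
qed

lemma square_integrable_bounded_on:
  assumes "S \<in> lmeasurable" "f \<in> borel_measurable (lebesgue_on S)" "\<And>x. x \<in> S \<Longrightarrow> cmod (f x) \<le> C"
  shows "square_integrable (lebesgue_on S) f"
  using finite_measure.square_integrable_bounded[OF finite_measure_lebesgue_on[OF assms(1)] assms(2), of C] assms(3)
  by simp

lemma square_integrable_expo:
  "S \<in> lmeasurable \<Longrightarrow> square_integrable (lebesgue_on S) (expo l)"
  by (rule square_integrable_bounded_on[where C = 1]) auto

lemma square_integrable_trig:
  "S \<in> lmeasurable \<Longrightarrow> square_integrable (lebesgue_on S) (\<lambda>x. \<Sum>\<mu>\<in>F. c \<mu> * expo \<mu> x)"
  by (intro square_integrable_sum square_integrable_scale square_integrable_expo)

text \<open>Bridge between the Borel integrals of the half plane argument and the norm on the merely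
  Lebesgue measurable \<open>S\<close>.\<close>

lemma integral_compact_le_L2_norm_sq:
  assumes S: "S \<in> lmeasurable" and K: "compact K" "K \<subseteq> S"
    and g: "continuous_on UNIV g" "square_integrable (lebesgue_on S) g"
  shows "(\<integral>x. indicator K x * (cmod (g x))\<^sup>2 \<partial>lborel) \<le> L2_norm_sq (lebesgue_on S) g"
proof -
  have Kl: "K \<in> sets lebesgue" using K by (simp add: borel_compact)
  have Sl: "S \<in> sets lebesgue" using S by (simp add: fmeasurableD)
  have m: "(\<lambda>x. indicator K x * (cmod (g x))\<^sup>2) \<in> borel_measurable lborel"
  proof -
    have [measurable]: "K \<in> sets borel" using K(1) by (rule borel_compact)
    have [measurable]: "g \<in> borel_measurable borel" using g(1) by (rule borel_measurable_continuous_onI)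
    show ?thesis by measurable
  qed
  have "(\<integral>x. indicator K x * (cmod (g x))\<^sup>2 \<partial>lborel) = (\<integral>x. indicator K x * (cmod (g x))\<^sup>2 \<partial>lebesgue)"
    using m by (simp add: integral_completion)
  also have "\<dots> \<le> (\<integral>x. indicator S x * (cmod (g x))\<^sup>2 \<partial>lebesgue)"
  proof (rule integral_mono)
    show intS: "integrable lebesgue (\<lambda>x. indicator S x * (cmod (g x))\<^sup>2)"
      using g(2) integrable_restrict_space[of S lebesgue "\<lambda>x. (cmod (g x))\<^sup>2"] Sl
      by (simp add: square_integrable_def)
    have "integrable lborel (\<lambda>x. indicator K x *\<^sub>R (cmod (g x))\<^sup>2)"
      using g(1) by (intro borel_integrable_compact K continuous_intros) (auto intro: continuous_on_subset)
    then show "integrable lebesgue (\<lambda>x. indicator K x * (cmod (g x))\<^sup>2)"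
      by (simp add: integrable_completion)
    show "indicator K x * (cmod (g x))\<^sup>2 \<le> indicator S x * (cmod (g x))\<^sup>2" for x
      using K(2) by (auto simp: indicator_def)
  qed
  also have "\<dots> = L2_norm_sq (lebesgue_on S) g"
    unfolding L2_norm_sq_def using Sl by (simp add: integral_restrict_space)
  finally show ?thesis .
qed

text \<open>Since \<open>s + Y \<le> 2 Y\<close>, the denominator grows at most fourfold. This
  bounds the harmonic measure of \<open>K\<close> at \<open>\<i> Y\<close> from below independently
  of \<open>s\<close>, so \<open>s\<close> may be chosen last.\<close>

lemma poisson_harmonic_measure_quarter:
  assumes "0 < s" "s \<le> Y"
  shows "poisson Y t / 4 \<le> poisson (s + Y) t"
proof -
  have "poisson Y t / 4 = Y / (pi * (4 * (t\<^sup>2 + Y\<^sup>2)))" by (simp add: poisson_def)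
  also have "\<dots> \<le> (s + Y) / (pi * (t\<^sup>2 + (s + Y)\<^sup>2))"
  proof (intro frac_le mult_left_mono)
    have "(s + Y)\<^sup>2 \<le> (2 * Y)\<^sup>2" using assms by (intro power_mono) auto
    moreover have "(2 * Y)\<^sup>2 = 4 * Y\<^sup>2" by (simp add: power_mult_distrib)
    moreover have "4 * (t\<^sup>2 + Y\<^sup>2) = 4 * t\<^sup>2 + 4 * Y\<^sup>2" by simp
    ultimately show "t\<^sup>2 + (s + Y)\<^sup>2 \<le> 4 * (t\<^sup>2 + Y\<^sup>2)" using zero_le_power2[of t] by linarith
    show "0 < pi * (t\<^sup>2 + (s + Y)\<^sup>2)" using assms by (simp add: add_nonneg_pos)
  qed (use assms in auto)
  finally show ?thesis by (simp add: poisson_def)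
qed

text \<open>The bounded analytic functions \<open>exp (N W)\<close>, with \<open>W\<close> a Cauchy transform of \<open>K\<close>, are as
  large as \<open>exp N\<close> on \<open>K\<close> and essentially of modulus 1 off \<open>K\<close>.  They replace the subharmonicity of
  \<open>log \<bar>f\<bar>\<close> in the F. and M. Riesz uniqueness theorem.\<close>

lemma exponential_amplifier:
  assumes K: "compact K" and Y: "Y \<ge> 1" and N: "N \<ge> 0"
  obtains s where "0 < s" "s \<le> Y"
    "(\<integral>x. indicator (- K) x * (poisson Y x * exp (2 * N * Re (cauchy_transform K s (of_real x)))) \<partial>lborel) \<le> 2"
proof -
  have Y0: "Y > 0" using Y by simp
  have Kb: "K \<in> sets borel" using K by (simp add: borel_compact)
  define U where "U n x = Re (cauchy_transform K (1 / Suc n) (of_real x))" for n x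
  have Ueq: "U n x = (\<integral>t. indicator K t * poisson (1 / Suc n) (t - x) \<partial>lborel)" for n x
    unfolding U_def using Re_cauchy_transform[OF K, of "1 / Suc n" "of_real x"] by simp
  have Ub: "0 \<le> U n x" "U n x \<le> 1" for n x
    unfolding Ueq by (intro poisson_extension_bounds K; simp)+
  have Um: "U n \<in> borel_measurable lborel" for n
  proof -
    have "continuous_on UNIV (\<lambda>x. cauchy_transform K (1 / Suc n) (of_real x))"
      by (intro continuous_on_compose2[OF holomorphic_on_imp_continuous_on[OF holomorphic_cauchy_transform[OF K]]]
          continuous_intros) auto
    then have "continuous_on UNIV (U n)" unfolding U_def by (intro continuous_intros)
    then show ?thesis by (simp add: borel_measurable_continuous_onI)
  qed
  \<comment> \<open>As the line of poles approaches the real axis, the extension tends to 0 off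
    \<open>K\<close>; the limit is the Poisson mass of the complement, which is at most 1 and hence
    below 2.\<close>
  have "(\<lambda>n. \<integral>x. indicator (- K) x * (poisson Y x * exp (2 * N * U n x)) \<partial>lborel) \<longlonglongrightarrow>
      (\<integral>x. indicator (- K) x * (poisson Y x * exp (2 * N * 0)) \<partial>lborel)"
  proof (rule integral_dominated_convergence)
    show "integrable lborel (\<lambda>x. poisson Y x * exp (2 * N))"
      using poisson_integral[OF Y0] by simp
    show "(\<lambda>x. indicator (- K) x * (poisson Y x * exp (2 * N * 0))) \<in> borel_measurable lborel"
      using Kb by measurable
    show "(\<lambda>x. indicator (- K) x * (poisson Y x * exp (2 * N * U n x))) \<in> borel_measurable lborel" for n
      using Kb Um[of n] by measurable
    show "AE x in lborel. (\<lambda>n. indicator (- K) x * (poisson Y x * exp (2 * N * U n x))) \<longlonglongrightarrow>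
        indicator (- K) x * (poisson Y x * exp (2 * N * 0))"
    proof (rule AE_I2)
      fix x
      show "(\<lambda>n. indicator (- K) x * (poisson Y x * exp (2 * N * U n x))) \<longlonglongrightarrow>
        indicator (- K) x * (poisson Y x * exp (2 * N * 0))"
      proof (cases "x \<in> K")
        case False
        show ?thesis
          using poisson_extension_outside[OF K False] unfolding Ueq[symmetric]
          by (intro tendsto_intros)
      qed simp
    qed
    show "AE x in lborel. norm (indicator (- K) x * (poisson Y x * exp (2 * N * U n x))) \<le> poisson Y x * exp (2 * N)" for n
    proof (rule AE_I2)
      fix x
      have "2 * N * U n x \<le> 2 * N * 1" using Ub N by (intro mult_left_mono) auto
      then show "norm (indicator (- K) x * (poisson Y x * exp (2 * N * U n x))) \<le> poisson Y x * exp (2 * N)"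
        using poisson_pos[OF Y0, of x] by (simp add: indicator_def abs_mult)
    qed
  qed
  moreover have "(\<integral>x. indicator (- K) x * (poisson Y x * exp (2 * N * 0)) \<partial>lborel) < 2"
  proof -
    have "(\<integral>x. indicator (- K) x * (poisson Y x * exp (2 * N * 0)) \<partial>lborel) \<le> (\<integral>x. poisson Y x \<partial>lborel)"
    proof (rule integral_mono)
      show "integrable lborel (\<lambda>x. indicator (- K) x * (poisson Y x * exp (2 * N * 0)))"
        using integrable_mult_indicator[of "- K" lborel "\<lambda>x. poisson Y x * exp (2 * N * 0)"] Kb poisson_integral[OF Y0]
        by (simp only: real_scaleR_def sets_lborel borel_comp) simp
      show "indicator (- K) x * (poisson Y x * exp (2 * N * 0)) \<le> poisson Y x" for x
        using poisson_pos[OF Y0, of x] by (simp add: indicator_def)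
    qed (rule poisson_integral[OF Y0])
    then show ?thesis using poisson_integral[OF Y0] by simp
  qed
  ultimately have "\<forall>\<^sub>F n in sequentially. (\<integral>x. indicator (- K) x * (poisson Y x * exp (2 * N * U n x)) \<partial>lborel) < 2"
    by (rule order_tendstoD)
  then obtain n where "(\<integral>x. indicator (- K) x * (poisson Y x * exp (2 * N * U n x)) \<partial>lborel) < 2"
    using eventually_happens'[OF sequentially_bot] by blast
  moreover have "1 / real (Suc n) \<le> 1" by simp
  then have "1 / real (Suc n) \<le> Y" using Y by linarith
  ultimately show ?thesis using that[of "1 / Suc n"] by (simp add: U_def)
qed

lemma integral_linear_combination4:
  fixes f\<^sub>1 f\<^sub>2 f\<^sub>3 f\<^sub>4 :: "'a \<Rightarrow> real"
  assumes "integrable M f\<^sub>1" "integrable M f\<^sub>2" "integrable M f\<^sub>3" "integrable M f\<^sub>4"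
  shows "(\<integral>x. a\<^sub>1 * f\<^sub>1 x + (a\<^sub>2 * f\<^sub>2 x + (a\<^sub>3 * f\<^sub>3 x + a\<^sub>4 * f\<^sub>4 x)) \<partial>M) =
    a\<^sub>1 * (\<integral>x. f\<^sub>1 x \<partial>M) + (a\<^sub>2 * (\<integral>x. f\<^sub>2 x \<partial>M) + (a\<^sub>3 * (\<integral>x. f\<^sub>3 x \<partial>M) + a\<^sub>4 * (\<integral>x. f\<^sub>4 x \<partial>M)))"
  using assms by simp

text \<open>The Poisson formula at \<open>\<i> Y\<close> is applied to
  \<open>(1 - sum) exp (N W)\<close>. The value there is at least \<open>(D + 4) / 2\<close> in
  modulus; in the integral the Bessel bound costs \<open>D / 2\<close>, the amplifier off
  \<open>K\<close> costs 1 and the mass of the kernel 1/2, so \<open>exp (2 N) / 2\<close> times the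
  squared norm has to supply the missing 1/2. Hence \<open>\<epsilon> = exp (- 2 N)\<close>,
  independent of \<open>F\<close> and \<open>c\<close>.\<close>

theorem positive_frequencies_gap:
  assumes S: "S \<in> lmeasurable" "measure lebesgue S > 0" and d: "d > 0" "d\<^sub>1 > 0"
  obtains \<epsilon> where "\<epsilon> > 0"
    "\<And>F c. finite F \<Longrightarrow> separated d F \<Longrightarrow> \<forall>\<mu>\<in>F. d\<^sub>1 \<le> \<mu> \<Longrightarrow> (\<Sum>\<mu>\<in>F. (cmod (c \<mu>))\<^sup>2) \<le> 1 \<Longrightarrow>
      \<epsilon> \<le> L2_norm_sq (lebesgue_on S) (\<lambda>x. 1 - (\<Sum>\<mu>\<in>F. c \<mu> * expo \<mu> x))"
proof -
  obtain K where K: "compact K" "K \<subseteq> S" "measure lebesgue K > 0"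
    using compact_inner_pos[OF S] .
  \<comment> \<open>\<open>e\<close> separates the frequencies from each other and from the added
    frequency 0, and \<open>2 e\<close> is at most each of them, as
    \<open>trig_sum_upper_half_plane\<close> requires.\<close>
  define e where "e = min d (d\<^sub>1 / 2)"
  have e: "e > 0" "e \<le> d" "2 * e \<le> d\<^sub>1" using d by (auto simp: e_def)
  define Y where "Y = max 1 (1 / e)"
  have Y: "Y \<ge> 1" "Y \<ge> 1 / e" "Y > 0" by (auto simp: Y_def)
  define \<kappa> where "\<kappa> = (\<integral>t. indicator K t * poisson Y t \<partial>lborel)"
  have intK: "integrable lborel (\<lambda>t. indicator K t * poisson Y t)"
    using integrable_indicator_poisson[OF Y(3) K(1), of 0] by simp
  have \<kappa>: "\<kappa> > 0"
  proof -
    have "\<kappa> \<noteq> 0"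
    proof
      assume "\<kappa> = 0"
      moreover have "AE t in lborel. 0 \<le> indicator K t * poisson Y t"
        using poisson_pos[OF Y(3)] by (intro AE_I2 mult_nonneg_nonneg) (auto simp: less_imp_le)
      ultimately have "AE t in lborel. indicator K t * poisson Y t = 0"
        using integral_nonneg_eq_0_iff_AE[OF intK] unfolding \<kappa>_def by blast
      then have "AE t in lborel. t \<notin> K"
      proof eventually_elim
        case (elim t)
        then show ?case using poisson_pos[OF Y(3), of t] by (cases "t \<in> K") auto
      qed
      moreover have "K \<in> sets lborel" using borel_compact[OF K(1)] by simp
      ultimately have "K \<in> null_sets lborel" using AE_iff_null_sets by blast
      then have "measure lebesgue K = 0"
        by (intro measure_eq_0_null_sets null_sets_completionI)
      then show False using K(3) by simp
    qed
    moreover have "\<kappa> \<ge> 0" unfolding \<kappa>_def using poisson_pos[OF Y(3)]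
      by (intro Bochner_Integration.integral_nonneg) (auto simp: less_imp_le)
    ultimately show ?thesis by simp
  qed
  \<comment> \<open>The last factor 2 bounds the sum of the squared coefficients: 1 for the constant
    term and at most 1 for the rest.\<close>
  define D where "D = (1 + 4 / (pi * Y * e)\<^sup>2) * 2"
  have D: "D \<ge> 0" by (simp add: D_def)
  \<comment> \<open>\<open>\<kappa> / 4\<close> is the guaranteed harmonic measure at
    \<open>\<i> Y\<close>; \<open>N\<close> lifts the amplifier to at least \<open>D + 4\<close>
    there. It depends on \<open>\<kappa>\<close> and \<open>D\<close> but not on \<open>s\<close>,
    which is chosen afterwards.\<close>
  define N where "N = 4 * ln (D + 4) / \<kappa>"
  have N: "N \<ge> 0" "exp (N * (\<kappa> / 4)) = D + 4"
    using D \<kappa> by (auto simp: N_def)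
  obtain s where s: "0 < s" "s \<le> Y" and
    V: "(\<integral>x. indicator (- K) x * (poisson Y x * exp (2 * N * Re (cauchy_transform K s (of_real x)))) \<partial>lborel) \<le> 2"
    using exponential_amplifier[OF K(1) Y(1) N(1)] .
  define W where "W = cauchy_transform K s"
  define U where "U x = Re (W (of_real x))" for x
  have U: "0 \<le> U x" "U x \<le> 1" for x
    using Re_cauchy_transform[OF K(1) s(1), of "of_real x"] poisson_extension_bounds[OF s(1) K(1), of x] s
    by (auto simp: U_def W_def)
  have holW: "W holomorphic_on {z. Im z > - s}"
    unfolding W_def by (rule holomorphic_cauchy_transform[OF K(1) s(1)])
  have contU: "continuous_on UNIV U"
  proof -
    have "continuous_on UNIV (\<lambda>x. W (of_real x))"
      by (intro continuous_on_compose2[OF holomorphic_on_imp_continuous_on[OF holW]] continuous_intros)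
        (use s in auto)
    then show ?thesis unfolding U_def by (intro continuous_intros)
  qed
  have WY: "\<kappa> / 4 \<le> Re (W (\<i> * of_real Y))"
  proof -
    have "\<kappa> / 4 = (\<integral>t. indicator K t * poisson Y t / 4 \<partial>lborel)" by (simp add: \<kappa>_def)
    also have "\<dots> \<le> (\<integral>t. indicator K t * poisson (s + Y) t \<partial>lborel)"
    proof (rule integral_mono)
      show "integrable lborel (\<lambda>t. indicator K t * poisson (s + Y) t)"
        using integrable_indicator_poisson[OF _ K(1), of "s + Y" 0] s Y by simp
      show "indicator K t * poisson Y t / 4 \<le> indicator K t * poisson (s + Y) t" for t
        using poisson_harmonic_measure_quarter[OF s, of t] by (simp add: indicator_def)
    qed (use intK in simp)
    also have "\<dots> = Re (W (\<i> * of_real Y))"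
      using Re_cauchy_transform[OF K(1) s(1), of "\<i> * of_real Y"] s Y by (simp add: W_def)
    finally show ?thesis .
  qed
  show ?thesis
  proof (rule that[of "exp (- (2 * N))"])
    fix F :: "real set" and c :: "real \<Rightarrow> complex"
    assume F: "finite F" "separated d F" "\<forall>\<mu>\<in>F. d\<^sub>1 \<le> \<mu>" and c: "(\<Sum>\<mu>\<in>F. (cmod (c \<mu>))\<^sup>2) \<le> 1"
    define g where "g x = 1 - (\<Sum>\<mu>\<in>F. c \<mu> * expo \<mu> x)" for x
    define f where "f z = (1 - (\<Sum>\<mu>\<in>F. c \<mu> * exp (2 * of_real pi * \<i> * of_real \<mu> * z))) * exp (of_real N * W z)" for z
    have contg: "continuous_on UNIV g"
      unfolding g_def by (intro continuous_intros)
    have e0: "0 \<notin> F" using F d by auto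
    have sep: "separated e (insert 0 F)"
    proof -
      have "e \<le> \<bar>x - y\<bar>" if "x \<in> insert 0 F" "y \<in> insert 0 F" "x \<noteq> y" for x y
      proof (cases "x \<in> F \<and> y \<in> F")
        case True
        then show ?thesis using F(2) e(2) that(3) unfolding separated_def by (meson order_trans)
      next
        case False
        then have "(x = 0 \<and> d\<^sub>1 \<le> y) \<or> (y = 0 \<and> d\<^sub>1 \<le> x)" using that F(3) by blast
        then show ?thesis using e by linarith
      qed
      then show ?thesis unfolding separated_def by blast
    qed
    have gsum: "g x = (\<Sum>\<mu>\<in>insert 0 F. (if \<mu> = 0 then 1 else - c \<mu>) * expo \<mu> x)" for x
    proof -
      have "(\<Sum>\<mu>\<in>F. (if \<mu> = 0 then 1 else - c \<mu>) * expo \<mu> x) = (\<Sum>\<mu>\<in>F. - (c \<mu> * expo \<mu> x))"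
        using e0 by (intro sum.cong) auto
      then show ?thesis using e0 F by (simp add: g_def sum_negf)
    qed
    have csum: "(\<Sum>\<mu>\<in>insert 0 F. (cmod (if \<mu> = 0 then 1 else - c \<mu>))\<^sup>2) \<le> 2"
    proof -
      have "(\<Sum>\<mu>\<in>F. (cmod (if \<mu> = 0 then 1 else - c \<mu>))\<^sup>2) = (\<Sum>\<mu>\<in>F. (cmod (c \<mu>))\<^sup>2)"
        using e0 by (intro sum.cong) auto
      then show ?thesis using e0 F c by simp
    qed
    have int1: "integrable lborel (\<lambda>x. poisson Y x * (cmod (g x))\<^sup>2)"
      unfolding gsum using sep F e Y by (intro poisson_bessel(1)[where d = e]) auto
    have "(\<integral>x. poisson Y x * (cmod (g x))\<^sup>2 \<partial>lborel) \<le>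
        (1 + 4 / (pi * Y * e)\<^sup>2) * (\<Sum>\<mu>\<in>insert 0 F. (cmod (if \<mu> = 0 then 1 else - c \<mu>))\<^sup>2)"
      unfolding gsum using sep F e Y by (intro poisson_bessel(2)[where d = e]) auto
    also have "\<dots> \<le> D"
      unfolding D_def using csum by (intro mult_left_mono) auto
    finally have I1: "(\<integral>x. poisson Y x * (cmod (g x))\<^sup>2 \<partial>lborel) \<le> D" .
    have fx: "cmod (f (of_real x)) = cmod (g x) * exp (N * U x)" for x
      by (simp add: f_def g_def norm_mult U_def expo_def)
    have holf: "f holomorphic_on {z. Im z > - s}"
      unfolding f_def by (intro holomorphic_intros holW)
    have bf: "cmod (f z) \<le> (1 + (\<Sum>\<mu>\<in>F. cmod (c \<mu>))) * exp (N * (measure lborel K / (pi * s)))" if z: "Im z \<ge> 0" for z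
      unfolding f_def norm_mult
    proof (intro mult_mono)
      have "cmod (\<Sum>\<mu>\<in>F. c \<mu> * exp (2 * of_real pi * \<i> * of_real \<mu> * z)) \<le> (\<Sum>\<mu>\<in>F. cmod (c \<mu>))"
      proof (rule order_trans[OF norm_sum sum_mono])
        fix \<mu> assume "\<mu> \<in> F"
        then have "\<mu> \<ge> 0" using F d by force
        then have "cmod (exp (2 * of_real pi * \<i> * of_real \<mu> * z)) \<le> 1" using z by simp
        then show "cmod (c \<mu> * exp (2 * of_real pi * \<i> * of_real \<mu> * z)) \<le> cmod (c \<mu>)"
          by (simp add: norm_mult mult_left_le)
      qed
      then show "cmod (1 - (\<Sum>\<mu>\<in>F. c \<mu> * exp (2 * of_real pi * \<i> * of_real \<mu> * z))) \<le> 1 + (\<Sum>\<mu>\<in>F. cmod (c \<mu>))"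
        using norm_triangle_ineq4[of 1 "\<Sum>\<mu>\<in>F. c \<mu> * exp (2 * of_real pi * \<i> * of_real \<mu> * z)"] by simp
      have "Re (W z) \<le> measure lborel K / (pi * s)"
        using cmod_cauchy_transform_le[OF K(1) s(1) z] complex_Re_le_cmod[of "W z"] by (simp add: W_def)
      from mult_left_mono[OF this N(1)]
      show "cmod (exp (of_real N * W z)) \<le> exp (N * (measure lborel K / (pi * s)))" by simp
      show "0 \<le> 1 + (\<Sum>\<mu>\<in>F. cmod (c \<mu>))" by (intro add_nonneg_nonneg sum_nonneg) auto
    qed simp
    note PF = poisson_formula[OF s(1) holf Y(3) bf]
    have intK2: "integrable lborel (\<lambda>x. indicator K x *\<^sub>R (cmod (g x))\<^sup>2)"
      using contg by (intro borel_integrable_compact K continuous_intros) (auto intro: continuous_on_subset)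
    have intV: "integrable lborel (\<lambda>x. indicator (- K) x * (poisson Y x * exp (2 * N * U x)))"
    proof (rule Bochner_Integration.integrable_bound)
      show "integrable lborel (\<lambda>x. poisson Y x * exp (2 * N))"
        using poisson_integral[OF Y(3)] by simp
      show "(\<lambda>x. indicator (- K) x * (poisson Y x * exp (2 * N * U x))) \<in> borel_measurable lborel"
      proof -
        have [measurable]: "K \<in> sets borel" using K(1) by (rule borel_compact)
        have [measurable]: "U \<in> borel_measurable borel" using contU by (rule borel_measurable_continuous_onI)
        show ?thesis by measurable
      qed
      have "poisson Y x * exp (2 * N * U x) \<le> poisson Y x * exp (2 * N)" for x
        using poisson_pos[OF Y(3), of x] mult_left_mono[OF U(2)[of x], of "2 * N"] N(1)
        by (intro mult_left_mono) auto
      then show "AE x in lborel. norm (indicator (- K) x * (poisson Y x * exp (2 * N * U x)))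
          \<le> norm (poisson Y x * exp (2 * N))"
        using poisson_pos[OF Y(3)] by (intro AE_I2) (simp add: indicator_def abs_mult less_imp_le)
    qed
    have "1 / 2 \<le> cmod (1 - (\<Sum>\<mu>\<in>F. c \<mu> * of_real (exp (- (2 * pi * \<mu> * Y)))))"
    proof -
      have "cmod (\<Sum>\<mu>\<in>F. c \<mu> * of_real (exp (- (2 * pi * \<mu> * Y)))) \<le> 1 / 2"
      proof (rule trig_sum_upper_half_plane[OF F(1) separated_mono[OF F(2) e(2)] e(1) _ c Y(2)])
        show "\<forall>\<mu>\<in>F. 2 * e \<le> \<mu>" using F(3) e(3) by (meson order_trans)
      qed
      then show ?thesis
        using norm_triangle_ineq2[of 1 "\<Sum>\<mu>\<in>F. c \<mu> * of_real (exp (- (2 * pi * \<mu> * Y)))"] by simp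
    qed
    moreover have "exp (2 * of_real pi * \<i> * of_real \<mu> * (\<i> * of_real Y)) = complex_of_real (exp (- (2 * pi * \<mu> * Y)))" for \<mu>
      unfolding exp_of_real[symmetric] by (rule arg_cong[where f = exp]) (simp add: complex_eq_iff)
    moreover have "D + 4 \<le> exp (N * Re (W (\<i> * of_real Y)))"
    proof -
      have "N * (\<kappa> / 4) \<le> N * Re (W (\<i> * of_real Y))" using WY N(1) by (rule mult_left_mono)
      then show ?thesis unfolding N(2)[symmetric] by simp
    qed
    ultimately have "1 / 2 * (D + 4) \<le> cmod (f (\<i> * of_real Y))"
      unfolding f_def norm_mult using D by (intro mult_mono) auto
    also have "f (\<i> * of_real Y) = (\<integral>x. of_real (poisson Y x) * f (of_real x) \<partial>lborel)"
      using PF by simp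
    also have "cmod \<dots> \<le> (\<integral>x. cmod (of_real (poisson Y x) * f (of_real x)) \<partial>lborel)"
      by (rule integral_norm_bound)
    also have "\<dots> \<le> (\<integral>x. (1 / 2) * (poisson Y x * (cmod (g x))\<^sup>2) +
        ((1 / 2) * (indicator (- K) x * (poisson Y x * exp (2 * N * U x))) +
        ((1 / 2) * poisson Y x + exp (2 * N) / 2 * (indicator K x * (cmod (g x))\<^sup>2))) \<partial>lborel)"
    proof (rule integral_mono)
      show "integrable lborel (\<lambda>x. cmod (of_real (poisson Y x) * f (of_real x)))"
        using PF by (intro integrable_norm)
      show "integrable lborel (\<lambda>x. (1 / 2) * (poisson Y x * (cmod (g x))\<^sup>2) +
        ((1 / 2) * (indicator (- K) x * (poisson Y x * exp (2 * N * U x))) +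
        ((1 / 2) * poisson Y x + exp (2 * N) / 2 * (indicator K x * (cmod (g x))\<^sup>2))))"
        using int1 intV intK2 poisson_integral[OF Y(3)]
        by (intro Bochner_Integration.integrable_add integrable_mult_right) simp_all
      fix x
      define a where "a = cmod (g x)"
      define E where "E = exp (N * U x)"
      have a: "a \<ge> 0" and E: "E > 0" by (simp_all add: a_def E_def)
      have E2: "E\<^sup>2 = exp (2 * N * U x)" by (simp add: E_def exp_double[symmetric] mult.assoc)
      have E3: "E\<^sup>2 \<le> exp (2 * N)"
        unfolding E2 using U[of x] N(1) by (simp add: mult_left_le)
      have P: "0 < poisson Y x" "poisson Y x \<le> 1" using poisson_pos[OF Y(3)] poisson_le[OF Y(1)] by auto
      have lhs: "cmod (of_real (poisson Y x) * f (of_real x)) = poisson Y x * (a * E)"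
        using P by (simp add: norm_mult fx a_def E_def)
      show "cmod (of_real (poisson Y x) * f (of_real x)) \<le> (1 / 2) * (poisson Y x * (cmod (g x))\<^sup>2) +
        ((1 / 2) * (indicator (- K) x * (poisson Y x * exp (2 * N * U x))) +
        ((1 / 2) * poisson Y x + exp (2 * N) / 2 * (indicator K x * (cmod (g x))\<^sup>2)))"
      \<comment> \<open>On \<open>K\<close> the amplifier is bounded by \<open>exp (2 N)\<close> and
        charged to the norm of \<open>g\<close>; off \<open>K\<close> it is separated from
        \<open>g\<close>, and its own weighted integral is at most 2.\<close>
      proof (cases "x \<in> K")
        case True
        have "a * E \<le> 1 / 2 + a\<^sup>2 * E\<^sup>2 / 2"
          using zero_le_power2[of "1 - a * E"] by (simp add: power2_diff power_mult_distrib)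
        then have "poisson Y x * (a * E) \<le> poisson Y x * (1 / 2 + a\<^sup>2 * E\<^sup>2 / 2)"
          using P by (intro mult_left_mono) auto
        also have "\<dots> = (1 / 2) * poisson Y x + poisson Y x * (a\<^sup>2 * E\<^sup>2) / 2"
          by (simp add: algebra_simps)
        also have "poisson Y x * (a\<^sup>2 * E\<^sup>2) \<le> 1 * (a\<^sup>2 * exp (2 * N))"
          using P E3 by (intro mult_mono mult_left_mono) auto
        finally have "poisson Y x * (a * E) \<le> (1 / 2) * poisson Y x + 1 * (a\<^sup>2 * exp (2 * N)) / 2"
          by simp
        moreover have "0 \<le> poisson Y x * a\<^sup>2" using P by simp
        ultimately show ?thesis unfolding lhs using True by (simp add: a_def mult.commute)
      next
        case False
        have "a * E \<le> (a\<^sup>2 + E\<^sup>2) / 2"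
          using sum_squares_bound[of a E] by simp
        then have "poisson Y x * (a * E) \<le> poisson Y x * ((a\<^sup>2 + E\<^sup>2) / 2)"
          using P by (intro mult_left_mono) auto
        also have "\<dots> = (1 / 2) * (poisson Y x * a\<^sup>2) + (1 / 2) * (poisson Y x * E\<^sup>2)"
          by (simp add: algebra_simps add_divide_distrib)
        finally show ?thesis unfolding lhs E2 a_def using False P by simp
      qed
    qed
    also have "\<dots> = (1 / 2) * (\<integral>x. poisson Y x * (cmod (g x))\<^sup>2 \<partial>lborel) +
        ((1 / 2) * (\<integral>x. indicator (- K) x * (poisson Y x * exp (2 * N * U x)) \<partial>lborel) +
        ((1 / 2) * (\<integral>x. poisson Y x \<partial>lborel) + exp (2 * N) / 2 * (\<integral>x. indicator K x * (cmod (g x))\<^sup>2 \<partial>lborel)))"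
      using int1 intV intK2 poisson_integral[OF Y(3)]
      by (intro integral_linear_combination4) simp_all
    also have "\<dots> \<le> (1 / 2) * D + ((1 / 2) * 2 + ((1 / 2) * 1 + exp (2 * N) / 2 * L2_norm_sq (lebesgue_on S) g))"
    proof (intro add_mono mult_left_mono I1)
      show "(\<integral>x. indicator (- K) x * (poisson Y x * exp (2 * N * U x)) \<partial>lborel) \<le> 2"
        using V by (simp add: U_def W_def)
      have "square_integrable (lebesgue_on S) g"
        unfolding gsum by (rule square_integrable_trig[OF S(1)])
      then show "(\<integral>x. indicator K x * (cmod (g x))\<^sup>2 \<partial>lborel) \<le> L2_norm_sq (lebesgue_on S) g"
        by (intro integral_compact_le_L2_norm_sq S K contg)
    qed (use poisson_integral[OF Y(3)] in auto)
    finally have "1 \<le> exp (2 * N) * L2_norm_sq (lebesgue_on S) g"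
      by (simp add: field_simps)
    then have "exp (- (2 * N)) * 1 \<le> exp (- (2 * N)) * (exp (2 * N) * L2_norm_sq (lebesgue_on S) g)"
      by (intro mult_left_mono) auto
    then show "exp (- (2 * N)) \<le> L2_norm_sq (lebesgue_on S) (\<lambda>x. 1 - (\<Sum>\<mu>\<in>F. c \<mu> * expo \<mu> x))"
      unfolding g_def by (simp add: mult.assoc[symmetric] exp_add[symmetric])
  qed simp
qed

section \<open>Density of trigonometric polynomials\<close>

text \<open>Given by closure rules, so that products and periodicity follow by rule induction;
  \<open>trig_poly_sum\<close> recovers an explicit finite sum.\<close>

inductive trig_poly :: "real \<Rightarrow> (real \<Rightarrow> complex) \<Rightarrow> bool" for q where
  expo: "trig_poly q (\<lambda>x. expo (of_int k / q) x)"
| scale: "trig_poly q f \<Longrightarrow> trig_poly q (\<lambda>x. c * f x)"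
| add: "trig_poly q f \<Longrightarrow> trig_poly q g \<Longrightarrow> trig_poly q (\<lambda>x. f x + g x)"

lemma trig_poly_const: "trig_poly q (\<lambda>x. c)"
  using trig_poly.scale[OF trig_poly.expo[of q 0], of c] by simp

lemma trig_poly_mult_expo: "trig_poly q f \<Longrightarrow> trig_poly q (\<lambda>x. expo (of_int k / q) x * f x)"
proof (induction rule: trig_poly.induct)
  case (expo j)
  have "(\<lambda>x. expo (of_int k / q) x * expo (of_int j / q) x) = (\<lambda>x. expo (of_int (k + j) / q) x)"
    by (simp add: expo_mult add_divide_distrib)
  then show ?case by (simp only: trig_poly.expo)
next
  case (scale f c)
  have "(\<lambda>x. expo (of_int k / q) x * (c * f x)) = (\<lambda>x. c * (expo (of_int k / q) x * f x))"
    by (simp add: mult_ac)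
  then show ?case using trig_poly.scale[OF scale.IH, of c] by simp
next
  case (add f g)
  then show ?case using trig_poly.add[OF add.IH] by (simp add: distrib_left)
qed

lemma trig_poly_mult: "trig_poly q f \<Longrightarrow> trig_poly q g \<Longrightarrow> trig_poly q (\<lambda>x. f x * g x)"
proof (induction rule: trig_poly.induct)
  case (expo k)
  then show ?case by (rule trig_poly_mult_expo)
next
  case (scale f c)
  then show ?case using trig_poly.scale[of q "\<lambda>x. f x * g x" c] by (simp add: mult.assoc)
next
  case (add f h)
  then show ?case using trig_poly.add[of q "\<lambda>x. f x * g x" "\<lambda>x. h x * g x"] by (simp add: distrib_right)
qed

lemma trig_poly_sum:
  assumes "trig_poly q f"
  obtains K c where "finite K" "f = (\<lambda>x. \<Sum>k\<in>K. c k * expo (of_int k / q) x)"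
proof -
  have "\<exists>K c. finite K \<and> f = (\<lambda>x. \<Sum>k\<in>K. c k * expo (of_int k / q) x)"
    using assms
  proof (induction rule: trig_poly.induct)
    case (expo k)
    show ?case by (rule exI[of _ "{k}"], rule exI[of _ "\<lambda>_. 1"]) simp
  next
    case (scale f c)
    then obtain K b where K: "finite K" "f = (\<lambda>x. \<Sum>k\<in>K. b k * expo (of_int k / q) x)" by blast
    then have "(\<lambda>x. c * f x) = (\<lambda>x. \<Sum>k\<in>K. (c * b k) * expo (of_int k / q) x)"
      by (simp add: sum_distrib_left mult.assoc)
    with K(1) show ?case by (intro exI[of _ K] exI[of _ "\<lambda>k. c * b k"]) simp
  next
    case (add f g)
    then obtain K b L c where K: "finite K" "f = (\<lambda>x. \<Sum>k\<in>K. b k * expo (of_int k / q) x)"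
      and L: "finite L" "g = (\<lambda>x. \<Sum>k\<in>L. c k * expo (of_int k / q) x)" by blast
    define d where "d k = (if k \<in> K then b k else 0) + (if k \<in> L then c k else 0)" for k
    have "f x + g x = (\<Sum>k\<in>K \<union> L. d k * expo (of_int k / q) x)" for x
    proof -
      have "f x = (\<Sum>k\<in>K \<union> L. (if k \<in> K then b k else 0) * expo (of_int k / q) x)"
        unfolding K(2) using K(1) L(1) by (intro sum.mono_neutral_cong_left) auto
      moreover have "g x = (\<Sum>k\<in>K \<union> L. (if k \<in> L then c k else 0) * expo (of_int k / q) x)"
        unfolding L(2) using K(1) L(1) by (intro sum.mono_neutral_cong_left) auto
      ultimately show ?thesis by (simp add: d_def distrib_right sum.distrib)
    qed
    then have "(\<lambda>x. f x + g x) = (\<lambda>x. \<Sum>k\<in>K \<union> L. d k * expo (of_int k / q) x)" by blast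
    moreover have "finite (K \<union> L)" using K(1) L(1) by simp
    ultimately show ?case by blast
  qed
  then show ?thesis using that by blast
qed

lemma trig_poly_periodic: "trig_poly q f \<Longrightarrow> q \<noteq> 0 \<Longrightarrow> f (x + of_int j * q) = f x"
proof (induction rule: trig_poly.induct)
  case (expo k)
  have "of_int k / q * (of_int j * q) = of_int (k * j)" using expo by simp
  then have "expo (of_int k / q) (of_int j * q) = 1" by (intro expo_Ints) (metis Ints_of_int)
  then show ?case by (simp add: expo_add_right)
qed simp_all

lemma square_integrable_trig_poly:
  assumes "trig_poly q f" "S \<in> lmeasurable"
  shows "square_integrable (lebesgue_on S) f"
  using assms(1) by induction (auto intro: square_integrable_expo square_integrable_scale square_integrable_add assms)

text \<open>A linear functional of a point on the circle is a combination of the point and its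
  conjugate, that is of the frequencies \<open>1 / q\<close> and \<open>- 1 / q\<close>; sums and
  products stay trigonometric.\<close>

lemma trig_poly_real_polynomial:
  fixes P :: "complex \<Rightarrow> real"
  assumes "real_polynomial_function P"
  shows "trig_poly q (\<lambda>x. of_real (P (expo (1 / q) x)))"
  using assms
proof (induction rule: real_polynomial_function.induct)
  case (linear f)
  have eq: "complex_of_real (f (expo (1 / q) x)) =
      of_real (f 1) / 2 * (expo (of_int 1 / q) x + expo (of_int (- 1) / q) x) +
      of_real (f \<i>) / (2 * \<i>) * (expo (of_int 1 / q) x + (- 1) * expo (of_int (- 1) / q) x)" for x
  proof -
    let ?z = "expo (1 / q) x"
    have "f ?z = f (Re ?z *\<^sub>R 1 + Im ?z *\<^sub>R \<i>)"
      by (rule arg_cong[where f = f]) (simp add: complex_eq_iff)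
    also have "\<dots> = Re ?z * f 1 + Im ?z * f \<i>"
      using linear by (simp only: bounded_linear.linear linear_add linear_scale real_scaleR_def)
    finally have "complex_of_real (f ?z) = of_real (f 1) * of_real (Re ?z) + of_real (f \<i>) * of_real (Im ?z)"
      by simp
    moreover have "expo (of_int (- 1) / q) x = cnj ?z" by (simp add: cnj_expo)
    moreover have "of_real (Re ?z) = (?z + cnj ?z) / 2" "of_real (Im ?z) = (?z - cnj ?z) / (2 * \<i>)"
      by (simp_all add: complex_eq_iff Re_divide Im_divide)
    ultimately show ?thesis by simp
  qed
  show ?case unfolding eq by (intro trig_poly.intros)
next
  case (const c)
  show ?case by (rule trig_poly_const)
next
  case (add f g)
  then show ?case by (simp add: trig_poly.add)
next
  case (mult f g)
  then show ?case by (simp add: trig_poly_mult)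
qed

text \<open>Equal end values let \<open>g\<close> factor through the circle, where the
  Stone-Weierstrass theorem applies.\<close>

lemma uniform_trig_approx:
  assumes q: "q > 0" and g: "continuous_on {a..a + q} g" "g a = g (a + q)" and e: "e > 0"
  shows "\<exists>p. trig_poly q p \<and> (\<forall>x\<in>{a..a + q}. cmod (g x - p x) < e)"
proof -
  define E where "E x = expo (1 / q) x" for x
  have E_eq: "g x = g y" if "x \<in> {a..a + q}" "y \<in> {a..a + q}" "E x = E y" for x y
  proof -
    have "expo (1 / q) (x - y) = 1"
    proof -
      have "expo (1 / q) x = expo (1 / q) (x - y) * expo (1 / q) y"
        using expo_add_right[of "1 / q" "x - y" y] by simp
      then show ?thesis using that(3) norm_expo[of "1 / q" y] unfolding E_def
        by (metis mult_cancel_right1 norm_zero zero_neq_one)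
    qed
    then have "cis (2 * pi * ((x - y) / q)) = 1" by (simp add: expo_cis mult.assoc)
    moreover define u where "u = (x - y) / q"
    ultimately obtain k :: int where "2 * pi * u = of_int (2 * k) * pi"
      unfolding cis_conv_exp exp_eq_1 by auto
    then have "(x - y) / q = of_int k" unfolding u_def[symmetric] by simp
    then have k: "x - y = of_int k * q" using q by (simp add: field_simps)
    have "\<bar>x - y\<bar> \<le> q" using that by auto
    then have "\<bar>real_of_int k\<bar> * q \<le> 1 * q" unfolding k abs_mult using q by simp
    then have "\<bar>real_of_int k\<bar> \<le> 1" using q by (simp only: mult_le_cancel_right)
    \<comment> \<open>Two points of the interval with the same image coincide or are its two ends,
      where \<open>g\<close> agrees.\<close>
    then have "k = -1 \<or> k = 0 \<or> k = 1" by linarith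
    then show ?thesis using k that g(2) by (auto simp: algebra_simps)
  qed
  define S where "S = E ` {a..a + q}"
  have contE: "continuous_on T E" for T unfolding E_def by (rule continuous_on_expo)
  have S: "compact S" unfolding S_def by (intro compact_continuous_image contE) simp
  \<comment> \<open>A choice of preimage; \<open>E_eq\<close> makes the value independent of
    it.\<close>
  define h where "h z = g (SOME x. x \<in> {a..a + q} \<and> E x = z)" for z
  have h: "h (E x) = g x" if "x \<in> {a..a + q}" for x
  proof -
    have "(SOME y. y \<in> {a..a + q} \<and> E y = E x) \<in> {a..a + q} \<and> E (SOME y. y \<in> {a..a + q} \<and> E y = E x) = E x"
      by (rule someI[of "\<lambda>y. y \<in> {a..a + q} \<and> E y = E x" x]) (use that in simp)
    then show ?thesis unfolding h_def using E_eq that by blast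
  qed
  \<comment> \<open>Quotient map argument: preimages of closed sets under \<open>h\<close> are
    images of compact sets under \<open>E\<close>.\<close>
  have "continuous_on S h"
    unfolding continuous_on_closed_vimage[OF compact_imp_closed[OF S]]
  proof (intro allI impI)
    fix B :: "complex set" assume "closed B"
    have "h -` B \<inter> S = E ` (g -` B \<inter> {a..a + q})"
      using h by (auto simp: S_def)
    moreover have "closed (g -` B \<inter> {a..a + q})"
      using g(1) \<open>closed B\<close> continuous_on_closed_vimage[of "{a..a + q}" g] by simp
    then have "compact ({a..a + q} \<inter> (g -` B \<inter> {a..a + q}))"
      by (intro compact_Int_closed) auto
    then have "compact (g -` B \<inter> {a..a + q})" by (simp add: inf_commute inf_left_commute)
    ultimately show "closed (h -` B \<inter> S)"
      by (simp add: compact_imp_closed compact_continuous_image contE)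
  qed
  then obtain P where P: "polynomial_function P" "\<forall>z\<in>S. cmod (h z - P z) < e"
    using Stone_Weierstrass_polynomial_function[OF S _ e] by blast
  have re: "real_polynomial_function (Re \<circ> P)" "real_polynomial_function (Im \<circ> P)"
    using P(1) bounded_linear_Re bounded_linear_Im unfolding polynomial_function_def by blast+
  have "trig_poly q (\<lambda>x. of_real ((Re \<circ> P) (expo (1 / q) x)) + \<i> * of_real ((Im \<circ> P) (expo (1 / q) x)))"
    using re by (intro trig_poly.add trig_poly.scale trig_poly_real_polynomial)
  then have "trig_poly q (\<lambda>x. P (E x))"
    by (simp add: complex_eq[symmetric] E_def)
  moreover have "cmod (g x - P (E x)) < e" if "x \<in> {a..a + q}" for x
    using P(2) h[OF that] that unfolding S_def by force
  ultimately show ?thesis by blast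
qed

section \<open>Mean square approximation by trigonometric polynomials\<close>

definition trig_approximable :: "real \<Rightarrow> real set \<Rightarrow> (real \<Rightarrow> complex) \<Rightarrow> bool" where
  "trig_approximable q S f \<longleftrightarrow>
    (\<forall>\<epsilon>>0. \<exists>p. trig_poly q p \<and> L2_norm_sq (lebesgue_on S) (\<lambda>x. f x - p x) < \<epsilon>)"

lemma trig_approximable_limit:
  assumes S: "S \<in> lmeasurable" and f: "square_integrable (lebesgue_on S) f"
    and g: "\<And>n. trig_approximable q S (g n)" "\<And>n. square_integrable (lebesgue_on S) (g n)"
    and lim: "(\<lambda>n. L2_norm_sq (lebesgue_on S) (\<lambda>x. f x - g n x)) \<longlonglongrightarrow> 0"
  shows "trig_approximable q S f"
  unfolding trig_approximable_def
proof (intro allI impI)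
  fix \<epsilon> :: real assume \<epsilon>: "\<epsilon> > 0"
  then have "eventually (\<lambda>n. L2_norm_sq (lebesgue_on S) (\<lambda>x. f x - g n x) < \<epsilon> / 4) sequentially"
    by (intro order_tendstoD[OF lim]) simp
  then obtain n where n: "L2_norm_sq (lebesgue_on S) (\<lambda>x. f x - g n x) < \<epsilon> / 4"
    using eventually_happens'[OF sequentially_bot] by blast
  have "\<epsilon> / 4 > 0" using \<epsilon> by simp
  then obtain p where p: "trig_poly q p" "L2_norm_sq (lebesgue_on S) (\<lambda>x. g n x - p x) < \<epsilon> / 4"
    using g(1)[of n] unfolding trig_approximable_def by blast
  have "L2_norm_sq (lebesgue_on S) (\<lambda>x. (f x - g n x) + (g n x - p x)) \<le>
      2 * L2_norm_sq (lebesgue_on S) (\<lambda>x. f x - g n x) + 2 * L2_norm_sq (lebesgue_on S) (\<lambda>x. g n x - p x)"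
    by (intro L2_norm_sq_add_le square_integrable_diff f g square_integrable_trig_poly[OF p(1) S])
  then have "L2_norm_sq (lebesgue_on S) (\<lambda>x. f x - p x) < \<epsilon>" using n p(2) by simp
  with p(1) show "\<exists>p. trig_poly q p \<and> L2_norm_sq (lebesgue_on S) (\<lambda>x. f x - p x) < \<epsilon>" by blast
qed

context
  fixes q a :: real
  assumes q: "q > 0"
begin

lemma interval_lmeasurable: "{a..<a + q} \<in> lmeasurable"
  by (intro bounded_set_imp_lmeasurable) auto

lemma trig_approximable_continuous:
  assumes "continuous_on {a..a + q} g" "g a = g (a + q)"
  shows "trig_approximable q {a..<a + q} g"
  unfolding trig_approximable_def
proof (intro allI impI)
  fix \<epsilon> :: real assume \<epsilon>: "\<epsilon> > 0"
  define e where "e = sqrt (\<epsilon> / (2 * q))"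
  have e: "e > 0" "e\<^sup>2 = \<epsilon> / (2 * q)" using \<epsilon> q by (auto simp: e_def)
  obtain p where p: "trig_poly q p" "\<forall>x\<in>{a..a + q}. cmod (g x - p x) < e"
    using uniform_trig_approx[OF q assms e(1)] by blast
  have "L2_norm_sq (lebesgue_on {a..<a + q}) (\<lambda>x. g x - p x) \<le> (\<integral>x. e\<^sup>2 \<partial>(lebesgue_on {a..<a + q}))"
    unfolding L2_norm_sq_def
  proof (rule integral_mono')
    show "integrable (lebesgue_on {a..<a + q}) (\<lambda>x. e\<^sup>2)"
      by (rule finite_measure.integrable_const[OF finite_measure_lebesgue_on[OF interval_lmeasurable]])
    show "(cmod (g x - p x))\<^sup>2 \<le> e\<^sup>2" if "x \<in> space (lebesgue_on {a..<a + q})" for x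
      using p(2) that by (intro power_mono) (auto simp: less_imp_le)
  qed simp
  also have "\<dots> = q * e\<^sup>2" using q by (simp add: measure_restrict_space)
  also have "\<dots> < \<epsilon>" using e(2) \<epsilon> q by simp
  finally show "\<exists>p. trig_poly q p \<and> L2_norm_sq (lebesgue_on {a..<a + q}) (\<lambda>x. g x - p x) < \<epsilon>"
    using p(1) by blast
qed

lemma trig_approximable_bounded:
  assumes f: "f \<in> borel_measurable (lebesgue_on {a..<a + q})" and C: "\<And>x. x \<in> {a..<a + q} \<Longrightarrow> cmod (f x) \<le> C"
  shows "trig_approximable q {a..<a + q} f"
proof -
  let ?S = "{a..<a + q}"
  have C0: "C \<ge> 0" using C[of a] q order_trans[OF norm_ge_zero] by auto
  have "f measurable_on ?S"
    using f by (simp add: measurable_on_iff_borel_measurable)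
  then obtain N g where N: "negligible N" and g: "\<And>n. continuous_on UNIV (g n)"
    and lim: "\<And>x. x \<notin> N \<Longrightarrow> (\<lambda>n. g n x) \<longlonglongrightarrow> (if x \<in> ?S then f x else 0)"
    unfolding measurable_on_def by blast
  \<comment> \<open>\<open>\<phi>\<close> retracts onto the disc of radius \<open>C\<close>, because
    the continuous functions converging to \<open>f\<close> come without a bound and dominated
    convergence needs one.\<close>
  define \<phi> :: "complex \<Rightarrow> complex" where "\<phi> = closest_point (cball 0 C)"
  have \<phi>: "continuous_on T \<phi>" "cmod (\<phi> z) \<le> C" "cmod z \<le> C \<Longrightarrow> \<phi> z = z" for T z
  proof -
    show "continuous_on T \<phi>" unfolding \<phi>_def using C0 by (intro continuous_on_closest_point) auto
    have "\<phi> z \<in> cball 0 C" unfolding \<phi>_def using C0 by (intro closest_point_in_set) auto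
    then show "cmod (\<phi> z) \<le> C" by simp
    show "cmod z \<le> C \<Longrightarrow> \<phi> z = z" unfolding \<phi>_def by (intro closest_point_self) simp
  qed
  \<comment> \<open>A cut-off that vanishes at both ends gives the approximants equal end values; at
    each interior point it is eventually 1.\<close>
  define \<psi> where "\<psi> n x = max 0 (min 1 (real n * min (x - a) (a + q - x)))" for n x
  have \<psi>01: "0 \<le> \<psi> n x" "\<psi> n x \<le> 1" for n x by (auto simp: \<psi>_def)
  define G where "G n x = of_real (\<psi> n x) * \<phi> (g n x)" for n x
  have contG: "continuous_on T (G n)" for T n
    unfolding G_def \<psi>_def
    by (intro continuous_intros continuous_on_compose2[OF \<phi>(1)[of UNIV]] continuous_on_subset[OF g]) auto
  have GC: "cmod (G n x) \<le> C" for n x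
    using mult_mono[OF \<psi>01(2) \<phi>(2)[of "g n x"], of n x] \<psi>01(1)[of n x] by (simp add: G_def norm_mult)
  have mG: "G n \<in> borel_measurable (lebesgue_on ?S)" for n
    using contG by (intro continuous_imp_measurable_on_sets_lebesgue) auto
  show ?thesis
  proof (rule trig_approximable_limit[OF interval_lmeasurable])
    show "square_integrable (lebesgue_on ?S) f"
      using square_integrable_bounded_on[OF interval_lmeasurable f C] .
    show "trig_approximable q ?S (G n)" for n
      by (intro trig_approximable_continuous contG) (use q in \<open>simp add: G_def \<psi>_def min_def\<close>)
    show "square_integrable (lebesgue_on ?S) (G n)" for n
      using square_integrable_bounded_on[OF interval_lmeasurable mG GC] .
    have "(\<lambda>n. \<integral>x. (cmod (f x - G n x))\<^sup>2 \<partial>(lebesgue_on ?S)) \<longlonglongrightarrow> (\<integral>x. 0 \<partial>(lebesgue_on ?S))"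
    proof (rule integral_dominated_convergence)
      show "integrable (lebesgue_on ?S) (\<lambda>x. (2 * C)\<^sup>2)"
        by (rule finite_measure.integrable_const[OF finite_measure_lebesgue_on[OF interval_lmeasurable]])
      show "(\<lambda>x. (cmod (f x - G n x))\<^sup>2) \<in> borel_measurable (lebesgue_on ?S)" for n
        using f mG[of n] by measurable
      have "insert a N \<in> null_sets lebesgue"
        using N negligible_insert[of a N] by (simp add: negligible_iff_null_sets)
      then have "AE x in lebesgue. x \<notin> insert a N" by (rule AE_not_in)
      then have "AE x in lebesgue. x \<in> ?S \<longrightarrow> x \<notin> insert a N" by (rule eventually_mono) blast
      then have ae: "AE x in lebesgue_on ?S. x \<notin> insert a N"
        by (rule AE_restrict_space_iff[THEN iffD2, rotated]) simp
      have sp: "AE x in lebesgue_on ?S. x \<in> ?S" by (rule AE_I2) simp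
      show "AE x in lebesgue_on ?S. (\<lambda>n. (cmod (f x - G n x))\<^sup>2) \<longlonglongrightarrow> 0"
        using ae sp
      proof eventually_elim
        case (elim x)
        then have x: "x \<notin> N" "a < x" "x < a + q" by auto
        have "(\<lambda>n. \<phi> (g n x)) \<longlonglongrightarrow> \<phi> (f x)"
          using lim[OF x(1)] elim continuous_on_tendsto_compose[OF \<phi>(1)[of UNIV]] by auto
        moreover have "\<phi> (f x) = f x" using C elim by (intro \<phi>(3)) auto
        moreover have "(\<lambda>n. \<psi> n x) \<longlonglongrightarrow> 1"
        proof (rule tendsto_eventually)
          define m where "m = min (x - a) (a + q - x)"
          have "m > 0" using x by (simp add: m_def)
          obtain M where M: "1 / m \<le> real M" using real_arch_simple by blast
          show "\<forall>\<^sub>F n in sequentially. \<psi> n x = 1"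
            using eventually_ge_at_top[of M]
          proof eventually_elim
            case (elim n)
            then have "1 / m \<le> real n" using M by simp
            then have "1 \<le> real n * m" using \<open>m > 0\<close> by (simp add: pos_divide_le_eq)
            then show ?case by (simp add: \<psi>_def m_def)
          qed
        qed
        ultimately have "(\<lambda>n. G n x) \<longlonglongrightarrow> of_real 1 * f x"
          unfolding G_def by (intro tendsto_intros) auto
        then have "(\<lambda>n. (cmod (f x - G n x))\<^sup>2) \<longlonglongrightarrow> (cmod (f x - of_real 1 * f x))\<^sup>2"
          by (intro tendsto_intros)
        then show ?case by simp
      qed
      show "AE x in lebesgue_on ?S. norm ((cmod (f x - G n x))\<^sup>2) \<le> (2 * C)\<^sup>2" for n
      proof (rule AE_I2)
        fix x assume "x \<in> space (lebesgue_on ?S)"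
        then have "cmod (f x - G n x) \<le> 2 * C"
          using norm_triangle_ineq4[of "f x" "G n x"] C[of x] GC[of n x] by simp
        then have "(cmod (f x - G n x))\<^sup>2 \<le> (2 * C)\<^sup>2" by (intro power_mono) auto
        then show "norm ((cmod (f x - G n x))\<^sup>2) \<le> (2 * C)\<^sup>2" by simp
      qed
    qed simp
    then show "(\<lambda>n. L2_norm_sq (lebesgue_on ?S) (\<lambda>x. f x - G n x)) \<longlonglongrightarrow> 0"
      by (simp add: L2_norm_sq_def)
  qed
qed

text \<open>Replacing large values by 0 reduces to bounded functions, with the squared modulus of
  \<open>f\<close> as dominating function.\<close>

theorem trig_approximable_square_integrable:
  assumes f: "square_integrable (lebesgue_on {a..<a + q}) f"
  shows "trig_approximable q {a..<a + q} f"
proof -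
  let ?M = "lebesgue_on {a..<a + q}"
  define g where "g n x = (if cmod (f x) \<le> real n then f x else 0)" for n x
  have fm [measurable]: "f \<in> borel_measurable ?M" using f by (simp add: square_integrable_def)
  have gm [measurable]: "g n \<in> borel_measurable ?M" for n unfolding g_def by measurable
  have gb: "cmod (g n x) \<le> real n" for n x by (simp add: g_def)
  show ?thesis
  proof (rule trig_approximable_limit[OF interval_lmeasurable f])
    show "trig_approximable q {a..<a + q} (g n)" for n
      using gm gb by (rule trig_approximable_bounded)
    show "square_integrable ?M (g n)" for n
      using gm gb by (rule square_integrable_bounded_on[OF interval_lmeasurable])
    have "(\<lambda>n. \<integral>x. (cmod (f x - g n x))\<^sup>2 \<partial>?M) \<longlonglongrightarrow> (\<integral>x. 0 \<partial>?M)"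
    proof (rule integral_dominated_convergence)
      show "integrable ?M (\<lambda>x. (cmod (f x))\<^sup>2)" using f by (simp add: square_integrable_def)
      show "(\<lambda>x. (cmod (f x - g n x))\<^sup>2) \<in> borel_measurable ?M" for n by measurable
      show "AE x in ?M. (\<lambda>n. (cmod (f x - g n x))\<^sup>2) \<longlonglongrightarrow> 0"
      proof (rule AE_I2, rule tendsto_eventually)
        fix x
        obtain N where "cmod (f x) \<le> real N" using real_arch_simple by blast
        then show "\<forall>\<^sub>F n in sequentially. (cmod (f x - g n x))\<^sup>2 = 0"
          by (intro eventually_mono[OF eventually_ge_at_top[of N]]) (auto simp: g_def)
      qed
      show "AE x in ?M. norm ((cmod (f x - g n x))\<^sup>2) \<le> (cmod (f x))\<^sup>2" for n
        by (rule AE_I2) (simp add: g_def)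
    qed simp
    then show "(\<lambda>n. L2_norm_sq ?M (\<lambda>x. f x - g n x)) \<longlonglongrightarrow> 0"
      by (simp add: L2_norm_sq_def)
  qed
qed

end

section \<open>Periodicity of spectra of bounded sets\<close>

text \<open>On \<open>{- R..<R}\<close> the kernel \<open>poisson 1\<close> is at least
  \<open>poisson 1 R\<close>, so the weighted Bessel inequality dominates the plain norm.\<close>

lemma trig_norm_bounded_interval:
  assumes "R > 0" "d > 0"
  obtains C where "C > 0"
    "\<And>F c. finite F \<Longrightarrow> separated d F \<Longrightarrow>
      L2_norm_sq (lebesgue_on {- R..<R}) (\<lambda>x. \<Sum>\<mu>\<in>F. c \<mu> * expo \<mu> x) \<le> C * (\<Sum>\<mu>\<in>F. (cmod (c \<mu>))\<^sup>2)"
proof (rule that[of "(1 + 4 / (pi * 1 * d)\<^sup>2) / poisson 1 R"])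
  have p: "poisson 1 R > 0" by (rule poisson_pos) simp
  show "(1 + 4 / (pi * 1 * d)\<^sup>2) / poisson 1 R > 0"
    using p by (intro divide_pos_pos add_pos_nonneg) auto
  fix F :: "real set" and c :: "real \<Rightarrow> complex"
  assume F: "finite F" "separated d F"
  define h where "h x = (\<Sum>\<mu>\<in>F. c \<mu> * expo \<mu> x)" for x
  have conth: "continuous_on UNIV h" unfolding h_def by (intro continuous_intros)
  have [measurable]: "h \<in> borel_measurable borel" using conth by (rule borel_measurable_continuous_onI)
  have "L2_norm_sq (lebesgue_on {- R..<R}) h = (\<integral>x. indicator {- R..<R} x *\<^sub>R (cmod (h x))\<^sup>2 \<partial>lebesgue)"
    unfolding L2_norm_sq_def by (rule integral_restrict_space) simp
  also have "\<dots> = (\<integral>x. indicator {- R..<R} x *\<^sub>R (cmod (h x))\<^sup>2 \<partial>lborel)"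
    by (rule integral_completion) measurable
  also have "\<dots> \<le> (\<integral>x. (1 / poisson 1 R) * (poisson 1 x * (cmod (h x))\<^sup>2) \<partial>lborel)"
  proof (rule integral_mono')
    show "integrable lborel (\<lambda>x. (1 / poisson 1 R) * (poisson 1 x * (cmod (h x))\<^sup>2))"
      unfolding h_def using F assms by (intro integrable_mult_right poisson_bessel(1)[of 1 F d]) auto
    show "indicator {- R..<R} x *\<^sub>R (cmod (h x))\<^sup>2 \<le> (1 / poisson 1 R) * (poisson 1 x * (cmod (h x))\<^sup>2)" for x
    proof (cases "x \<in> {- R..<R}")
      case True
      then have "x\<^sup>2 \<le> R\<^sup>2" using assms by (intro abs_le_square_iff[THEN iffD1]) auto
      then have "poisson 1 R \<le> poisson 1 x"
        unfolding poisson_def by (intro divide_left_mono mult_left_mono mult_pos_pos) (auto intro: add_nonneg_pos)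
      then have "1 \<le> poisson 1 x / poisson 1 R" using p by simp
      then have "1 * (cmod (h x))\<^sup>2 \<le> (poisson 1 x / poisson 1 R) * (cmod (h x))\<^sup>2" by (rule mult_right_mono) simp
      then show ?thesis using True by simp
    next
      case False
      then show ?thesis using p poisson_pos[of 1 x] by simp
    qed
    show "0 \<le> (1 / poisson 1 R) * (poisson 1 x * (cmod (h x))\<^sup>2)" for x
      using p poisson_pos[of 1 x] by simp
  qed
  also have "\<dots> = (1 / poisson 1 R) * (\<integral>x. poisson 1 x * (cmod (h x))\<^sup>2 \<partial>lborel)" by simp
  also have "\<dots> \<le> (1 / poisson 1 R) * ((1 + 4 / (pi * 1 * d)\<^sup>2) * (\<Sum>\<mu>\<in>F. (cmod (c \<mu>))\<^sup>2))"
    unfolding h_def using F assms p by (intro mult_left_mono poisson_bessel(2)) auto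
  finally show "L2_norm_sq (lebesgue_on {- R..<R}) (\<lambda>x. \<Sum>\<mu>\<in>F. c \<mu> * expo \<mu> x) \<le>
      (1 + 4 / (pi * 1 * d)\<^sup>2) / poisson 1 R * (\<Sum>\<mu>\<in>F. (cmod (c \<mu>))\<^sup>2)"
    by (simp add: h_def[abs_def])
qed

text \<open>Cauchy-Schwarz as a weighted mean; the parameter \<open>t\<close> avoids square roots
  and is balanced at the point of use.\<close>

lemma cmod_L2_inner_le:
  assumes f: "square_integrable M f" and g: "square_integrable M g" and t: "t > 0"
  shows "cmod (L2_inner M f g) \<le> (t * L2_norm_sq M f + L2_norm_sq M g / t) / 2"
proof -
  have "cmod (L2_inner M f g) \<le> (\<integral>x. cmod (f x * cnj (g x)) \<partial>M)"
    unfolding L2_inner_def by (rule integral_norm_bound)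
  also have "\<dots> \<le> (\<integral>x. t / 2 * (cmod (f x))\<^sup>2 + 1 / (2 * t) * (cmod (g x))\<^sup>2 \<partial>M)"
  proof (rule integral_mono)
    show "integrable M (\<lambda>x. cmod (f x * cnj (g x)))"
      by (intro integrable_norm integrable_inner f g)
    show "integrable M (\<lambda>x. t / 2 * (cmod (f x))\<^sup>2 + 1 / (2 * t) * (cmod (g x))\<^sup>2)"
      using f g by (intro Bochner_Integration.integrable_add integrable_mult_right) (auto simp: square_integrable_def)
    fix x
    have "0 \<le> (t * cmod (f x) - cmod (g x))\<^sup>2 / (2 * t)" using t by simp
    also have "\<dots> = t / 2 * (cmod (f x))\<^sup>2 + 1 / (2 * t) * (cmod (g x))\<^sup>2 - cmod (f x) * cmod (g x)"
      using t by (simp add: power2_eq_square field_simps)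
    finally show "cmod (f x * cnj (g x)) \<le> t / 2 * (cmod (f x))\<^sup>2 + 1 / (2 * t) * (cmod (g x))\<^sup>2"
      by (simp add: norm_mult)
  qed
  also have "\<dots> = t / 2 * L2_norm_sq M f + 1 / (2 * t) * L2_norm_sq M g"
    using f g by (simp add: L2_norm_sq_def square_integrable_def)
  also have "\<dots> = (t * L2_norm_sq M f + L2_norm_sq M g / t) / 2"
    by (simp add: field_simps)
  finally show ?thesis .
qed

text \<open>Duality: when a sum is synthesised with the coefficients of \<open>g\<close> itself, its
  inner product with \<open>g\<close> is the sum \<open>\<sigma>\<close> of their squares. The
  weight \<open>t = 1 / C\<close> bounds \<open>\<sigma>\<close> by the mean of
  \<open>\<sigma>\<close> and \<open>C\<close> times the squared norm, and the finite
  \<open>\<sigma>\<close> is absorbed.\<close>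

lemma dual_bessel:
  assumes "R > 0" "d > 0"
  obtains C where "C > 0"
    "\<And>F g. finite F \<Longrightarrow> separated d F \<Longrightarrow> square_integrable (lebesgue_on {- R..<R}) g \<Longrightarrow>
      (\<Sum>\<mu>\<in>F. (cmod (L2_inner (lebesgue_on {- R..<R}) g (expo \<mu>)))\<^sup>2) \<le> C * L2_norm_sq (lebesgue_on {- R..<R}) g"
proof -
  let ?M = "lebesgue_on {- R..<R}"
  have lm: "{- R..<R} \<in> lmeasurable" by (intro bounded_set_imp_lmeasurable) auto
  obtain C where C: "C > 0" and bound: "\<And>F c. finite F \<Longrightarrow> separated d F \<Longrightarrow>
      L2_norm_sq ?M (\<lambda>x. \<Sum>\<mu>\<in>F. c \<mu> * expo \<mu> x) \<le> C * (\<Sum>\<mu>\<in>F. (cmod (c \<mu>))\<^sup>2)"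
    by (rule trig_norm_bounded_interval[OF assms]) blast
  show ?thesis
  proof (rule that[OF C])
    fix F g assume F: "finite F" "separated d F" and g: "square_integrable ?M g"
    define c where "c \<mu> = L2_inner ?M g (expo \<mu>)" for \<mu>
    define h where "h x = (\<Sum>\<mu>\<in>F. c \<mu> * expo \<mu> x)" for x
    have h: "square_integrable ?M h" unfolding h_def by (rule square_integrable_trig[OF lm])
    define \<sigma> where "\<sigma> = (\<Sum>\<mu>\<in>F. (cmod (c \<mu>))\<^sup>2)"
    have "L2_inner ?M h g = (\<Sum>\<mu>\<in>F. L2_inner ?M (\<lambda>x. c \<mu> * expo \<mu> x) g)"
      unfolding h_def by (intro L2_inner_sum_left square_integrable_scale square_integrable_expo lm g)
    also have "\<dots> = (\<Sum>\<mu>\<in>F. c \<mu> * cnj (c \<mu>))"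
      by (intro sum.cong refl) (simp add: L2_inner_scale_left c_def L2_inner_cnj[of ?M "expo _" g])
    also have "\<dots> = of_real \<sigma>"
      by (simp add: \<sigma>_def complex_norm_square del: of_real_power)
    finally have "\<sigma> \<le> cmod (L2_inner ?M h g)" by simp
    also have "\<dots> \<le> (1 / C * L2_norm_sq ?M h + L2_norm_sq ?M g / (1 / C)) / 2"
      using C by (intro cmod_L2_inner_le h g) simp
    also have "\<dots> \<le> (1 / C * (C * \<sigma>) + L2_norm_sq ?M g / (1 / C)) / 2"
      unfolding h_def \<sigma>_def using C F by (intro divide_right_mono add_right_mono mult_left_mono bound) auto
    also have "\<dots> = (\<sigma> + C * L2_norm_sq ?M g) / 2" using C by simp
    finally have "\<sigma> \<le> C * L2_norm_sq ?M g" by simp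
    then show "(\<Sum>\<mu>\<in>F. (cmod (L2_inner ?M g (expo \<mu>)))\<^sup>2) \<le> C * L2_norm_sq ?M g"
      by (simp add: \<sigma>_def c_def)
  qed
qed

section \<open>Decay of the Fourier transform of a bounded set\<close>

lemma integral_expo_interval:
  assumes "R > 0" "\<theta> \<noteq> 0"
  shows "cmod (\<integral>x. expo \<theta> x \<partial>(lebesgue_on {- R..<R})) \<le> 1 / (pi * \<bar>\<theta>\<bar>)"
proof -
  define F where "F x = expo \<theta> x / (2 * of_real pi * \<i> * of_real \<theta>)" for x
  have "(expo \<theta> has_integral F R - F (- R)) {- R..R}"
  proof (rule fundamental_theorem_of_calculus)
    fix x assume "x \<in> {- R..R}"
    show "(F has_vector_derivative expo \<theta> x) (at x within {- R..R})"
      unfolding F_def expo_def using assms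
      by (auto intro!: derivative_eq_intros has_vector_derivative_real_field)
  qed (use assms in simp)
  then have "(expo \<theta> has_integral F R - F (- R)) {- R..<R}"
    by (subst has_integral_spike_set_eq[where T = "{- R..R}"]) (auto intro: negligible_subset[of "{R}"])
  moreover have "integrable (lebesgue_on {- R..<R}) (expo \<theta>)"
  proof -
    have lm: "{- R..<R} \<in> lmeasurable" by (intro bounded_set_imp_lmeasurable) auto
    show ?thesis
      by (rule finite_measure.integrable_const_bound[OF finite_measure_lebesgue_on[OF lm], of _ 1]) auto
  qed
  ultimately have "(\<integral>x. expo \<theta> x \<partial>(lebesgue_on {- R..<R})) = F R - F (- R)"
    by (subst lebesgue_integral_eq_integral) (auto dest: integral_unique)
  also have "cmod \<dots> \<le> cmod (F R) + cmod (F (- R))" by (rule norm_triangle_ineq4)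
  also have "\<dots> = 1 / (pi * \<bar>\<theta>\<bar>)" by (simp add: F_def norm_divide norm_mult)
  finally show ?thesis .
qed

text \<open>The Fourier transform of the indicator, with positive sign in the exponent. Exponentials
  on \<open>S\<close> are orthogonal exactly when it vanishes at the difference of their
  frequencies.\<close>

definition ind_transform :: "real set \<Rightarrow> real \<Rightarrow> complex" where
  "ind_transform S x = (\<integral>t. expo x t \<partial>(lebesgue_on S))"

lemma L2_inner_expo: "L2_inner (lebesgue_on S) (expo l) (expo m) = ind_transform S (l - m)"
  by (simp add: L2_inner_def expo_mult_cnj ind_transform_def)

lemma ind_transform_0: "S \<in> lmeasurable \<Longrightarrow> ind_transform S 0 = of_real (measure lebesgue S)"
  by (simp add: ind_transform_def measure_restrict_space fmeasurableD scaleR_conv_of_real)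

lemma L2_norm_sq_expo: "S \<in> lmeasurable \<Longrightarrow> L2_norm_sq (lebesgue_on S) (expo l) = measure lebesgue S"
  by (simp add: L2_norm_sq_def measure_restrict_space fmeasurableD)

lemma ind_transform_minus: "ind_transform S (- x) = cnj (ind_transform S x)"
  by (simp only: ind_transform_def cnj_expo[symmetric] Bochner_Integration.integral_cnj)

text \<open>The indicator is approximated by a trigonometric polynomial \<open>p\<close>. The
  difference is small for all separated frequency sets by \<open>dual_bessel\<close>, and the
  coefficients of \<open>p\<close> fall off like \<open>1 / |\<mu>|\<close>, whose squares have
  small sums far out.\<close>

lemma ind_transform_tail:
  assumes S: "S \<in> lmeasurable" "S \<subseteq> {- R..<R}" and R: "R > 0" and d: "d > 0" and \<epsilon>: "\<epsilon> > 0"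
  obtains L where "L > 0"
    "\<And>F. finite F \<Longrightarrow> separated d F \<Longrightarrow> \<forall>\<mu>\<in>F. L \<le> \<bar>\<mu>\<bar> \<Longrightarrow> (\<Sum>\<mu>\<in>F. (cmod (ind_transform S \<mu>))\<^sup>2) \<le> \<epsilon>"
proof -
  let ?M = "lebesgue_on {- R..<R}"
  have lm: "{- R..<R} \<in> lmeasurable" by (intro bounded_set_imp_lmeasurable) auto
  have Sl: "S \<in> sets lebesgue" using S by (simp add: fmeasurableD)
  obtain C where C: "C > 0" and bessel: "\<And>F g. finite F \<Longrightarrow> separated d F \<Longrightarrow> square_integrable ?M g \<Longrightarrow>
      (\<Sum>\<mu>\<in>F. (cmod (L2_inner ?M g (expo \<mu>)))\<^sup>2) \<le> C * L2_norm_sq ?M g"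
    by (rule dual_bessel[OF R d]) blast
  define f :: "real \<Rightarrow> complex" where "f = indicator S"
  have fm: "f \<in> borel_measurable ?M"
    unfolding f_def using Sl by (intro measurable_restrict_space1 borel_measurable_indicator)
  have f: "square_integrable ?M f"
    by (rule square_integrable_bounded_on[OF lm fm, of 1]) (simp add: f_def indicator_def)
  have "trig_approximable (2 * R) {- R..<- R + 2 * R} f"
    using f R by (intro trig_approximable_square_integrable) simp_all
  then have "trig_approximable (2 * R) {- R..<R} f" by simp
  moreover have "\<epsilon> / (4 * C) > 0" using \<epsilon> C by simp
  ultimately obtain p where p: "trig_poly (2 * R) p" "L2_norm_sq ?M (\<lambda>x. f x - p x) < \<epsilon> / (4 * C)"
    unfolding trig_approximable_def by blast
  obtain K c where K: "finite K" "p = (\<lambda>x. \<Sum>k\<in>K. c k * expo (of_int k / (2 * R)) x)"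
    using trig_poly_sum[OF p(1)] .
  have pm: "square_integrable ?M p" by (rule square_integrable_trig_poly[OF p(1) lm])
  define A where "A = (\<Sum>k\<in>K. cmod (c k))"
  have A: "A \<ge> 0" by (simp add: A_def sum_nonneg)
  define B where "B = (\<Sum>k\<in>K. \<bar>of_int k / (2 * R)\<bar>)"
  have B: "\<bar>of_int k / (2 * R)\<bar> \<le> B" if "k \<in> K" for k
    unfolding B_def using that K(1) by (intro member_le_sum) auto
  have B0: "B \<ge> 0" by (simp add: B_def sum_nonneg)
  \<comment> \<open>The term \<open>2 * B\<close> keeps \<open>\<mu>\<close> at a distance of at
    least half its size from the frequencies of \<open>p\<close>; the last term makes the inverse
    square tail at most \<open>\<epsilon> / 2\<close>.\<close>
  define L where "L = 2 * B + d + 1 + 8 * (2 * A / pi)\<^sup>2 / (d * \<epsilon>)"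
  have L: "L > d" "L \<ge> 2 * B" "L > 0" "8 * (2 * A / pi)\<^sup>2 / (d * \<epsilon>) \<le> L - d"
  proof -
    have "0 \<le> 8 * (2 * A / pi)\<^sup>2 / (d * \<epsilon>)" using d \<epsilon> by simp
    then show "L > d" "L \<ge> 2 * B" "L > 0" "8 * (2 * A / pi)\<^sup>2 / (d * \<epsilon>) \<le> L - d"
      using B0 d unfolding L_def by linarith+
  qed
  show ?thesis
  proof (rule that[OF L(3)])
    fix F assume F: "finite F" "separated d F" "\<forall>\<mu>\<in>F. L \<le> \<bar>\<mu>\<bar>"
    have fe: "L2_inner ?M f (expo \<mu>) = ind_transform S (- \<mu>)" for \<mu>
    proof -
      have "L2_inner ?M f (expo \<mu>) = (\<integral>x. indicator S x * expo (- \<mu>) x \<partial>?M)"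
        by (simp add: L2_inner_def f_def cnj_expo)
      also have "\<dots> = (\<integral>x. indicator {- R..<R} x *\<^sub>R (indicator S x * expo (- \<mu>) x) \<partial>lebesgue)"
        by (rule integral_restrict_space) simp
      also have "(\<lambda>x. indicator {- R..<R} x *\<^sub>R (indicator S x * expo (- \<mu>) x)) = (\<lambda>x. indicator S x *\<^sub>R expo (- \<mu>) x)"
        using S(2) by (auto simp: indicator_def fun_eq_iff)
      also have "(\<integral>x. indicator S x *\<^sub>R expo (- \<mu>) x \<partial>lebesgue) = ind_transform S (- \<mu>)"
        unfolding ind_transform_def using Sl by (subst integral_restrict_space) auto
      finally show ?thesis .
    qed
    have pe: "cmod (L2_inner ?M p (expo \<mu>)) \<le> (2 * A / pi) / \<bar>\<mu>\<bar>" if \<mu>: "\<mu> \<in> F" for \<mu>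
    proof -
      have \<mu>L: "\<bar>\<mu>\<bar> \<ge> L" using F \<mu> by auto
      have "L2_inner ?M p (expo \<mu>) = (\<Sum>k\<in>K. c k * L2_inner ?M (expo (of_int k / (2 * R))) (expo \<mu>))"
        unfolding K(2) by (subst L2_inner_sum_left)
          (auto simp: L2_inner_scale_left intro!: square_integrable_scale square_integrable_expo lm)
      also have "cmod \<dots> \<le> (\<Sum>k\<in>K. cmod (c k) * (2 / (pi * \<bar>\<mu>\<bar>)))"
      proof (intro order_trans[OF norm_sum] sum_mono)
        fix k assume k: "k \<in> K"
        define \<theta> where "\<theta> = of_int k / (2 * R) - \<mu>"
        have "\<bar>\<mu>\<bar> / 2 \<le> \<bar>\<theta>\<bar>" using B[OF k] L \<mu>L unfolding \<theta>_def by linarith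
        moreover have "\<bar>\<mu>\<bar> > 0" using \<mu>L L by linarith
        ultimately have "\<bar>\<mu>\<bar> / 2 > 0" "\<bar>\<theta>\<bar> > 0" by linarith+
        with \<open>\<bar>\<mu>\<bar> / 2 \<le> \<bar>\<theta>\<bar>\<close> have \<theta>: "\<theta> \<noteq> 0" "1 / (pi * \<bar>\<theta>\<bar>) \<le> 1 / (pi * (\<bar>\<mu>\<bar> / 2))"
          by (simp, intro divide_left_mono mult_left_mono mult_pos_pos pi_gt_zero pi_ge_zero zero_le_one)
        have "cmod (L2_inner ?M (expo (of_int k / (2 * R))) (expo \<mu>)) \<le> 1 / (pi * \<bar>\<theta>\<bar>)"
          unfolding L2_inner_expo ind_transform_def \<theta>_def[symmetric] by (rule integral_expo_interval[OF R \<theta>(1)])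
        also have "\<dots> \<le> 2 / (pi * \<bar>\<mu>\<bar>)" using \<theta>(2) by simp
        finally show "cmod (c k * L2_inner ?M (expo (of_int k / (2 * R))) (expo \<mu>)) \<le> cmod (c k) * (2 / (pi * \<bar>\<mu>\<bar>))"
          unfolding norm_mult by (rule mult_left_mono) simp
      qed
      also have "\<dots> = (2 * A / pi) / \<bar>\<mu>\<bar>"
        unfolding A_def sum_distrib_right[symmetric] by simp
      finally show ?thesis .
    qed
    have "(\<Sum>\<mu>\<in>F. (cmod (ind_transform S \<mu>))\<^sup>2) \<le>
        (\<Sum>\<mu>\<in>F. 2 * (cmod (L2_inner ?M (\<lambda>x. f x - p x) (expo \<mu>)))\<^sup>2 + 2 * (2 * A / pi)\<^sup>2 * (1 / \<mu>\<^sup>2))"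
    proof (rule sum_mono)
      fix \<mu> assume \<mu>: "\<mu> \<in> F"
      have "L2_inner ?M f (expo \<mu>) = L2_inner ?M (\<lambda>x. f x - p x) (expo \<mu>) + L2_inner ?M p (expo \<mu>)"
        by (subst L2_inner_diff_left[OF f pm square_integrable_expo[OF lm]]) simp
      then have "cmod (ind_transform S \<mu>) \<le> cmod (L2_inner ?M (\<lambda>x. f x - p x) (expo \<mu>)) + cmod (L2_inner ?M p (expo \<mu>))"
        using norm_triangle_ineq[of "L2_inner ?M (\<lambda>x. f x - p x) (expo \<mu>)" "L2_inner ?M p (expo \<mu>)"]
        using complex_mod_cnj[of "ind_transform S \<mu>"] unfolding ind_transform_minus[symmetric] fe by simp
      then have "(cmod (ind_transform S \<mu>))\<^sup>2 \<le> (cmod (L2_inner ?M (\<lambda>x. f x - p x) (expo \<mu>)) + (2 * A / pi) / \<bar>\<mu>\<bar>)\<^sup>2"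
        using pe[OF \<mu>] by (intro power_mono) auto
      also have "\<dots> \<le> 2 * (cmod (L2_inner ?M (\<lambda>x. f x - p x) (expo \<mu>)))\<^sup>2 + 2 * ((2 * A / pi) / \<bar>\<mu>\<bar>)\<^sup>2"
        using sum_squares_bound[of "cmod (L2_inner ?M (\<lambda>x. f x - p x) (expo \<mu>))" "(2 * A / pi) / \<bar>\<mu>\<bar>"]
        unfolding power2_sum by linarith
      also have "2 * ((2 * A / pi) / \<bar>\<mu>\<bar>)\<^sup>2 = 2 * (2 * A / pi)\<^sup>2 * (1 / \<mu>\<^sup>2)"
        by (simp add: power_divide power_mult_distrib)
      finally show "(cmod (ind_transform S \<mu>))\<^sup>2 \<le>
          2 * (cmod (L2_inner ?M (\<lambda>x. f x - p x) (expo \<mu>)))\<^sup>2 + 2 * (2 * A / pi)\<^sup>2 * (1 / \<mu>\<^sup>2)" .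
    qed
    also have "\<dots> = 2 * (\<Sum>\<mu>\<in>F. (cmod (L2_inner ?M (\<lambda>x. f x - p x) (expo \<mu>)))\<^sup>2) +
        2 * (2 * A / pi)\<^sup>2 * (\<Sum>\<mu>\<in>F. 1 / \<mu>\<^sup>2)"
      by (simp only: sum.distrib sum_distrib_left)
    also have "\<dots> \<le> 2 * (C * (\<epsilon> / (4 * C))) + 2 * (2 * A / pi)\<^sup>2 * (2 / (d * (L - d)))"
    proof (intro add_mono mult_left_mono)
      have "(\<Sum>\<mu>\<in>F. (cmod (L2_inner ?M (\<lambda>x. f x - p x) (expo \<mu>)))\<^sup>2) \<le> C * L2_norm_sq ?M (\<lambda>x. f x - p x)"
        by (intro bessel F square_integrable_diff f pm)
      also have "\<dots> \<le> C * (\<epsilon> / (4 * C))" using p(2) C by (intro mult_left_mono) auto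
      finally show "(\<Sum>\<mu>\<in>F. (cmod (L2_inner ?M (\<lambda>x. f x - p x) (expo \<mu>)))\<^sup>2) \<le> C * (\<epsilon> / (4 * C))" .
      show "(\<Sum>\<mu>\<in>F. 1 / \<mu>\<^sup>2) \<le> 2 / (d * (L - d))"
        using F d L by (intro sum_inverse_squares) auto
    qed auto
    also have "2 * (C * (\<epsilon> / (4 * C))) = \<epsilon> / 2" using C by simp
    also have "2 * (2 * A / pi)\<^sup>2 * (2 / (d * (L - d))) \<le> \<epsilon> / 2"
    proof -
      define E where "E = (2 * A / pi)\<^sup>2"
      have "8 * E \<le> (L - d) * (d * \<epsilon>)"
        using L(4) d \<epsilon> unfolding E_def[symmetric] by (simp add: pos_divide_le_eq)
      then have "4 * E \<le> \<epsilon> / 2 * (d * (L - d))" by (simp add: mult_ac)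
      then have "4 * E / (d * (L - d)) \<le> \<epsilon> / 2"
        using d L by (subst pos_divide_le_eq) auto
      then show ?thesis unfolding E_def[symmetric] by simp
    qed
    finally show "(\<Sum>\<mu>\<in>F. (cmod (ind_transform S \<mu>))\<^sup>2) \<le> \<epsilon>" by simp
  qed
qed

section \<open>Analyticity and zeros of the Fourier transform\<close>

lemma norm_exp_minus_linear:
  fixes w :: complex
  shows "cmod (exp w - 1 - w) \<le> exp (cmod w) * (cmod w)\<^sup>2"
  using Taylor_exp_field[of w 1] by (simp add: power2_eq_square algebra_simps)

text \<open>Since \<open>S\<close> is bounded, the exponent is at most \<open>b\<close> times the
  modulus of the complex variable, which makes the Taylor remainder of the kernel quadratic
  uniformly on \<open>S\<close>.\<close>

lemma ind_transform_entire:
  assumes S: "S \<in> lmeasurable" "bounded S"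
  obtains f where "f holomorphic_on UNIV" "\<And>x. f (of_real x) = ind_transform S x"
proof -
  obtain R where R: "R > 0" "\<And>t. t \<in> S \<Longrightarrow> \<bar>t\<bar> \<le> R"
    using S(2) unfolding bounded_pos by auto
  define c where "c = 2 * of_real pi * \<i>"
  define b where "b = 2 * pi * R"
  have b: "b > 0" using R by (simp add: b_def)
  have ct: "cmod (c * z * of_real t) \<le> b * cmod z" if "t \<in> S" for z t
    using mult_left_mono[OF R(2)[OF that], of "2 * pi * cmod z"] by (simp add: c_def b_def norm_mult mult_ac)
  define k where "k z t = exp (c * z * of_real t)" for z and t :: real
  define k' where "k' z t = c * of_real t * exp (c * z * of_real t)" for z and t :: real
  have m: "k z \<in> borel_measurable (lebesgue_on S)" "k' z \<in> borel_measurable (lebesgue_on S)" for z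
  proof -
    have Sl: "S \<in> sets lebesgue" using S by (simp add: fmeasurableD)
    show "k z \<in> borel_measurable (lebesgue_on S)"
      unfolding k_def by (intro continuous_imp_measurable_on_sets_lebesgue continuous_intros Sl)
    show "k' z \<in> borel_measurable (lebesgue_on S)"
      unfolding k'_def by (intro continuous_imp_measurable_on_sets_lebesgue continuous_intros Sl)
  qed
  have k: "cmod (k z t) \<le> exp (b * cmod z)" if "t \<in> S" for z t
  proof -
    have "cmod (k z t) \<le> exp (cmod (c * z * of_real t))"
      unfolding k_def by (rule norm_exp)
    then show ?thesis using ct[OF that, of z] by (meson exp_le_cancel_iff order_trans)
  qed
  have k': "cmod (k' z t) \<le> b * exp (b * cmod z)" if "t \<in> S" for z t
  proof -
    have "cmod (k' z t) = cmod (c * 1 * of_real t) * cmod (k z t)" by (simp add: k_def k'_def norm_mult)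
    also have "\<dots> \<le> (b * cmod 1) * exp (b * cmod z)"
      using b by (intro mult_mono ct k that) auto
    finally show ?thesis by simp
  qed
  note fm = finite_measure_lebesgue_on[OF S(1)]
  define f where "f z = (\<integral>t. k z t \<partial>(lebesgue_on S))" for z
  have int: "integrable (lebesgue_on S) (k z)" "integrable (lebesgue_on S) (k' z)" for z
  proof -
    show "integrable (lebesgue_on S) (k z)"
      by (rule finite_measure.integrable_const_bound[OF fm _ m(1), where B = "exp (b * cmod z)"])
        (rule AE_I2, use k in simp)
    show "integrable (lebesgue_on S) (k' z)"
      by (rule finite_measure.integrable_const_bound[OF fm _ m(2), where B = "b * exp (b * cmod z)"])
        (rule AE_I2, use k' in simp)
  qed
  have "(f has_field_derivative (\<integral>t. k' z0 t \<partial>(lebesgue_on S))) (at z0)" for z0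
    unfolding f_def
  proof (rule has_field_derivative_parametric_integral)
    show "(1::real) > 0" by simp
    show "integrable (lebesgue_on S) (\<lambda>t. exp (b * cmod z0) * (exp b * b\<^sup>2))"
      by (rule finite_measure.integrable_const[OF fm])
    fix z t assume z: "z \<in> ball z0 1" and "t \<in> space (lebesgue_on S)"
    then have t: "t \<in> S" by simp
    define w where "w = c * (z - z0) * of_real t"
    have w: "cmod w \<le> b * cmod (z - z0)" unfolding w_def by (rule ct[OF t])
    have w1: "cmod w \<le> b"
    proof -
      have "cmod (z - z0) \<le> 1" using z by (simp add: dist_norm norm_minus_commute)
      then have "b * cmod (z - z0) \<le> b * 1" using b by (intro mult_left_mono) auto
      then show ?thesis using w by simp
    qed
    have "k z t = k z0 t * exp w"
      by (simp add: k_def w_def exp_add[symmetric] algebra_simps)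
    moreover have "(z - z0) * k' z0 t = k z0 t * w" by (simp add: k_def k'_def w_def)
    ultimately have "k z t - k z0 t - (z - z0) * k' z0 t = k z0 t * (exp w - 1 - w)"
      by (simp add: algebra_simps)
    then have "cmod (k z t - k z0 t - (z - z0) * k' z0 t) = cmod (k z0 t) * cmod (exp w - 1 - w)"
      by (simp add: norm_mult)
    also have "\<dots> \<le> exp (b * cmod z0) * (exp b * (b * cmod (z - z0))\<^sup>2)"
    proof (intro mult_mono k t)
      have "cmod (exp w - 1 - w) \<le> exp (cmod w) * (cmod w)\<^sup>2" by (rule norm_exp_minus_linear)
      also have "\<dots> \<le> exp b * (b * cmod (z - z0))\<^sup>2"
        using w w1 by (intro mult_mono power_mono) auto
      finally show "cmod (exp w - 1 - w) \<le> exp b * (b * cmod (z - z0))\<^sup>2" .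
    qed auto
    also have "\<dots> = exp (b * cmod z0) * (exp b * b\<^sup>2) * (cmod (z - z0))\<^sup>2"
      by (simp add: power_mult_distrib)
    finally show "cmod (k z t - k z0 t - (z - z0) * k' z0 t) \<le> exp (b * cmod z0) * (exp b * b\<^sup>2) * (cmod (z - z0))\<^sup>2" .
  qed (use int in auto)
  then have "f holomorphic_on UNIV"
    by (auto simp: holomorphic_on_def field_differentiable_def)
  moreover have "f (of_real x) = ind_transform S x" for x
    unfolding f_def k_def ind_transform_def expo_def c_def ..
  ultimately show ?thesis using that by blast
qed

text \<open>The entire extension takes the positive value \<open>measure lebesgue S\<close> at 0, so
  it is not the zero function and has finitely many zeros in a disc.\<close>

lemma ind_transform_finite_zeros:
  assumes S: "S \<in> lmeasurable" "bounded S" "measure lebesgue S > 0"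
  shows "finite {x. \<bar>x\<bar> \<le> R \<and> ind_transform S x = 0}"
proof -
  obtain f where f: "f holomorphic_on UNIV" "\<And>x. f (of_real x) = ind_transform S x"
    using ind_transform_entire[OF S(1,2)] by metis
  have f0: "f 0 \<noteq> 0" using f(2)[of 0] ind_transform_0[OF S(1)] S(3) by simp
  let ?Z = "{z \<in> cball 0 R. f z = 0}"
  have "finite ?Z"
  proof (cases "f constant_on UNIV")
    case True
    then obtain y where "\<And>z. f z = y" unfolding constant_on_def by blast
    then show ?thesis using f0 by simp
  next
    case False
    then show ?thesis by (intro holomorphic_compact_finite_zeros[OF f(1)]) auto
  qed
  moreover have "of_real ` {x. \<bar>x\<bar> \<le> R \<and> ind_transform S x = 0} \<subseteq> ?Z"
    by (auto simp: f(2))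
  ultimately have "finite (complex_of_real ` {x. \<bar>x\<bar> \<le> R \<and> ind_transform S x = 0})"
    by (rule finite_subset[rotated])
  then show ?thesis by (rule finite_imageD) (simp add: inj_on_def)
qed

section \<open>Local determination and periodicity\<close>

lemma finite_set_gap:
  fixes Z :: "real set"
  assumes "finite Z"
  obtains \<delta> where "\<delta> > 0" "\<And>x y. x \<in> Z \<Longrightarrow> y \<in> Z \<Longrightarrow> x < y \<Longrightarrow> \<delta> \<le> y - x"
proof -
  define D where "D = insert 1 ((\<lambda>(x, y). y - x) ` {p \<in> Z \<times> Z. fst p < snd p})"
  have D: "finite D" "\<And>t. t \<in> D \<Longrightarrow> t > 0" using assms by (auto simp: D_def)
  have "Min D > 0" using D Min_in[of D] by (auto simp: D_def)
  moreover have "Min D \<le> y - x" if "x \<in> Z" "y \<in> Z" "x < y" for x y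
  proof (rule Min_le[OF D(1)])
    have "(x, y) \<in> {p \<in> Z \<times> Z. fst p < snd p}" using that by simp
    then have "(\<lambda>(x, y). y - x) (x, y) \<in> (\<lambda>(x, y). y - x) ` {p \<in> Z \<times> Z. fst p < snd p}" by (rule imageI)
    then show "y - x \<in> D" by (simp add: D_def)
  qed
  ultimately show ?thesis using that by blast
qed

text \<open>A sequence over a finite alphabet in which every window of bounded length determines
  everything to its right is periodic: the same shift is found arbitrarily far to the left.\<close>

lemma periodic_if_deterministic:
  fixes X :: "real set"
  assumes fin: "\<And>R. finite {x - y | x y. x \<in> X \<and> y \<in> X \<and> \<bar>x - y\<bar> \<le> R}"
    and dense: "R \<ge> 0" "\<And>x. \<exists>y\<in>X. x - R \<le> y \<and> y \<le> x"
    and det: "L \<ge> 0" "\<And>u v. u \<in> X \<Longrightarrow> v \<in> X \<Longrightarrow> \<forall>x\<in>{- L..0}. u + x \<in> X \<longleftrightarrow> v + x \<in> X \<Longrightarrow>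
      \<forall>x\<ge>- L. u + x \<in> X \<longleftrightarrow> v + x \<in> X"
  shows "\<exists>T>0. \<forall>y. y \<in> X \<longleftrightarrow> y + T \<in> X"
proof -
  define D where "D = {x - y | x y. x \<in> X \<and> y \<in> X \<and> \<bar>x - y\<bar> \<le> L}"
  have "finite D" unfolding D_def by (rule fin)
  \<comment> \<open>The pattern of \<open>X\<close> in the window ending at \<open>u\<close>. Only
    differences in the finite set \<open>D\<close> can occur, so there are at most
    \<open>card (Pow D)\<close> states.\<close>
  define state where "state u = {t \<in> D. t \<in> {- L..0} \<and> u + t \<in> X}" for u
  have state: "\<forall>x\<in>{- L..0}. u + x \<in> X \<longleftrightarrow> v + x \<in> X" if "u \<in> X" "v \<in> X" "state u = state v" for u v
  proof
    fix x assume x: "x \<in> {- L..0}"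
    have *: "a + x \<in> X \<longleftrightarrow> x \<in> state a" if "a \<in> X" for a
    proof
      assume "a + x \<in> X"
      moreover have "\<bar>(a + x) - a\<bar> \<le> L" using x by auto
      ultimately have "(a + x) - a \<in> D" unfolding D_def using that by blast
      then have "x \<in> D" by simp
      then show "x \<in> state a" using x \<open>a + x \<in> X\<close> by (simp add: state_def)
    qed (simp add: state_def)
    show "u + x \<in> X \<longleftrightarrow> v + x \<in> X" using *[OF that(1)] *[OF that(2)] that(3) by simp
  qed
  define K where "K = card (Pow D)"
  \<comment> \<open>Among \<open>K + 1\<close> points chosen at intervals of \<open>R + 1\<close>
    two have the same state, and they lie within \<open>R'\<close> of each other.\<close>
  define R' where "R' = (R + 1) * (K + 1)"
  define D' where "D' = {x - y | x y. x \<in> X \<and> y \<in> X \<and> \<bar>x - y\<bar> \<le> R'}"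
  have shift: "\<exists>T\<in>D'. T > 0 \<and> (\<forall>y\<ge>x. y \<in> X \<longleftrightarrow> y + T \<in> X)" for x
  proof -
    \<comment> \<open>The spacing \<open>R + 1\<close> exceeds the uncertainty \<open>R\<close> in
      the position, so the chosen points are strictly decreasing.\<close>
    have "\<forall>i::nat. \<exists>y\<in>X. x - (R + 1) * i - R \<le> y \<and> y \<le> x - (R + 1) * i"
      using dense(2) by blast
    then obtain s where s: "\<And>i::nat. s i \<in> X" "\<And>i. x - (R + 1) * real i - R \<le> s i" "\<And>i. s i \<le> x - (R + 1) * real i"
      by metis
    have "state ` (s ` {..K}) \<subseteq> Pow D" by (auto simp: state_def)
    then have "card ((\<lambda>i. state (s i)) ` {..K}) \<le> K"
      unfolding K_def using \<open>finite D\<close> by (intro card_mono) (auto simp: image_image)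
    then have "\<not> inj_on (\<lambda>i. state (s i)) {..K}"
      using card_image[of "\<lambda>i. state (s i)" "{..K}"] by auto
    then obtain i\<^sub>0 j\<^sub>0 where ij0: "i\<^sub>0 \<le> K" "j\<^sub>0 \<le> K" "i\<^sub>0 \<noteq> j\<^sub>0" "state (s i\<^sub>0) = state (s j\<^sub>0)"
      unfolding inj_on_def by auto
    then obtain i j where ij: "i \<le> K" "j \<le> K" "i < j" "state (s i) = state (s j)"
      by (cases "i\<^sub>0 < j\<^sub>0") (blast, metis linorder_neqE_nat)
    define T where "T = s i - s j"
    have "real i + 1 \<le> real j" using ij by linarith
    then have "(R + 1) * (real i + 1) \<le> (R + 1) * real j" using dense(1) by (intro mult_left_mono) auto
    then have T0: "T > 0"
      using s(2)[of i] s(3)[of j] unfolding T_def by (simp add: algebra_simps)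
    have "(R + 1) * real j \<le> (R + 1) * K" "0 \<le> (R + 1) * real i" using ij dense(1) by (auto intro!: mult_left_mono)
    then have "\<bar>T\<bar> \<le> R'"
      using s(2)[of j] s(3)[of i] T0 unfolding T_def R'_def by (simp add: algebra_simps)
    then have "T \<in> D'" unfolding D'_def T_def using s(1) by blast
    moreover have "y \<in> X \<longleftrightarrow> y + T \<in> X" if "y \<ge> x" for y
    proof -
      have "0 \<le> (R + 1) * real j" using dense(1) by simp
      then have "y - s j \<ge> - L" using that s(3)[of j] det(1) by linarith
      then have "s i + (y - s j) \<in> X \<longleftrightarrow> s j + (y - s j) \<in> X"
        using det(2)[OF s(1) s(1) state[OF s(1) s(1) ij(4)]] by blast
      then show ?thesis by (simp add: T_def algebra_simps)
    qed
    ultimately show ?thesis using T0 by blast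
  qed
  then have "\<forall>n\<in>(UNIV :: nat set). \<exists>T\<in>D'. T > 0 \<and> (\<forall>y\<ge>- real n. y \<in> X \<longleftrightarrow> y + T \<in> X)" by blast
  moreover have "finite D'" unfolding D'_def by (rule fin)
  ultimately obtain T where T: "T \<in> D'" "infinite {n. T > 0 \<and> (\<forall>y\<ge>- real n. y \<in> X \<longleftrightarrow> y + T \<in> X)}"
    using pigeonhole_infinite_rel[OF infinite_UNIV_nat, of D'
        "\<lambda>n T. T > 0 \<and> (\<forall>y\<ge>- real n. y \<in> X \<longleftrightarrow> y + T \<in> X)"] by auto
  have "T > 0 \<and> (y \<in> X \<longleftrightarrow> y + T \<in> X)" for y
  proof -
    obtain m :: nat where m: "- y \<le> real m" using real_arch_simple by blast
    obtain n where n: "n > m" "T > 0 \<and> (\<forall>y\<ge>- real n. y \<in> X \<longleftrightarrow> y + T \<in> X)"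
      using T(2) unfolding infinite_nat_iff_unbounded by blast
    then have "y \<ge> - real n" using m by linarith
    with n show ?thesis by blast
  qed
  then show ?thesis by blast
qed

section \<open>Separation and local finiteness of spectra\<close>

context
  fixes S \<Lambda> :: "real set"
  assumes spectrum: "is_spectrum S \<Lambda>" and S_bounded: "bounded S"
begin

lemma spectrum_lmeasurable: "S \<in> lmeasurable" and spectrum_pos: "measure lebesgue S > 0"
  and spectrum_basis: "L2_orthogonal_basis (lebesgue_on S) \<Lambda> expo"
  using spectrum unfolding is_spectrum_def by blast+

lemma spectrum_orthogonal: "x \<in> \<Lambda> \<Longrightarrow> y \<in> \<Lambda> \<Longrightarrow> x \<noteq> y \<Longrightarrow> ind_transform S (x - y) = 0"
  using basis_orthogonal[OF spectrum_basis] by (simp add: L2_inner_expo)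

lemma fourier_coeff_expo:
  "fourier_coeff (lebesgue_on S) expo (expo a) \<nu> = ind_transform S (a - \<nu>) / measure lebesgue S"
  by (simp add: fourier_coeff_def L2_inner_expo ind_transform_0[OF spectrum_lmeasurable])

text \<open>Nonzero differences of frequencies are zeros of the transform, and only finitely many
  zeros lie near 0.\<close>

lemma spectrum_separated: "\<exists>d>0. separated d \<Lambda>"
proof -
  have "finite {x. \<bar>x\<bar> \<le> 1 \<and> ind_transform S x = 0}"
    by (rule ind_transform_finite_zeros[OF spectrum_lmeasurable S_bounded spectrum_pos])
  then obtain d where d: "d > 0" "\<forall>x\<in>{x. \<bar>x\<bar> \<le> 1 \<and> ind_transform S x = 0}. x \<noteq> 0 \<longrightarrow> d \<le> dist 0 x"
    using finite_set_avoid[of _ "0::real"] by blast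
  have "separated (min d 1) \<Lambda>"
    unfolding separated_def
  proof (intro ballI impI)
    fix x y assume "x \<in> \<Lambda>" "y \<in> \<Lambda>" "x \<noteq> y"
    then have "ind_transform S (x - y) = 0" by (rule spectrum_orthogonal)
    then show "min d 1 \<le> \<bar>x - y\<bar>"
      using d(2)[rule_format, of "x - y"] \<open>x \<noteq> y\<close> by (cases "\<bar>x - y\<bar> \<le> 1") auto
  qed
  then show ?thesis using d(1) by (intro exI[of _ "min d 1"]) auto
qed

lemma spectrum_finite_differences:
  "finite {x - y | x y. x \<in> \<Lambda> \<and> y \<in> \<Lambda> \<and> \<bar>x - y\<bar> \<le> R}"
proof (rule finite_subset)
  show "{x - y | x y. x \<in> \<Lambda> \<and> y \<in> \<Lambda> \<and> \<bar>x - y\<bar> \<le> R} \<subseteq> insert 0 {x. \<bar>x\<bar> \<le> R \<and> ind_transform S x = 0}"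
  proof
    fix t assume "t \<in> {x - y | x y. x \<in> \<Lambda> \<and> y \<in> \<Lambda> \<and> \<bar>x - y\<bar> \<le> R}"
    then obtain x y where "x \<in> \<Lambda>" "y \<in> \<Lambda>" "\<bar>x - y\<bar> \<le> R" "t = x - y" by blast
    then show "t \<in> insert 0 {x. \<bar>x\<bar> \<le> R \<and> ind_transform S x = 0}"
      using spectrum_orthogonal[of x y] by (cases "x = y") auto
  qed
  show "finite (insert 0 {x. \<bar>x\<bar> \<le> R \<and> ind_transform S x = 0})"
    using ind_transform_finite_zeros[OF spectrum_lmeasurable S_bounded spectrum_pos] by simp
qed

text \<open>Completeness allows the residual to be made arbitrarily small, so the squared transforms
  must add up to the squared measure; a deficit shows that frequencies are missing.\<close>

lemma spectrum_residual:
  assumes "finite F" "F \<subseteq> \<Lambda>"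
  shows "L2_norm_sq (lebesgue_on S) (\<lambda>x. expo a x - (\<Sum>\<nu>\<in>F. fourier_coeff (lebesgue_on S) expo (expo a) \<nu> * expo \<nu> x)) =
    measure lebesgue S - (\<Sum>\<nu>\<in>F. (cmod (ind_transform S (a - \<nu>)))\<^sup>2) / measure lebesgue S"
proof -
  let ?m = "measure lebesgue S"
  have "(\<Sum>\<nu>\<in>F. (cmod (fourier_coeff (lebesgue_on S) expo (expo a) \<nu>))\<^sup>2 * ?m) =
      (\<Sum>\<nu>\<in>F. (cmod (ind_transform S (a - \<nu>)))\<^sup>2) / ?m"
    unfolding sum_divide_distrib using spectrum_pos
    by (intro sum.cong refl) (simp add: fourier_coeff_expo norm_divide power_divide power2_eq_square)
  then show ?thesis
    using residual_norm[OF spectrum_basis square_integrable_expo[OF spectrum_lmeasurable] assms, of a]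
    by (simp add: L2_norm_sq_expo[OF spectrum_lmeasurable])
qed

end

lemma bounded_subset_interval:
  fixes S :: "real set"
  assumes "bounded S"
  obtains R where "R > 0" "S \<subseteq> {- R..<R}"
proof -
  obtain B where B: "B > 0" "\<And>x. x \<in> S \<Longrightarrow> \<bar>x\<bar> \<le> B"
    using assms unfolding bounded_pos by auto
  have "S \<subseteq> {- (B + 1)..<B + 1}" using B(2) by (fastforce simp: abs_le_iff)
  then show ?thesis using that[of "B + 1"] B(1) by simp
qed

lemma separated_translate: "separated d F \<Longrightarrow> separated d ((\<lambda>x. x - t) ` F)"
  unfolding separated_def by auto

lemma separated_reflect: "separated d F \<Longrightarrow> separated d ((\<lambda>x. t - x) ` F)"
  unfolding separated_def by (auto simp: abs_minus_commute)

context
  fixes S \<Lambda> :: "real set"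
  assumes spectrum: "is_spectrum S \<Lambda>" and S_bounded: "bounded S"
begin

text \<open>If no frequency lay within \<open>L\<close> of \<open>x\<close>, the tail estimate would
  leave at most half of the energy of \<open>expo x\<close> in any finite partial sum, against
  completeness.\<close>

lemma spectrum_relatively_dense: "\<exists>R\<ge>0. \<forall>x. \<exists>y\<in>\<Lambda>. x - R \<le> y \<and> y \<le> x"
proof -
  let ?m = "measure lebesgue S"
  have lm: "S \<in> lmeasurable" and m: "?m > 0" and basis: "L2_orthogonal_basis (lebesgue_on S) \<Lambda> expo"
    using spectrum unfolding is_spectrum_def by blast+
  obtain d where d: "d > 0" "separated d \<Lambda>" using spectrum_separated[OF spectrum S_bounded] by blast
  obtain R where R: "R > 0" "S \<subseteq> {- R..<R}" using bounded_subset_interval[OF S_bounded] .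
  have "?m\<^sup>2 / 2 > 0" using m by simp
  then obtain L where L: "L > 0" and tail: "\<And>F. finite F \<Longrightarrow> separated d F \<Longrightarrow> \<forall>\<mu>\<in>F. L \<le> \<bar>\<mu>\<bar> \<Longrightarrow>
      (\<Sum>\<mu>\<in>F. (cmod (ind_transform S \<mu>))\<^sup>2) \<le> ?m\<^sup>2 / 2"
    using ind_transform_tail[OF lm R(2,1) d(1)] by blast
  have near: "\<exists>y\<in>\<Lambda>. \<bar>x - y\<bar> < L" for x
  proof (rule ccontr)
    assume "\<not> ?thesis"
    then have far: "L \<le> \<bar>x - y\<bar>" if "y \<in> \<Lambda>" for y using that by force
    have "?m / 2 > 0" using m by simp
    then obtain F where F: "finite F" "F \<subseteq> \<Lambda>"
      "L2_norm_sq (lebesgue_on S) (\<lambda>t. expo x t - (\<Sum>\<nu>\<in>F. fourier_coeff (lebesgue_on S) expo (expo x) \<nu> * expo \<nu> t)) < ?m / 2"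
      using fourier_approx[OF basis square_integrable_expo[OF lm]] by blast
    then have "?m - (\<Sum>\<nu>\<in>F. (cmod (ind_transform S (x - \<nu>)))\<^sup>2) / ?m < ?m / 2"
      using spectrum_residual[OF spectrum S_bounded] by simp
    moreover have "(\<Sum>\<nu>\<in>F. (cmod (ind_transform S (x - \<nu>)))\<^sup>2) \<le> ?m\<^sup>2 / 2"
    proof -
      have "(\<Sum>\<nu>\<in>F. (cmod (ind_transform S (x - \<nu>)))\<^sup>2) = (\<Sum>\<mu>\<in>(\<lambda>\<nu>. x - \<nu>) ` F. (cmod (ind_transform S \<mu>))\<^sup>2)"
        by (subst sum.reindex) (auto simp: inj_on_def)
      also have "\<dots> \<le> ?m\<^sup>2 / 2"
        using F far by (intro tail separated_reflect separated_subset[OF d(2)]) auto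
      finally show ?thesis .
    qed
    then have "(\<Sum>\<nu>\<in>F. (cmod (ind_transform S (x - \<nu>)))\<^sup>2) / ?m \<le> (?m\<^sup>2 / 2) / ?m"
      using m by (intro divide_right_mono) auto
    moreover have "(?m\<^sup>2 / 2) / ?m = ?m / 2" using m by (simp add: power2_eq_square)
    ultimately show False by linarith
  qed
  have "\<exists>y\<in>\<Lambda>. x - 2 * L \<le> y \<and> y \<le> x" for x
  proof -
    \<comment> \<open>Centring at \<open>x - L\<close> turns the two-sided estimate into a point to
      the left of \<open>x\<close>.\<close>
    obtain y where "y \<in> \<Lambda>" "\<bar>(x - L) - y\<bar> < L" using near by blast
    then show ?thesis by (intro bexI[of _ y]) (auto simp: abs_less_iff)
  qed
  then show ?thesis using L by (intro exI[of _ "2 * L"]) auto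
qed

text \<open>If two translates of the spectrum agree on a long window and then disagree, the first
  frequency \<open>a\<close> present in only one of them is orthogonal to the common part.  Up to a small tail,
  \<open>expo a\<close> would be a limit of trigonometric sums with frequencies to the right of \<open>a\<close>, which
  \<open>positive_frequencies_gap\<close> excludes.\<close>

lemma spectrum_deterministic:
  "\<exists>L\<ge>0. \<forall>u\<in>\<Lambda>. \<forall>v\<in>\<Lambda>. (\<forall>x\<in>{- L..0}. u + x \<in> \<Lambda> \<longleftrightarrow> v + x \<in> \<Lambda>) \<longrightarrow>
    (\<forall>x\<ge>- L. u + x \<in> \<Lambda> \<longleftrightarrow> v + x \<in> \<Lambda>)"
proof -
  let ?m = "measure lebesgue S" and ?M = "lebesgue_on S"
  have lm: "S \<in> lmeasurable" and m: "?m > 0" and basis: "L2_orthogonal_basis ?M \<Lambda> expo"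
    using spectrum unfolding is_spectrum_def by blast+
  obtain d where d: "d > 0" "separated d \<Lambda>" using spectrum_separated[OF spectrum S_bounded] by blast
  obtain R where R: "R > 0" "S \<subseteq> {- R..<R}" using bounded_subset_interval[OF S_bounded] .
  obtain r where r: "r \<ge> 0" "\<And>x. \<exists>y\<in>\<Lambda>. x - r \<le> y \<and> y \<le> x" using spectrum_relatively_dense by blast
  \<comment> \<open>Distances between nearby frequencies take finitely many values, so unequal ones
    differ by at least \<open>\<delta>\<close>; this will keep the frequencies to the right of
    \<open>w\<close> away from \<open>w\<close>.\<close>
  define Z where "Z = {x - y | x y. x \<in> \<Lambda> \<and> y \<in> \<Lambda> \<and> \<bar>x - y\<bar> \<le> r + 2}"
  have "finite Z" unfolding Z_def by (rule spectrum_finite_differences[OF spectrum S_bounded])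
  then obtain \<delta> where \<delta>: "\<delta> > 0" "\<And>x y. x \<in> Z \<Longrightarrow> y \<in> Z \<Longrightarrow> x < y \<Longrightarrow> \<delta> \<le> y - x"
    using finite_set_gap by blast
  define d\<^sub>1 where "d\<^sub>1 = min \<delta> 1"
  have d1: "d\<^sub>1 > 0" using \<delta>(1) by (simp add: d\<^sub>1_def)
  obtain \<epsilon> where \<epsilon>: "\<epsilon> > 0" and gap:
    "\<And>F c. finite F \<Longrightarrow> separated d F \<Longrightarrow> \<forall>\<mu>\<in>F. d\<^sub>1 \<le> \<mu> \<Longrightarrow> (\<Sum>\<mu>\<in>F. (cmod (c \<mu>))\<^sup>2) \<le> 1 \<Longrightarrow>
      \<epsilon> \<le> L2_norm_sq ?M (\<lambda>x. 1 - (\<Sum>\<mu>\<in>F. c \<mu> * expo \<mu> x))"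
    using positive_frequencies_gap[OF lm m d(1) d1] by blast
  have "\<epsilon> * ?m / 8 > 0" using \<epsilon> m by simp
  then obtain L\<^sub>0 where L0: "L\<^sub>0 > 0" and tail: "\<And>F. finite F \<Longrightarrow> separated d F \<Longrightarrow> \<forall>\<mu>\<in>F. L\<^sub>0 \<le> \<bar>\<mu>\<bar> \<Longrightarrow>
      (\<Sum>\<mu>\<in>F. (cmod (ind_transform S \<mu>))\<^sup>2) \<le> \<epsilon> * ?m / 8"
    using ind_transform_tail[OF lm R(2,1) d(1)] by blast
  \<comment> \<open>\<open>L\<^sub>0\<close> makes the tail beyond the window small;
    \<open>r + 2\<close> guarantees a frequency near the first disagreement that lies in the range
    of agreement.\<close>
  define L where "L = max L\<^sub>0 (r + 2)"
  have L: "L \<ge> 0" "L \<ge> L\<^sub>0" "L \<ge> r + 2" using L0 by (auto simp: L_def)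
  have key: "v + a \<in> \<Lambda>" if uv: "u \<in> \<Lambda>" "v \<in> \<Lambda>" and a: "a > 0"
    and agree: "\<And>x. - L \<le> x \<Longrightarrow> x < a \<Longrightarrow> u + x \<in> \<Lambda> \<longleftrightarrow> v + x \<in> \<Lambda>" and ua: "u + a \<in> \<Lambda>" for u v a
  proof (rule ccontr)
    assume va: "v + a \<notin> \<Lambda>"
    define w where "w = v + a"
    define c where "c = fourier_coeff ?M expo (expo w)"
    have c: "c \<nu> = ind_transform S (w - \<nu>) / ?m" for \<nu>
      unfolding c_def by (rule fourier_coeff_expo[OF spectrum S_bounded])
    have cc: "(cmod (c \<nu>))\<^sup>2 = (cmod (ind_transform S (w - \<nu>)))\<^sup>2 / ?m\<^sup>2" for \<nu>
      by (simp add: c norm_divide power_divide)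
    have "\<epsilon> / 4 > 0" using \<epsilon> by simp
    then obtain F where F: "finite F" "F \<subseteq> \<Lambda>"
      and approx: "L2_norm_sq ?M (\<lambda>t. expo w t - (\<Sum>\<nu>\<in>F. c \<nu> * expo \<nu> t)) < \<epsilon> / 4"
      using fourier_approx[OF basis square_integrable_expo[OF lm, of w]] unfolding c_def by blast
    define F\<^sub>1 where "F\<^sub>1 = {\<nu> \<in> F. w < \<nu>}"
    define F\<^sub>2 where "F\<^sub>2 = {\<nu> \<in> F. \<nu> < v - L}"
    have F12: "finite F\<^sub>1" "finite F\<^sub>2" "F\<^sub>1 \<subseteq> \<Lambda>" "F\<^sub>2 \<subseteq> \<Lambda>" "F\<^sub>1 \<inter> F\<^sub>2 = {}" "F\<^sub>1 \<union> F\<^sub>2 \<subseteq> F"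
      using F a L(1) by (auto simp: F\<^sub>1_def F\<^sub>2_def w_def)
    \<comment> \<open>Between \<open>v - L\<close> and \<open>w\<close>, a frequency shifted by
      \<open>u - v\<close> is again a frequency, and \<open>u + a\<close> is orthogonal to it.
      Orthogonality depends only on differences, so \<open>w\<close> is orthogonal to the original
      one.\<close>
    have c0: "c \<nu> = 0" if \<nu>: "\<nu> \<in> F - (F\<^sub>1 \<union> F\<^sub>2)" for \<nu>
    proof -
      have "\<nu> \<in> \<Lambda>" using \<nu> F by auto
      then have "\<nu> \<noteq> w" using va by (auto simp: w_def)
      then have x: "- L \<le> \<nu> - v" "\<nu> - v < a" using \<nu> by (auto simp: F\<^sub>1_def F\<^sub>2_def w_def)
      then have u\<nu>: "u + (\<nu> - v) \<in> \<Lambda>" using agree[OF x] \<open>\<nu> \<in> \<Lambda>\<close> by simp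
      have "u + a \<noteq> u + (\<nu> - v)" using x by simp
      with u\<nu> have "ind_transform S ((u + a) - (u + (\<nu> - v))) = 0"
        by (intro spectrum_orthogonal[OF spectrum S_bounded ua])
      also have "(u + a) - (u + (\<nu> - v)) = w - \<nu>" by (simp add: w_def)
      finally show ?thesis by (simp add: c)
    qed
    have split: "(\<Sum>\<nu>\<in>F. c \<nu> * expo \<nu> t) = (\<Sum>\<nu>\<in>F\<^sub>1. c \<nu> * expo \<nu> t) + (\<Sum>\<nu>\<in>F\<^sub>2. c \<nu> * expo \<nu> t)" for t
    proof -
      have "(\<Sum>\<nu>\<in>F. c \<nu> * expo \<nu> t) = (\<Sum>\<nu>\<in>F\<^sub>1 \<union> F\<^sub>2. c \<nu> * expo \<nu> t)"
        using F(1) F12(6) c0 by (intro sum.mono_neutral_right) auto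
      then show ?thesis using F12 by (simp add: sum.union_disjoint)
    qed
    \<comment> \<open>\<open>\<nu>\<close> and the missing point \<open>w\<close> are compared
      through the common frequency \<open>v + (y - u)\<close>: both distances to it belong to
      \<open>Z\<close>, the one of \<open>w\<close> because \<open>u + a\<close> and
      \<open>y\<close> are frequencies.\<close>
    have right: "d\<^sub>1 \<le> \<nu> - w" if \<nu>: "\<nu> \<in> F\<^sub>1" for \<nu>
    proof (cases "\<nu> - w \<le> 1")
      case True
      obtain y where y: "y \<in> \<Lambda>" "u + a - 1 - r \<le> y" "y \<le> u + a - 1" using r(2)[of "u + a - 1"] by auto
      have "- L \<le> y - u" "y - u < a" using y a L(3) by auto
      then have vy: "v + (y - u) \<in> \<Lambda>" using agree[of "y - u"] y(1) by simp
      have "\<bar>(u + a) - y\<bar> \<le> r + 2" using y r(1) by auto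
      then have "(u + a) - y \<in> Z" unfolding Z_def using ua y(1) by blast
      moreover have "\<nu> - (v + (y - u)) \<in> Z"
        unfolding Z_def
      proof (intro CollectI exI conjI)
        show "\<nu> \<in> \<Lambda>" using \<nu> F12 by auto
        show "\<bar>\<nu> - (v + (y - u))\<bar> \<le> r + 2" using True \<nu> y unfolding w_def F\<^sub>1_def by auto
      qed (use vy in auto)
      moreover have "(u + a) - y < \<nu> - (v + (y - u))" using \<nu> by (auto simp: F\<^sub>1_def w_def)
      ultimately have "\<delta> \<le> (\<nu> - (v + (y - u))) - ((u + a) - y)" by (intro \<delta>(2))
      also have "\<dots> = \<nu> - w" by (simp add: w_def)
      finally show ?thesis by (simp add: d\<^sub>1_def)
    next
      case False
      then show ?thesis by (simp add: d\<^sub>1_def)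
    qed
    have bessel: "(\<Sum>\<nu>\<in>F\<^sub>1. (cmod (c \<nu>))\<^sup>2) \<le> 1"
    proof -
      have "0 \<le> ?m - (\<Sum>\<nu>\<in>F\<^sub>1. (cmod (ind_transform S (w - \<nu>)))\<^sup>2) / ?m"
        unfolding spectrum_residual[OF spectrum S_bounded F12(1,3), of w, symmetric] by (rule L2_norm_sq_nonneg)
      then have "(\<Sum>\<nu>\<in>F\<^sub>1. (cmod (ind_transform S (w - \<nu>)))\<^sup>2) \<le> ?m\<^sup>2"
        using m by (simp add: pos_divide_le_eq power2_eq_square)
      then have "(\<Sum>\<nu>\<in>F\<^sub>1. (cmod (ind_transform S (w - \<nu>)))\<^sup>2) / ?m\<^sup>2 \<le> ?m\<^sup>2 / ?m\<^sup>2"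
        by (rule divide_right_mono) simp
      then show ?thesis unfolding cc sum_divide_distrib[symmetric] using m by simp
    qed
    have left: "L2_norm_sq ?M (\<lambda>t. \<Sum>\<nu>\<in>F\<^sub>2. c \<nu> * expo \<nu> t) \<le> \<epsilon> / 8"
    proof -
      have "L2_norm_sq ?M (\<lambda>t. \<Sum>\<nu>\<in>F\<^sub>2. c \<nu> * expo \<nu> t) = (\<Sum>\<nu>\<in>F\<^sub>2. (cmod (c \<nu>))\<^sup>2 * L2_norm_sq ?M (expo \<nu>))"
        using F12 by (intro L2_norm_sq_orthogonal_sum square_integrable_expo lm)
          (auto simp: pairwise_def basis_orthogonal[OF basis] subsetD)
      also have "\<dots> = (\<Sum>\<nu>\<in>F\<^sub>2. (cmod (ind_transform S (w - \<nu>)))\<^sup>2) / ?m"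
        unfolding sum_divide_distrib using m
        by (intro sum.cong refl) (simp only: cc L2_norm_sq_expo[OF lm], simp add: power2_eq_square)
      also have "(\<Sum>\<nu>\<in>F\<^sub>2. (cmod (ind_transform S (w - \<nu>)))\<^sup>2) = (\<Sum>\<mu>\<in>(\<lambda>\<nu>. w - \<nu>) ` F\<^sub>2. (cmod (ind_transform S \<mu>))\<^sup>2)"
        by (subst sum.reindex) (auto simp: inj_on_def)
      also have "\<dots> \<le> \<epsilon> * ?m / 8"
      proof (intro tail separated_reflect separated_subset[OF d(2)])
        show "\<forall>\<mu>\<in>(\<lambda>\<nu>. w - \<nu>) ` F\<^sub>2. L\<^sub>0 \<le> \<bar>\<mu>\<bar>"
          using a L by (auto simp: F\<^sub>2_def w_def)
      qed (use F12 in auto)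
      finally show ?thesis using m by (simp add: divide_right_mono)
    qed
    \<comment> \<open>Multiplication by \<open>expo (- w)\<close> preserves the norm and moves
      \<open>w\<close> to frequency 0.\<close>
    have "\<epsilon> \<le> L2_norm_sq ?M (\<lambda>t. 1 - (\<Sum>\<mu>\<in>(\<lambda>\<nu>. \<nu> - w) ` F\<^sub>1. c (\<mu> + w) * expo \<mu> t))"
    proof (intro gap separated_translate separated_subset[OF d(2)])
      have "(\<Sum>\<mu>\<in>(\<lambda>\<nu>. \<nu> - w) ` F\<^sub>1. (cmod (c (\<mu> + w)))\<^sup>2) = (\<Sum>\<nu>\<in>F\<^sub>1. (cmod (c \<nu>))\<^sup>2)"
        by (subst sum.reindex) (auto simp: inj_on_def)
      then show "(\<Sum>\<mu>\<in>(\<lambda>\<nu>. \<nu> - w) ` F\<^sub>1. (cmod (c (\<mu> + w)))\<^sup>2) \<le> 1" using bessel by simp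
    qed (use F12 right in auto)
    also have "\<dots> = L2_norm_sq ?M (\<lambda>t. expo w t - (\<Sum>\<nu>\<in>F\<^sub>1. c \<nu> * expo \<nu> t))"
    proof -
      have "cmod (1 - (\<Sum>\<mu>\<in>(\<lambda>\<nu>. \<nu> - w) ` F\<^sub>1. c (\<mu> + w) * expo \<mu> t)) =
          cmod (expo w t - (\<Sum>\<nu>\<in>F\<^sub>1. c \<nu> * expo \<nu> t))" for t
      proof -
        have "(\<Sum>\<mu>\<in>(\<lambda>\<nu>. \<nu> - w) ` F\<^sub>1. c (\<mu> + w) * expo \<mu> t) = (\<Sum>\<nu>\<in>F\<^sub>1. c \<nu> * expo (\<nu> - w) t)"
          by (subst sum.reindex) (auto simp: inj_on_def)
        moreover have "expo w t * (\<Sum>\<nu>\<in>F\<^sub>1. c \<nu> * expo (\<nu> - w) t) = (\<Sum>\<nu>\<in>F\<^sub>1. c \<nu> * expo \<nu> t)"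
          unfolding sum_distrib_left by (intro sum.cong refl) (simp add: mult.left_commute expo_mult)
        ultimately have "expo w t - (\<Sum>\<nu>\<in>F\<^sub>1. c \<nu> * expo \<nu> t) =
            expo w t * (1 - (\<Sum>\<mu>\<in>(\<lambda>\<nu>. \<nu> - w) ` F\<^sub>1. c (\<mu> + w) * expo \<mu> t))"
          by (simp add: right_diff_distrib)
        then show ?thesis by (simp add: norm_mult)
      qed
      then show ?thesis by (simp add: L2_norm_sq_def)
    qed
    also have "\<dots> = L2_norm_sq ?M (\<lambda>t. (expo w t - (\<Sum>\<nu>\<in>F. c \<nu> * expo \<nu> t)) + (\<Sum>\<nu>\<in>F\<^sub>2. c \<nu> * expo \<nu> t))"
      unfolding split by (simp add: algebra_simps)
    also have "\<dots> \<le> 2 * L2_norm_sq ?M (\<lambda>t. expo w t - (\<Sum>\<nu>\<in>F. c \<nu> * expo \<nu> t)) +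
        2 * L2_norm_sq ?M (\<lambda>t. \<Sum>\<nu>\<in>F\<^sub>2. c \<nu> * expo \<nu> t)"
      by (intro L2_norm_sq_add_le square_integrable_diff square_integrable_expo square_integrable_trig lm)
    also have "\<dots> < \<epsilon>" using approx left \<epsilon> by linarith
    finally show False by simp
  qed
  show ?thesis
  proof (intro exI[of _ L] conjI L(1) ballI impI)
    fix u v assume uv: "u \<in> \<Lambda>" "v \<in> \<Lambda>" and window: "\<forall>x\<in>{- L..0}. u + x \<in> \<Lambda> \<longleftrightarrow> v + x \<in> \<Lambda>"
    show "\<forall>x\<ge>- L. u + x \<in> \<Lambda> \<longleftrightarrow> v + x \<in> \<Lambda>"
    proof (rule ccontr)
      assume "\<not> (\<forall>x\<ge>- L. u + x \<in> \<Lambda> \<longleftrightarrow> v + x \<in> \<Lambda>)"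
      then obtain x where x: "x \<ge> - L" "(u + x \<in> \<Lambda>) \<noteq> (v + x \<in> \<Lambda>)" by blast
      \<comment> \<open>Finiteness of local differences yields a first disagreement, which
        \<open>key\<close> excludes in both directions.\<close>
      define B where "B = {t. 0 < t \<and> t \<le> x \<and> (u + t \<in> \<Lambda>) \<noteq> (v + t \<in> \<Lambda>)}"
      have "x \<in> B" using x window by (force simp: B_def)
      have "B \<subseteq> {s - t | s t. s \<in> \<Lambda> \<and> t \<in> \<Lambda> \<and> \<bar>s - t\<bar> \<le> x}"
      proof
        fix t assume t: "t \<in> B"
        then have "\<bar>(u + t) - u\<bar> \<le> x" "\<bar>(v + t) - v\<bar> \<le> x" by (auto simp: B_def)
        moreover have "u + t \<in> \<Lambda> \<or> v + t \<in> \<Lambda>" using t by (auto simp: B_def)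
        ultimately have "(u + t) - u \<in> {s - t | s t. s \<in> \<Lambda> \<and> t \<in> \<Lambda> \<and> \<bar>s - t\<bar> \<le> x} \<or>
            (v + t) - v \<in> {s - t | s t. s \<in> \<Lambda> \<and> t \<in> \<Lambda> \<and> \<bar>s - t\<bar> \<le> x}" using uv by blast
        then show "t \<in> {s - t | s t. s \<in> \<Lambda> \<and> t \<in> \<Lambda> \<and> \<bar>s - t\<bar> \<le> x}" by simp
      qed
      then have "finite B"
        using spectrum_finite_differences[OF spectrum S_bounded] finite_subset by blast
      define a where "a = Min B"
      have "a \<in> B" unfolding a_def using \<open>finite B\<close> \<open>x \<in> B\<close> by (intro Min_in) auto
      then have a: "a > 0" "a \<le> x" "(u + a \<in> \<Lambda>) \<noteq> (v + a \<in> \<Lambda>)" by (auto simp: B_def)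
      have agree: "u + t \<in> \<Lambda> \<longleftrightarrow> v + t \<in> \<Lambda>" if "- L \<le> t" "t < a" for t
      proof (cases "t \<le> 0")
        case True
        then show ?thesis using window that by simp
      next
        case False
        have "t \<notin> B" using Min_le[OF \<open>finite B\<close>, of t] that unfolding a_def by auto
        then show ?thesis using False that a(2) by (auto simp: B_def)
      qed
      show False
        using a(3) key[OF uv a(1) agree] key[OF uv(2,1) a(1) agree[symmetric]] by blast
    qed
  qed
qed

theorem spectrum_periodic:
  obtains T where "has_period \<Lambda> T"
proof -
  obtain R where R: "R \<ge> 0" "\<forall>x. \<exists>y\<in>\<Lambda>. x - R \<le> y \<and> y \<le> x"
    using spectrum_relatively_dense by blast
  obtain L where L: "L \<ge> 0" "\<forall>u\<in>\<Lambda>. \<forall>v\<in>\<Lambda>. (\<forall>x\<in>{- L..0}. u + x \<in> \<Lambda> \<longleftrightarrow> v + x \<in> \<Lambda>) \<longrightarrow>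
    (\<forall>x\<ge>- L. u + x \<in> \<Lambda> \<longleftrightarrow> v + x \<in> \<Lambda>)"
    using spectrum_deterministic by blast
  have "\<exists>T>0. \<forall>y. y \<in> \<Lambda> \<longleftrightarrow> y + T \<in> \<Lambda>"
  proof (rule periodic_if_deterministic[OF spectrum_finite_differences[OF spectrum S_bounded] R(1) _ L(1)])
    show "\<exists>y\<in>\<Lambda>. x - R \<le> y \<and> y \<le> x" for x using R(2) by blast
    show "\<forall>x\<ge>- L. u + x \<in> \<Lambda> \<longleftrightarrow> v + x \<in> \<Lambda>"
      if "u \<in> \<Lambda>" "v \<in> \<Lambda>" "\<forall>x\<in>{- L..0}. u + x \<in> \<Lambda> \<longleftrightarrow> v + x \<in> \<Lambda>" for u v
      using L(2) that by blast
  qed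
  then obtain T where T: "T > 0" "\<And>y. y \<in> \<Lambda> \<longleftrightarrow> y + T \<in> \<Lambda>" by blast
  have "(+) T ` \<Lambda> = \<Lambda>"
  proof (intro equalityI subsetI)
    fix y assume "y \<in> (+) T ` \<Lambda>"
    then show "y \<in> \<Lambda>" using T(2) by (auto simp: add.commute)
  next
    fix y assume "y \<in> \<Lambda>"
    then have "y - T \<in> \<Lambda>" using T(2)[of "y - T"] by simp
    moreover have "y = T + (y - T)" by simp
    ultimately show "y \<in> (+) T ` \<Lambda>" by blast
  qed
  then have "has_period \<Lambda> T" using T(1) by (simp add: has_period_def)
  then show ?thesis using that by blast
qed

end

section \<open>Fibres of a spectral set\<close>

definition slice :: "real \<Rightarrow> real set \<Rightarrow> real \<Rightarrow> int set" where
  "slice q S x = {k. x + of_int k * q \<in> S}"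

text \<open>Periodisation modulo \<open>q\<close> of \<open>f\<close> cut off to \<open>S\<close>.
  For bounded \<open>S\<close> and positive \<open>q\<close> the fibres are finite, so the default
  value of infinite sums does not intervene.\<close>

definition fold_sum :: "real \<Rightarrow> real set \<Rightarrow> (real \<Rightarrow> 'b::comm_monoid_add) \<Rightarrow> real \<Rightarrow> 'b" where
  "fold_sum q S f x = (\<Sum>k\<in>slice q S x. f (x + of_int k * q))"

lemma slice_finite_range:
  assumes q: "q > 0" and S: "bounded S"
  obtains K where "finite K" "\<And>x. x \<in> {0..<q} \<Longrightarrow> slice q S x \<subseteq> K" "\<And>y. y \<in> S \<Longrightarrow> \<lfloor>y / q\<rfloor> \<in> K"
proof -
  obtain R where R: "R > 0" "S \<subseteq> {- R..<R}" using bounded_subset_interval[OF S] .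
  obtain n :: nat where n: "R / q + 1 \<le> real n" using real_arch_simple by blast
  have Rn: "R \<le> (real n - 1) * q" using n q by (simp add: field_simps)
  have fl: "\<lfloor>y / q\<rfloor> \<in> {- int n..int n}" if "y \<in> S" for y
  proof -
    have "- R \<le> y" "y < R" using that R by auto
    then have "- (R / q) \<le> y / q" "y / q < R / q" using q by (simp_all add: field_simps)
    then have "- real n \<le> y / q" "y / q \<le> real n" using n by linarith+
    then show ?thesis by (simp add: le_floor_iff floor_le_iff)
  qed
  moreover have "slice q S x \<subseteq> {- int n..int n}" if x: "x \<in> {0..<q}" for x
  proof
    fix k assume "k \<in> slice q S x"
    then have "x + of_int k * q \<in> S" by (simp add: slice_def)
    then have "\<lfloor>(x + of_int k * q) / q\<rfloor> \<in> {- int n..int n}" by (rule fl)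
    moreover have "(x + of_int k * q) / q = x / q + of_int k" using q by (simp add: field_simps)
    moreover have "\<lfloor>x / q\<rfloor> = 0" using x q by (simp add: floor_eq_iff)
    ultimately show "k \<in> {- int n..int n}" by simp
  qed
  ultimately show ?thesis using that[of "{- int n..int n}"] by blast
qed

lemma floor_slice:
  fixes q x :: real
  assumes "q > 0" "x \<in> {0..<q}"
  shows "\<lfloor>(x + of_int k * q) / q\<rfloor> = k"
proof -
  have "(x + of_int k * q) / q = x / q + of_int k" using assms by (simp add: field_simps)
  moreover have "\<lfloor>x / q\<rfloor> = 0" using assms by (simp add: floor_eq_iff)
  ultimately show ?thesis by simp
qed

lemma floor_remainder:
  fixes q y :: real
  assumes "q > 0"
  shows "y - of_int \<lfloor>y / q\<rfloor> * q \<in> {0..<q}"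
proof -
  have "of_int \<lfloor>y / q\<rfloor> \<le> y / q" "y / q < of_int \<lfloor>y / q\<rfloor> + 1" by linarith+
  then have "of_int \<lfloor>y / q\<rfloor> * q \<le> y" "y < (of_int \<lfloor>y / q\<rfloor> + 1) * q"
    using pos_le_divide_eq[OF assms] pos_divide_less_eq[OF assms] by blast+
  then show ?thesis by (simp add: algebra_simps)
qed

text \<open>The line is cut into the intervals \<open>[k q, (k + 1) q)\<close>, of which finitely
  many meet \<open>S\<close>, and each is translated to \<open>[0, q)\<close>.\<close>

lemma has_bochner_integral_fold_sum:
  fixes f :: "real \<Rightarrow> 'b::euclidean_space"
  assumes q: "q > 0" and S: "S \<in> sets lebesgue" "bounded S"
    and f: "has_bochner_integral (lebesgue_on S) f I"
  shows "has_bochner_integral (lebesgue_on {0..<q}) (fold_sum q S f) I"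
proof -
  obtain K where K: "finite K" "\<And>x. x \<in> {0..<q} \<Longrightarrow> slice q S x \<subseteq> K" "\<And>y. y \<in> S \<Longrightarrow> \<lfloor>y / q\<rfloor> \<in> K"
    by (rule slice_finite_range[OF q S(2)]) blast
  define g where "g x = indicator S x *\<^sub>R f x" for x
  have g: "has_bochner_integral lebesgue g I"
    unfolding g_def using f S(1) by (subst (asm) has_bochner_integral_restrict_space) auto
  define J where "J k = {of_int k * q..<(of_int k + 1) * q}" for k :: int
  define G where "G k x = indicator (J k) x *\<^sub>R g x" for k x
  have intG: "integrable lebesgue (G k)" for k
    unfolding G_def using g by (intro integrable_mult_indicator) (auto simp: J_def has_bochner_integral_iff)
  have sumG: "g x = (\<Sum>k\<in>K. G k x)" for x
  proof (cases "x \<in> S")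
    case True
    have J: "x \<in> J k \<longleftrightarrow> k = \<lfloor>x / q\<rfloor>" for k
    proof
      assume "x \<in> J k"
      then have "x - of_int k * q \<in> {0..<q}" by (simp add: J_def algebra_simps)
      from floor_slice[OF q this, of k] show "k = \<lfloor>x / q\<rfloor>" by simp
    next
      assume "k = \<lfloor>x / q\<rfloor>"
      then show "x \<in> J k" using floor_remainder[OF q, of x] by (simp add: J_def algebra_simps)
    qed
    have "(\<Sum>k\<in>K. G k x) = (\<Sum>k\<in>K. if k = \<lfloor>x / q\<rfloor> then g x else 0)"
      by (intro sum.cong refl) (auto simp: G_def J)
    then show ?thesis using K(1) K(3)[OF True] by simp
  next
    case False
    then show ?thesis by (simp add: G_def g_def)
  qed
  have "I = (\<Sum>k\<in>K. integral\<^sup>L lebesgue (G k))"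
  proof -
    have "I = integral\<^sup>L lebesgue (\<lambda>x. \<Sum>k\<in>K. G k x)"
      using g unfolding sumG by (simp add: has_bochner_integral_iff)
    also have "\<dots> = (\<Sum>k\<in>K. integral\<^sup>L lebesgue (G k))" by (rule Bochner_Integration.integral_sum) (rule intG)
    finally show ?thesis .
  qed
  moreover have "has_bochner_integral lebesgue (\<lambda>x. G k (of_int k * q + 1 * x)) (integral\<^sup>L lebesgue (G k))" for k
    using has_bochner_integral_lebesgue_real_affine_iff[of 1 "G k" "integral\<^sup>L lebesgue (G k)" "of_int k * q"] intG[of k]
    by (simp add: has_bochner_integral_iff)
  then have "has_bochner_integral lebesgue (\<lambda>x. \<Sum>k\<in>K. G k (of_int k * q + 1 * x)) (\<Sum>k\<in>K. integral\<^sup>L lebesgue (G k))"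
    by (rule has_bochner_integral_sum)
  moreover have "(\<Sum>k\<in>K. G k (of_int k * q + 1 * x)) = indicator {0..<q} x *\<^sub>R fold_sum q S f x" for x
  proof (cases "x \<in> {0..<q}")
    case True
    have "(\<Sum>k\<in>K. G k (of_int k * q + 1 * x)) = (\<Sum>k\<in>K. if k \<in> slice q S x then f (x + of_int k * q) else 0)"
    proof (intro sum.cong refl)
      fix k
      have "of_int k * q + 1 * x \<in> J k" using True by (simp add: J_def algebra_simps)
      then show "G k (of_int k * q + 1 * x) = (if k \<in> slice q S x then f (x + of_int k * q) else 0)"
        by (simp add: G_def g_def slice_def add.commute)
    qed
    also have "\<dots> = fold_sum q S f x"
      unfolding fold_sum_def using K(1) K(2)[OF True] by (simp add: sum.If_cases Int_absorb1)
    finally show ?thesis using True by simp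
  next
    case False
    then have "of_int k * q + 1 * x \<notin> J k" for k by (auto simp: J_def algebra_simps)
    then show ?thesis using False by (simp add: G_def)
  qed
  ultimately have "has_bochner_integral lebesgue (\<lambda>x. indicator {0..<q} x *\<^sub>R fold_sum q S f x) I"
    by simp
  then show ?thesis by (subst has_bochner_integral_restrict_space) auto
qed

lemma fold_sum_integral:
  fixes f :: "real \<Rightarrow> 'b::euclidean_space"
  assumes "q > 0" "S \<in> sets lebesgue" "bounded S" "integrable (lebesgue_on S) f"
  shows "integrable (lebesgue_on {0..<q}) (fold_sum q S f)"
    "integral\<^sup>L (lebesgue_on {0..<q}) (fold_sum q S f) = integral\<^sup>L (lebesgue_on S) f"
  using has_bochner_integral_fold_sum[OF assms(1-3) has_bochner_integral_integrable[OF assms(4)]]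
  by (auto simp: has_bochner_integral_iff)

text \<open>Every trigonometric polynomial \<open>p\<close> is orthogonal to \<open>F\<close>, so by
  Pythagoras it is no closer to \<open>F\<close> than 0 is; density then forces the norm of
  \<open>F\<close> to vanish.\<close>

lemma trig_orthogonal_imp_zero:
  assumes q: "q > 0" and F: "square_integrable (lebesgue_on {0..<q}) F"
    and orth: "\<And>j::int. L2_inner (lebesgue_on {0..<q}) F (expo (of_int j / q)) = 0"
  shows "AE x in lebesgue_on {0..<q}. F x = 0"
proof (rule L2_norm_sq_eq_0[OF F])
  let ?M = "lebesgue_on {0..<q}"
  have lm: "{0..<q} \<in> lmeasurable" by (intro bounded_set_imp_lmeasurable) auto
  show "L2_norm_sq ?M F = 0"
  proof (rule ccontr)
    assume "L2_norm_sq ?M F \<noteq> 0"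
    then have pos: "L2_norm_sq ?M F > 0" using L2_norm_sq_nonneg[of ?M F] by linarith
    have "trig_approximable q {0..<0 + q} F"
      by (rule trig_approximable_square_integrable[OF q]) (use F in simp)
    then obtain p where p: "trig_poly q p" "L2_norm_sq ?M (\<lambda>x. F x - p x) < L2_norm_sq ?M F"
      using pos unfolding trig_approximable_def by auto
    have pm: "square_integrable ?M p" by (rule square_integrable_trig_poly[OF p(1) lm])
    have "square_integrable ?M f \<and> L2_inner ?M F f = 0" if "trig_poly q f" for f
      using that
    proof (induction rule: trig_poly.induct)
      case (expo k)
      then show ?case using orth square_integrable_expo[OF lm] by simp
    next
      case (scale f c)
      then show ?case by (simp add: L2_inner_scale_right square_integrable_scale)
    next
      case (add f g)
      then show ?case by (simp add: L2_inner_add_right[OF _ _ F] square_integrable_add)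
    qed
    then have "L2_inner ?M F (\<lambda>x. (- 1) * p x) = 0"
      using p(1) by (simp only: L2_inner_scale_right) simp
    then have "L2_norm_sq ?M (\<lambda>x. F x + (- 1) * p x) = L2_norm_sq ?M F + L2_norm_sq ?M (\<lambda>x. (- 1) * p x)"
      by (intro L2_pythagoras F square_integrable_scale pm)
    then show False using p(2) L2_norm_sq_nonneg[of ?M "\<lambda>x. - p x"] by simp
  qed
qed

lemma AE_interval_exists:
  assumes q: "(q::real) > 0" and ae: "AE x in lebesgue_on {0..<q}. P x"
  shows "\<exists>x\<in>{0..<q}. P x"
proof (rule ccontr)
  assume neg: "\<not> ?thesis"
  let ?M = "lebesgue_on {0..<q}"
  have "AE x in ?M. x \<in> {0..<q}" by (rule AE_I2) simp
  with ae have "AE x in ?M. False" by eventually_elim (use neg in blast)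
  then have "emeasure ?M (space ?M) = 0" unfolding eventually_False ae_filter_eq_bot_iff .
  then show False using q by (simp add: emeasure_restrict_space)
qed

section \<open>Orthogonality relations between finite sets\<close>

definition fin_orth :: "real set \<Rightarrow> real set \<Rightarrow> bool" where
  "fin_orth X Y \<longleftrightarrow> (\<forall>x\<in>X. \<forall>x'\<in>X. x \<noteq> x' \<longrightarrow> (\<Sum>y\<in>Y. expo (x - x') y) = 0)"

text \<open>Characters are symmetric in point and frequency, so both sides are the fourfold sum of
  \<open>expo (x - x') (y - y')\<close>.\<close>

lemma double_count:
  "(\<Sum>y\<in>Y. \<Sum>y'\<in>Y. (cmod (\<Sum>x\<in>X. expo (y - y') x))\<^sup>2) = (\<Sum>x\<in>X. \<Sum>x'\<in>X. (cmod (\<Sum>y\<in>Y. expo (x - x') y))\<^sup>2)"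
proof -
  have e: "expo a b * cnj (expo a c) = expo (b - c) a" for a b c
    by (simp add: expo_commute[of a] expo_mult_cnj)
  have sq: "complex_of_real ((cmod (\<Sum>x\<in>X. expo z x))\<^sup>2) = (\<Sum>x\<in>X. \<Sum>x'\<in>X. expo (x - x') z)" for X z
    unfolding complex_norm_square by (simp add: sum_product e)
  have split: "expo (x - x') (y - y') = expo (x - x') y * cnj (expo (x - x') y')" for x x' y y'
  proof -
    have "cnj (expo (x - x') y') = expo (x - x') (- y')"
      by (simp add: cnj_expo expo_commute[of _ y'] expo_commute[of _ "- y'"])
    then show ?thesis using expo_add_right[of "x - x'" y "- y'"] by simp
  qed
  have "complex_of_real (\<Sum>y\<in>Y. \<Sum>y'\<in>Y. (cmod (\<Sum>x\<in>X. expo (y - y') x))\<^sup>2) =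
      (\<Sum>y\<in>Y. \<Sum>y'\<in>Y. \<Sum>x\<in>X. \<Sum>x'\<in>X. expo (x - x') (y - y'))"
    by (simp only: of_real_sum sq)
  also have "\<dots> = (\<Sum>x\<in>X. \<Sum>x'\<in>X. \<Sum>y\<in>Y. \<Sum>y'\<in>Y. expo (x - x') (y - y'))"
    by (simp only: sum.swap[of _ X Y])
  also have "\<dots> = (\<Sum>x\<in>X. \<Sum>x'\<in>X. \<Sum>y\<in>Y. \<Sum>y'\<in>Y. expo (y - y') (x - x'))"
    by (simp only: expo_commute[of "_ - _" "_ - _"])
  also have "\<dots> = complex_of_real (\<Sum>x\<in>X. \<Sum>x'\<in>X. (cmod (\<Sum>y\<in>Y. expo (x - x') y))\<^sup>2)"
    by (simp only: of_real_sum sq)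
  finally show ?thesis by (simp only: of_real_eq_iff)
qed

lemma fin_orth_double_sum:
  assumes "finite X" "fin_orth X Y"
  shows "(\<Sum>x\<in>X. \<Sum>x'\<in>X. (cmod (\<Sum>y\<in>Y. expo (x - x') y))\<^sup>2) = card X * (card Y)\<^sup>2"
proof -
  have "(\<Sum>x'\<in>X. (cmod (\<Sum>y\<in>Y. expo (x - x') y))\<^sup>2) = (real (card Y))\<^sup>2" if "x \<in> X" for x
  proof -
    have "(\<Sum>x'\<in>X. (cmod (\<Sum>y\<in>Y. expo (x - x') y))\<^sup>2) = (\<Sum>x'\<in>X. if x' = x then (real (card Y))\<^sup>2 else 0)"
      using assms(2) that by (intro sum.cong refl) (auto simp: fin_orth_def)
    then show ?thesis using assms(1) that by simp
  qed
  then show ?thesis by simp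
qed

text \<open>Keeping only the diagonal on the \<open>Y\<close> side of \<open>double_count\<close>
  gives \<open>|Y| |X|\<^sup>2 \<le> |X| |Y|\<^sup>2\<close>.\<close>

lemma fin_orth_card_le:
  assumes "finite X" "finite Y" "Y \<noteq> {}" "fin_orth X Y"
  shows "card X \<le> card Y"
proof (cases "X = {}")
  case False
  have "real (card Y * (card X)\<^sup>2) = (\<Sum>y\<in>Y. (cmod (\<Sum>x\<in>X. expo (y - y) x))\<^sup>2)" by simp
  also have "\<dots> \<le> (\<Sum>y\<in>Y. \<Sum>y'\<in>Y. (cmod (\<Sum>x\<in>X. expo (y - y') x))\<^sup>2)"
    using assms by (intro sum_mono member_le_sum) auto
  also have "\<dots> = real (card X * (card Y)\<^sup>2)"
    unfolding double_count[where X = X and Y = Y] using fin_orth_double_sum[OF assms(1,4)] by simp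
  finally have "card Y * (card X)\<^sup>2 \<le> card X * (card Y)\<^sup>2" by (simp only: of_nat_le_iff)
  then have "(card X * card Y) * card X \<le> (card X * card Y) * card Y" by (simp add: power2_eq_square mult_ac)
  moreover have "card X * card Y > 0" using assms False by (simp add: card_gt_0_iff)
  ultimately show ?thesis by simp
qed simp

text \<open>For equal cardinalities the diagonal of the other side already uses up the whole double
  sum, so its off-diagonal squares vanish: orthogonal rows of a square matrix of unimodular entries
  have orthogonal columns.\<close>

lemma fin_orth_sym:
  assumes "finite X" "finite Y" "card X = card Y" "fin_orth X Y"
  shows "fin_orth Y X"
proof -
  let ?a = "\<lambda>y y'. (cmod (\<Sum>x\<in>X. expo (y - y') x))\<^sup>2"
  have "(\<Sum>y\<in>Y. \<Sum>y'\<in>Y. ?a y y') = (\<Sum>y\<in>Y. (real (card X))\<^sup>2)"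
    unfolding double_count[where X = X and Y = Y] fin_orth_double_sum[OF assms(1,4)] using assms(3) by simp
  also have "\<dots> = (\<Sum>y\<in>Y. \<Sum>y'\<in>Y. if y' = y then (real (card X))\<^sup>2 else 0)"
    using assms(2) by (intro sum.cong refl) simp
  finally have "(\<Sum>y\<in>Y. \<Sum>y'\<in>Y. ?a y y' - (if y' = y then (real (card X))\<^sup>2 else 0)) = 0"
    by (simp only: sum_subtractf)
  then have "(\<Sum>p\<in>Y \<times> Y. ?a (fst p) (snd p) - (if snd p = fst p then (real (card X))\<^sup>2 else 0)) = 0"
    by (simp add: sum.cartesian_product case_prod_unfold)
  then have "\<forall>p\<in>Y \<times> Y. ?a (fst p) (snd p) - (if snd p = fst p then (real (card X))\<^sup>2 else 0) = 0"
    using assms(2) by (subst (asm) sum_nonneg_eq_0_iff) auto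
  then show ?thesis unfolding fin_orth_def by fastforce
qed

section \<open>Folding modulo a period\<close>

lemma integral_expo_period:
  assumes q: "q > 0" and j: "j \<noteq> 0"
  shows "(\<integral>x. expo (of_int j / q) x \<partial>(lebesgue_on {0..<q})) = 0"
proof -
  define \<theta> where "\<theta> = of_int j / q"
  have \<theta>: "\<theta> \<noteq> 0" using q j by (simp add: \<theta>_def)
  define F where "F x = expo \<theta> x / (2 * of_real pi * \<i> * of_real \<theta>)" for x
  have "(expo \<theta> has_integral F q - F 0) {0..q}"
  proof (rule fundamental_theorem_of_calculus)
    fix x assume "x \<in> {0..q}"
    show "(F has_vector_derivative expo \<theta> x) (at x within {0..q})"
      unfolding F_def expo_def using \<theta>
      by (auto intro!: derivative_eq_intros has_vector_derivative_real_field)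
  qed (use q in simp)
  moreover have "F q = F 0"
  proof -
    have "\<theta> * q \<in> \<int>" using q by (simp add: \<theta>_def)
    then show ?thesis by (simp add: F_def expo_Ints)
  qed
  ultimately have "(expo \<theta> has_integral 0) {0..<q}"
    by (subst has_integral_spike_set_eq[where T = "{0..q}"]) (auto intro: negligible_subset[of "{q}"])
  moreover have "integrable (lebesgue_on {0..<q}) (expo \<theta>)"
  proof -
    have lm: "{0..<q} \<in> lmeasurable" by (intro bounded_set_imp_lmeasurable) auto
    show ?thesis
      by (rule finite_measure.integrable_const_bound[OF finite_measure_lebesgue_on[OF lm], of _ 1]) auto
  qed
  ultimately show ?thesis
    unfolding \<theta>_def[symmetric] by (subst lebesgue_integral_eq_integral) (auto dest: integral_unique)
qed

lemma expo_slice: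
  assumes "q > 0"
  shows "expo (of_int j / q) (x + of_int k * q) = expo (of_int j / q) x"
proof -
  have "of_int j / q * (of_int k * q) = of_int (j * k)" using assms by simp
  then have "expo (of_int j / q) (of_int k * q) = 1" by (intro expo_Ints) (metis Ints_of_int)
  then show ?thesis by (simp add: expo_add_right)
qed

lemma fold_sum_mult_periodic:
  assumes "q > 0"
  shows "fold_sum q S (\<lambda>y. h y * cnj (expo (of_int j / q) y)) x = fold_sum q S h x * cnj (expo (of_int j / q) x)"
  unfolding fold_sum_def expo_slice[OF assms] by (simp add: sum_distrib_right)

text \<open>Folding preserves inner products with characters of period \<open>q\<close>, so the
  hypothesis lists the Fourier coefficients of the folded function, and they are those of the
  constant \<open>c\<close>.\<close>

lemma fold_sum_constant_ae:
  fixes h :: "real \<Rightarrow> complex"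
  assumes q: "q > 0" and S: "S \<in> lmeasurable" "bounded S"
    and h: "h \<in> borel_measurable (lebesgue_on S)" "\<And>y. y \<in> S \<Longrightarrow> cmod (h y) \<le> C"
    and coeff: "\<And>j::int. L2_inner (lebesgue_on S) h (expo (of_int j / q)) = c * (if j = 0 then of_real q else 0)"
  shows "AE x in lebesgue_on {0..<q}. fold_sum q S h x = c"
proof -
  let ?M = "lebesgue_on {0..<q}"
  have lm: "{0..<q} \<in> lmeasurable" by (intro bounded_set_imp_lmeasurable) auto
  have Sl: "S \<in> sets lebesgue" using S by (simp add: fmeasurableD)
  have hS: "square_integrable (lebesgue_on S) h" by (rule square_integrable_bounded_on[OF S(1) h])
  have intS: "integrable (lebesgue_on S) h"
    by (rule finite_measure.integrable_const_bound[OF finite_measure_lebesgue_on[OF S(1)] _ h(1), where B = C])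
      (rule AE_I2, use h(2) in simp)
  note fold = fold_sum_integral[OF q Sl S(2)]
  obtain K where K: "finite K" "\<And>x. x \<in> {0..<q} \<Longrightarrow> slice q S x \<subseteq> K"
    by (rule slice_finite_range[OF q S(2)]) blast
  have bound: "cmod (fold_sum q S h x) \<le> card K * \<bar>C\<bar>" if x: "x \<in> {0..<q}" for x
  proof -
    have "cmod (fold_sum q S h x) \<le> (\<Sum>k\<in>slice q S x. \<bar>C\<bar>)"
      unfolding fold_sum_def
      by (intro order_trans[OF norm_sum] sum_mono order_trans[OF h(2)]) (auto simp: slice_def)
    also have "\<dots> = card (slice q S x) * \<bar>C\<bar>" by simp
    also have "\<dots> \<le> card K * \<bar>C\<bar>" using card_mono[OF K(1) K(2)[OF x]] by (intro mult_right_mono) auto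
    finally show ?thesis .
  qed
  have F: "square_integrable ?M (fold_sum q S h)"
    by (rule square_integrable_bounded_on[OF lm _ bound]) (use fold(1)[OF intS] in auto)
  have const: "square_integrable ?M (\<lambda>x. c)"
    by (rule square_integrable_bounded_on[OF lm, where C = "cmod c"]) auto
  have "L2_inner ?M (\<lambda>x. fold_sum q S h x - c) (expo (of_int j / q)) = 0" for j :: int
  proof -
    have "L2_inner ?M (\<lambda>x. fold_sum q S h x - c) (expo (of_int j / q)) =
        L2_inner ?M (fold_sum q S h) (expo (of_int j / q)) - L2_inner ?M (\<lambda>x. c) (expo (of_int j / q))"
      by (rule L2_inner_diff_left[OF F const square_integrable_expo[OF lm]])
    also have "L2_inner ?M (fold_sum q S h) (expo (of_int j / q)) = L2_inner (lebesgue_on S) h (expo (of_int j / q))"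
      unfolding L2_inner_def fold_sum_mult_periodic[OF q, symmetric]
      by (rule fold(2)) (rule integrable_inner[OF hS square_integrable_expo[OF S(1)]])
    also have "L2_inner ?M (\<lambda>x. c) (expo (of_int j / q)) = c * (if j = 0 then of_real q else 0)"
    proof (cases "j = 0")
      case True
      then show ?thesis using q by (simp add: L2_inner_def measure_restrict_space scaleR_conv_of_real mult.commute)
    next
      case False
      then have "(\<integral>x. expo (of_int (- j) / q) x \<partial>?M) = 0" by (intro integral_expo_period[OF q]) simp
      then show ?thesis using False by (simp add: L2_inner_def cnj_expo)
    qed
    finally show ?thesis by (simp add: coeff)
  qed
  then have "AE x in ?M. fold_sum q S h x - c = 0"
    by (intro trig_orthogonal_imp_zero[OF q] square_integrable_diff F const)
  then show ?thesis by simp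
qed

text \<open>With fewer characters than points some point mass is not a combination of characters;
  its component orthogonal to all of them is the desired \<open>v\<close>.\<close>

lemma fin_orth_annihilator:
  assumes X: "finite X" and Y: "finite Y" "fin_orth X Y" "card X < card Y"
  shows "\<exists>v. (\<exists>y\<in>Y. v y \<noteq> 0) \<and> (\<forall>x\<in>X. (\<Sum>y\<in>Y. v y * expo (- x) y) = 0)"
proof -
  obtain y\<^sub>0 where y0: "y\<^sub>0 \<in> Y" using Y(3) by fastforce
  define n where "n = card Y"
  have n: "n > 0" using Y(3) by (simp add: n_def)
  \<comment> \<open>The point mass at \<open>y\<^sub>0\<close> minus its projection onto the
    characters, each of squared norm \<open>n\<close> on \<open>Y\<close>. Its value at
    \<open>y\<^sub>0\<close> is \<open>1 - card X / n\<close>.\<close>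
  define v where "v y = (if y = y\<^sub>0 then 1 else 0) - (\<Sum>x\<in>X. expo x (y - y\<^sub>0)) / of_nat n" for y
  have "v y\<^sub>0 \<noteq> 0"
  proof
    assume "v y\<^sub>0 = 0"
    then have "of_nat (card X) = (of_nat n :: complex)" using n by (simp add: v_def)
    then show False using Y(3) by (simp add: n_def)
  qed
  moreover have "(\<Sum>y\<in>Y. v y * expo (- x) y) = 0" if x: "x \<in> X" for x
  proof -
    have "(\<Sum>y\<in>Y. v y * expo (- x) y) =
        (\<Sum>y\<in>Y. (if y = y\<^sub>0 then expo (- x) y\<^sub>0 else 0) - (\<Sum>x'\<in>X. expo x' (y - y\<^sub>0)) * expo (- x) y / of_nat n)"
      by (intro sum.cong refl) (simp add: v_def left_diff_distrib)
    also have "\<dots> = expo (- x) y\<^sub>0 - (\<Sum>y\<in>Y. (\<Sum>x'\<in>X. expo x' (y - y\<^sub>0)) * expo (- x) y) / of_nat n"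
      using Y(1) y0 by (simp add: sum_subtractf sum_divide_distrib)
    also have "(\<Sum>y\<in>Y. (\<Sum>x'\<in>X. expo x' (y - y\<^sub>0)) * expo (- x) y) = (\<Sum>y\<in>Y. \<Sum>x'\<in>X. expo x' (- y\<^sub>0) * expo (x' - x) y)"
    proof (intro sum.cong refl, unfold sum_distrib_right, intro sum.cong refl)
      fix y x'
      show "expo x' (y - y\<^sub>0) * expo (- x) y = expo x' (- y\<^sub>0) * expo (x' - x) y"
        using expo_add_right[of x' y "- y\<^sub>0"] expo_mult[of x' y "- x"] by simp
    qed
    also have "\<dots> = (\<Sum>x'\<in>X. expo x' (- y\<^sub>0) * (\<Sum>y\<in>Y. expo (x' - x) y))"
      by (subst sum.swap) (simp add: sum_distrib_left)
    also have "\<dots> = (\<Sum>x'\<in>X. if x' = x then expo x (- y\<^sub>0) * of_nat n else 0)"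
      using Y(2) x by (intro sum.cong refl) (auto simp: fin_orth_def n_def)
    also have "\<dots> = expo x (- y\<^sub>0) * of_nat n" using X x by simp
    also have "expo x (- y\<^sub>0) = expo (- x) y\<^sub>0" by (simp add: expo_cis)
    finally show ?thesis using n by simp
  qed
  ultimately show ?thesis using y0 by blast
qed

text \<open>Only the finitely many \<open>k \<in> K\<close> need testing, so the level set is a
  finite intersection of translates of \<open>S\<close> and their complements within the
  interval.\<close>

lemma slice_level_set_measurable:
  assumes q: "q > 0" and S: "S \<in> sets lebesgue" "bounded S"
  shows "{x \<in> {0..<q}. slice q S x = A} \<in> sets lebesgue"
proof -
  obtain K where K: "finite K" "\<And>x. x \<in> {0..<q} \<Longrightarrow> slice q S x \<subseteq> K"
    by (rule slice_finite_range[OF q S(2)]) blast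
  have shift: "{x. x + of_int k * q \<in> S} \<in> sets lebesgue" for k :: int
  proof -
    have "{x. x + of_int k * q \<in> S} = (+) (- (of_int k * q)) ` S"
      by (auto simp: image_iff algebra_simps intro!: bexI[of _ "_ + of_int k * q"])
    then show ?thesis using lebesgue_sets_translation[OF S(1)] by (simp only:)
  qed
  show ?thesis
  proof (cases "A \<subseteq> K")
    case True
    have fwd: "(x + of_int k * q \<in> S) = (k \<in> A)" if "slice q S x = A" for x and k :: int
      using that unfolding slice_def by blast
    have bwd: "slice q S x = A" if "x \<in> {0..<q}" "\<forall>k\<in>K. (x + of_int k * q \<in> S) = (k \<in> A)" for x
      using K(2)[OF that(1)] that(2) True unfolding slice_def by blast
    have "{x \<in> {0..<q}. slice q S x = A} = {0..<q} \<inter> {x \<in> space lebesgue. \<forall>k\<in>K. (x + of_int k * q \<in> S) = (k \<in> A)}"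
    proof (intro set_eqI iffI)
      fix x assume "x \<in> {x \<in> {0..<q}. slice q S x = A}"
      then have "x \<in> {0..<q}" "slice q S x = A" by blast+
      then show "x \<in> {0..<q} \<inter> {x \<in> space lebesgue. \<forall>k\<in>K. (x + of_int k * q \<in> S) = (k \<in> A)}"
        using fwd by simp
    next
      fix x assume "x \<in> {0..<q} \<inter> {x \<in> space lebesgue. \<forall>k\<in>K. (x + of_int k * q \<in> S) = (k \<in> A)}"
      then have "x \<in> {0..<q}" "\<forall>k\<in>K. (x + of_int k * q \<in> S) = (k \<in> A)" by blast+
      then show "x \<in> {x \<in> {0..<q}. slice q S x = A}" using bwd by blast
    qed
    moreover have "{x \<in> space lebesgue. \<forall>k\<in>K. (x + of_int k * q \<in> S) = (k \<in> A)} \<in> sets lebesgue"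
    proof (rule sets.sets_Collect_finite_All[OF _ K(1)])
      fix k
      show "{x \<in> space lebesgue. (x + of_int k * q \<in> S) = (k \<in> A)} \<in> sets lebesgue"
      proof (cases "k \<in> A")
        case False
        then have "{x \<in> space lebesgue. (x + of_int k * q \<in> S) = (k \<in> A)} = - {x. x + of_int k * q \<in> S}" by auto
        then show ?thesis using shift[of k] by (simp only: Compl_in_sets_lebesgue)
      qed (use shift[of k] in simp)
    qed
    ultimately show ?thesis by auto
  next
    case False
    then have "{x \<in> {0..<q}. slice q S x = A} = {}" using K(2) by blast
    then show ?thesis by (simp only: sets.empty_sets)
  qed
qed

text \<open>Invariance under \<open>T\<close> extends orthogonality to all shifts by
  \<open>j T\<close>. Folding \<open>1\<close> and \<open>expo (\<gamma> - \<gamma>')\<close> modulo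
  \<open>1 / T\<close> therefore yields the constants \<open>p\<close> and 0: almost every fibre has
  \<open>p\<close> points, on which \<open>\<Gamma>\<close> is orthogonal. Completeness enters to
  show that \<open>\<Gamma>\<close> has no fewer than \<open>p\<close> elements.\<close>

theorem spectrum_slices:
  assumes spectrum: "is_spectrum S \<Lambda>" and S: "bounded S" and period: "has_period \<Lambda> T"
  shows "\<exists>(p::nat) \<Gamma>. p \<ge> 1 \<and> real p = measure lebesgue S * T \<and> finite \<Gamma> \<and> card \<Gamma> = p \<and> 0 \<in> \<Gamma> \<and>
    (AE x in lebesgue_on {0..<1 / T}. card (slice (1 / T) S x) = p \<and>
       fin_orth \<Gamma> ((\<lambda>k. of_int k * (1 / T)) ` slice (1 / T) S x))"
proof -
  define q where "q = 1 / T"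
  have T: "T > 0" and shift: "(+) T ` \<Lambda> = \<Lambda>" using period by (auto simp: has_period_def)
  have q: "q > 0" using T by (simp add: q_def)
  have jq: "of_int j / q = of_int j * T" for j :: int by (simp add: q_def)
  let ?m = "measure lebesgue S"
  have lm: "S \<in> lmeasurable" and m: "?m > 0" and basis: "L2_orthogonal_basis (lebesgue_on S) \<Lambda> expo"
    using spectrum unfolding is_spectrum_def by blast+
  have Sl: "S \<in> sets lebesgue" using lm by (simp add: fmeasurableD)
  let ?M = "lebesgue_on {0..<q}"
  have step: "l + T \<in> \<Lambda> \<longleftrightarrow> l \<in> \<Lambda>" for l
  proof -
    have "l + T \<in> (+) T ` \<Lambda> \<longleftrightarrow> l \<in> \<Lambda>" by (auto simp: add.commute)
    then show ?thesis unfolding shift .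
  qed
  have nstep: "l + of_nat n * T \<in> \<Lambda> \<longleftrightarrow> l \<in> \<Lambda>" for l and n :: nat
  proof (induction n)
    case (Suc n)
    then show ?case using step[of "l + of_nat n * T"] by (simp add: algebra_simps)
  qed simp
  have jstep: "l + of_int j * T \<in> \<Lambda> \<longleftrightarrow> l \<in> \<Lambda>" for l and j :: int
  proof (cases "j \<ge> 0")
    case True
    then show ?thesis using nstep[of l "nat j"] by simp
  next
    case False
    then show ?thesis using nstep[of "l + of_int j * T" "nat (- j)"] by simp
  qed
  have zero: "ind_transform S (l - l' - of_int j * T) = 0"
    if "l \<in> \<Lambda>" "l' \<in> \<Lambda>" "l \<noteq> l' + of_int j * T" for l l' and j :: int
    using spectrum_orthogonal[OF spectrum S that(1), of "l' + of_int j * T"] jstep that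
    by (simp add: algebra_simps)
  obtain l\<^sub>0 where l0: "l\<^sub>0 \<in> \<Lambda>" using spectrum_relatively_dense[OF spectrum S] by blast
  \<comment> \<open>One representative of each class of the spectrum modulo its period.\<close>
  define \<Gamma> where "\<Gamma> = \<Lambda> \<inter> {0..<T}"
  have rep: "l - of_int \<lfloor>l / T\<rfloor> * T \<in> \<Gamma>" if "l \<in> \<Lambda>" for l
    using jstep[of "l - of_int \<lfloor>l / T\<rfloor> * T" "\<lfloor>l / T\<rfloor>"] that floor_remainder[OF T, of l] by (simp add: \<Gamma>_def)
  obtain \<gamma>\<^sub>0 where g0: "\<gamma>\<^sub>0 \<in> \<Gamma>" using rep[OF l0] by blast
  have finG: "finite \<Gamma>"
  proof (rule finite_subset)
    show "\<Gamma> \<subseteq> (+) \<gamma>\<^sub>0 ` {x - y | x y. x \<in> \<Lambda> \<and> y \<in> \<Lambda> \<and> \<bar>x - y\<bar> \<le> T}"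
    proof
      fix \<gamma> assume "\<gamma> \<in> \<Gamma>"
      then have "\<gamma> - \<gamma>\<^sub>0 \<in> {x - y | x y. x \<in> \<Lambda> \<and> y \<in> \<Lambda> \<and> \<bar>x - y\<bar> \<le> T}"
        using g0 unfolding \<Gamma>_def by (intro CollectI exI[of _ \<gamma>] exI[of _ \<gamma>\<^sub>0]) auto
      moreover have "\<gamma> = \<gamma>\<^sub>0 + (\<gamma> - \<gamma>\<^sub>0)" by simp
      ultimately show "\<gamma> \<in> (+) \<gamma>\<^sub>0 ` {x - y | x y. x \<in> \<Lambda> \<and> y \<in> \<Lambda> \<and> \<bar>x - y\<bar> \<le> T}" by blast
    qed
    show "finite ((+) \<gamma>\<^sub>0 ` {x - y | x y. x \<in> \<Lambda> \<and> y \<in> \<Lambda> \<and> \<bar>x - y\<bar> \<le> T})"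
      using spectrum_finite_differences[OF spectrum S] by simp
  qed
  have ae_card: "AE x in ?M. of_nat (card (slice q S x)) = complex_of_real (?m / q)"
  proof -
    have "AE x in ?M. fold_sum q S (\<lambda>y. 1 :: complex) x = of_real (?m / q)"
    proof (rule fold_sum_constant_ae[OF q lm S, where C = 1])
      fix j :: int
      have "L2_inner (lebesgue_on S) (\<lambda>y. 1) (expo (of_int j / q)) = ind_transform S (l\<^sub>0 - l\<^sub>0 - of_int j * T)"
        by (simp add: L2_inner_def ind_transform_def cnj_expo jq)
      also have "\<dots> = of_real (?m / q) * (if j = 0 then of_real q else 0)"
        using zero[OF l0 l0, of j] T q by (auto simp: ind_transform_0[OF lm])
      finally show "L2_inner (lebesgue_on S) (\<lambda>y. 1) (expo (of_int j / q)) = of_real (?m / q) * (if j = 0 then of_real q else 0)" .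
    qed auto
    then show ?thesis by (simp add: fold_sum_def)
  qed
  have ae_orth: "AE x in ?M. (\<Sum>k\<in>slice q S x. expo (\<gamma> - \<gamma>') (of_int k * q)) = 0"
    if \<gamma>: "\<gamma> \<in> \<Gamma>" "\<gamma>' \<in> \<Gamma>" "\<gamma> \<noteq> \<gamma>'" for \<gamma> \<gamma>'
  proof -
    have ne: "\<gamma> \<noteq> \<gamma>' + of_int j * T" for j :: int
    proof
      assume eq: "\<gamma> = \<gamma>' + of_int j * T"
      then have "\<bar>of_int j * T\<bar> < T" using \<gamma> by (auto simp: \<Gamma>_def)
      then have "\<bar>real_of_int j\<bar> < 1" using T by (simp add: abs_mult)
      then have "j = 0" by linarith
      then show False using eq \<gamma>(3) by simp
    qed
    have "AE x in ?M. fold_sum q S (expo (\<gamma> - \<gamma>')) x = 0"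
    proof (rule fold_sum_constant_ae[OF q lm S, where C = 1])
      fix j :: int
      show "L2_inner (lebesgue_on S) (expo (\<gamma> - \<gamma>')) (expo (of_int j / q)) = 0 * (if j = 0 then of_real q else 0)"
        using zero[of \<gamma> \<gamma>' j] \<gamma> ne[of j] by (simp add: L2_inner_expo jq \<Gamma>_def)
    qed auto
    then show ?thesis
    proof eventually_elim
      case (elim x)
      have "fold_sum q S (expo (\<gamma> - \<gamma>')) x = expo (\<gamma> - \<gamma>') x * (\<Sum>k\<in>slice q S x. expo (\<gamma> - \<gamma>') (of_int k * q))"
        by (simp add: fold_sum_def expo_add_right sum_distrib_left)
      moreover have "expo (\<gamma> - \<gamma>') x \<noteq> 0" using norm_expo[of "\<gamma> - \<gamma>'" x] by (metis norm_zero zero_neq_one)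
      ultimately show ?case using elim by simp
    qed
  qed
  define img where "img A = (\<lambda>k::int. of_int k * q) ` A" for A
  have sum_img: "(\<Sum>y\<in>img A. f y) = (\<Sum>k\<in>A. f (of_int k * q))" for A and f :: "real \<Rightarrow> complex"
    unfolding img_def using q by (subst sum.reindex) (auto simp: inj_on_def)
  have card_img: "card (img A) = card A" for A
    unfolding img_def using q by (intro card_image) (auto simp: inj_on_def)
  have "AE x in ?M. \<forall>\<gamma>\<in>\<Gamma>. \<forall>\<gamma>'\<in>\<Gamma>. \<gamma> \<noteq> \<gamma>' \<longrightarrow> (\<Sum>k\<in>slice q S x. expo (\<gamma> - \<gamma>') (of_int k * q)) = 0"
  proof (intro AE_finite_allI finG)
    fix \<gamma> \<gamma>' assume "\<gamma> \<in> \<Gamma>" "\<gamma>' \<in> \<Gamma>"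
    then show "AE x in ?M. \<gamma> \<noteq> \<gamma>' \<longrightarrow> (\<Sum>k\<in>slice q S x. expo (\<gamma> - \<gamma>') (of_int k * q)) = 0"
      using ae_orth by (cases "\<gamma> = \<gamma>'") auto
  qed
  then have ae_fin: "AE x in ?M. fin_orth \<Gamma> (img (slice q S x))"
    by (rule eventually_mono) (simp add: fin_orth_def sum_img)
  note posM = AE_interval_exists[OF q]
  obtain x\<^sub>1 where x1: "x\<^sub>1 \<in> {0..<q}" "of_nat (card (slice q S x\<^sub>1)) = complex_of_real (?m / q)"
    using posM[OF ae_card] by blast
  define p where "p = card (slice q S x\<^sub>1)"
  have p: "real p = ?m / q"
  proof -
    have "complex_of_real (real p) = of_real (?m / q)" using x1(2) unfolding p_def by simp
    then show ?thesis by (simp only: of_real_eq_iff)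
  qed
  have p1: "p \<ge> 1" using p m q by (cases p) auto
  have good: "AE x in ?M. card (slice q S x) = p \<and> fin_orth \<Gamma> (img (slice q S x))"
    using ae_card ae_fin
  proof eventually_elim
    case (elim x)
    then have "complex_of_real (real (card (slice q S x))) = of_real (real p)" unfolding p by simp
    then show ?case using elim(2) by (simp only: of_real_eq_iff of_nat_eq_iff)
  qed
  obtain K where K: "finite K" "\<And>x. x \<in> {0..<q} \<Longrightarrow> slice q S x \<subseteq> K"
    by (rule slice_finite_range[OF q S]) blast
  have card_eq: "card \<Gamma> = p"
  proof (rule ccontr)
    assume ne: "card \<Gamma> \<noteq> p"
    obtain x\<^sub>2 where x2: "x\<^sub>2 \<in> {0..<q}" "card (slice q S x\<^sub>2) = p" "fin_orth \<Gamma> (img (slice q S x\<^sub>2))"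
      using posM[OF good] by blast
    have "card \<Gamma> \<le> card (img (slice q S x\<^sub>2))"
    proof (rule fin_orth_card_le[OF finG _ _ x2(3)])
      have "finite (slice q S x\<^sub>2)" using K x2(1) finite_subset by blast
      then show "finite (img (slice q S x\<^sub>2))" by (simp add: img_def)
      show "img (slice q S x\<^sub>2) \<noteq> {}" using x2(2) p1 by (auto simp: img_def)
    qed
    then have less: "card \<Gamma> < p" using ne x2(2) card_img by simp
    \<comment> \<open>Only finitely many fibres occur, so one admissible fibre \<open>A\<close>
      occurs over a set of positive measure, where a counterexample to completeness can be
      placed.\<close>
    define X where "X A = {x \<in> {0..<q}. slice q S x = A}" for A
    have Xm: "X A \<in> sets lebesgue" for A unfolding X_def by (rule slice_level_set_measurable[OF q Sl S])
    have "\<exists>A. A \<subseteq> K \<and> card A = p \<and> fin_orth \<Gamma> (img A) \<and> X A \<notin> null_sets lebesgue"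
    proof (rule ccontr)
      assume none: "\<not> ?thesis"
      define N where "N = (\<Union>A\<in>{A. A \<subseteq> K \<and> card A = p \<and> fin_orth \<Gamma> (img A)}. X A)"
      have "N \<in> null_sets lebesgue"
        unfolding N_def
      proof (rule null_sets_UN')
        have "finite {A. A \<subseteq> K \<and> card A = p \<and> fin_orth \<Gamma> (img A)}"
          by (rule finite_subset[of _ "Pow K"]) (use K(1) in \<open>simp_all add: subset_eq\<close>)
        then show "countable {A. A \<subseteq> K \<and> card A = p \<and> fin_orth \<Gamma> (img A)}" by (rule countable_finite)
        show "X A \<in> null_sets lebesgue" if "A \<in> {A. A \<subseteq> K \<and> card A = p \<and> fin_orth \<Gamma> (img A)}" for A
          using none that by blast
      qed
      then have "AE x in lebesgue. x \<notin> N" by (rule AE_not_in)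
      then have "AE x in lebesgue. x \<in> {0..<q} \<longrightarrow> x \<notin> N" by (rule eventually_mono) blast
      then have "AE x in ?M. x \<notin> N"
        by (rule AE_restrict_space_iff[THEN iffD2, rotated]) simp
      with good have "AE x in ?M. x \<notin> N \<and> card (slice q S x) = p \<and> fin_orth \<Gamma> (img (slice q S x))"
        by eventually_elim blast
      then obtain x where "x \<in> {0..<q}" "x \<notin> N" "card (slice q S x) = p" "fin_orth \<Gamma> (img (slice q S x))"
        using posM by blast
      then show False using K(2) unfolding N_def X_def by blast
    qed
    then obtain A where A: "A \<subseteq> K" "card A = p" "fin_orth \<Gamma> (img A)" "X A \<notin> null_sets lebesgue" by blast
    have finA: "finite A" using A(1) K(1) finite_subset by blast
    obtain v where v: "\<exists>y\<in>img A. v y \<noteq> 0" "\<forall>\<gamma>\<in>\<Gamma>. (\<Sum>y\<in>img A. v y * expo (- \<gamma>) y) = 0"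
    proof -
      have "finite (img A)" unfolding img_def using finA by (rule finite_imageI)
      moreover have "card \<Gamma> < card (img A)" using less A(2) card_img[of A] by simp
      ultimately show ?thesis using fin_orth_annihilator[OF finG _ A(3)] that by blast
    qed
    define V where "V = (\<Sum>k\<in>A. (cmod (v (of_int k * q)))\<^sup>2)"
    have V: "V > 0"
    proof -
      obtain y where y: "y \<in> img A" "v y \<noteq> 0" using v(1) by blast
      then obtain k where k: "k \<in> A" "y = of_int k * q" unfolding img_def by blast
      show ?thesis unfolding V_def
      proof (rule sum_pos2[OF finA k(1)])
        show "0 < (cmod (v (of_int k * q)))\<^sup>2" using y(2) k(2) by simp
      qed simp
    qed
    \<comment> \<open>The annihilator spread over the translates of \<open>X A\<close>: nonzero on a
      set of positive measure, yet orthogonal on every fibre to all frequencies of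
      \<open>\<Lambda>\<close>.\<close>
    define f where "f y = (\<Sum>k\<in>A. v (of_int k * q) * indicator (X A) (y - of_int k * q))" for y
    have f_slice: "f (x + of_int k * q) = (if k \<in> A \<and> x \<in> X A then v (of_int k * q) else 0)"
      if x: "x \<in> {0..<q}" for x and k :: int
    proof -
      have "indicator (X A) (x + of_int k * q - of_int j * q) = (if j = k then indicator (X A) x else (0::complex))" for j :: int
      proof (cases "j = k")
        case False
        have "x + of_int k * q - of_int j * q \<notin> X A"
        proof
          assume "x + of_int k * q - of_int j * q \<in> X A"
          then have "x + of_int k * q - of_int j * q \<in> {0..<q}" unfolding X_def by blast
          from floor_slice[OF q this, of j] floor_slice[OF q x, of k] False show False by simp
        qed
        then show ?thesis using False by simp
      qed simp
      then have "f (x + of_int k * q) = (\<Sum>j\<in>A. if j = k then v (of_int k * q) * indicator (X A) x else 0)"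
        unfolding f_def by (intro sum.cong refl) auto
      then show ?thesis using finA by (simp add: indicator_def)
    qed
    have fm: "f \<in> borel_measurable (lebesgue_on S)"
    proof -
      have "(\<lambda>y. indicator (X A) (y - of_int k * q) :: complex) \<in> borel_measurable lebesgue" for k :: int
        using borel_measurable_affine[of "indicator (X A) :: real \<Rightarrow> complex" 1 "- (of_int k * q)"] Xm by simp
      then have "f \<in> borel_measurable lebesgue"
        unfolding f_def by (intro borel_measurable_sum borel_measurable_times) auto
      then show ?thesis by (rule measurable_restrict_space1)
    qed
    have f2: "square_integrable (lebesgue_on S) f"
    proof (rule square_integrable_bounded_on[OF lm fm])
      fix y assume "y \<in> S"
      show "cmod (f y) \<le> (\<Sum>k\<in>A. cmod (v (of_int k * q)))"
        unfolding f_def by (intro order_trans[OF norm_sum] sum_mono) (simp add: norm_mult indicator_def)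
    qed
    have "L2_inner (lebesgue_on S) f (expo l) = 0" if "l \<in> \<Lambda>" for l
    proof -
      define j where "j = \<lfloor>l / T\<rfloor>"
      define \<gamma> where "\<gamma> = l - of_int j * T"
      have \<gamma>: "\<gamma> \<in> \<Gamma>" unfolding \<gamma>_def j_def by (rule rep[OF that])
      \<comment> \<open>Multiples of \<open>q\<close> do not distinguish frequencies that are
        congruent modulo \<open>T\<close>.\<close>
      have e: "expo (- l) (of_int k * q) = expo (- \<gamma>) (of_int k * q)" for k :: int
      proof -
        have "- l = of_int (- j) / q + - \<gamma>" by (simp add: \<gamma>_def jq)
        then have "expo (- l) (of_int k * q) = expo (of_int (- j) / q) (0 + of_int k * q) * expo (- \<gamma>) (of_int k * q)"
          by (simp add: expo_mult)
        then show ?thesis unfolding expo_slice[OF q] by simp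
      qed
      have "fold_sum q S (\<lambda>y. f y * cnj (expo l y)) x = 0" if x: "x \<in> {0..<q}" for x
      proof (cases "x \<in> X A")
        case True
        then have "slice q S x = A" by (simp add: X_def)
        then have "fold_sum q S (\<lambda>y. f y * cnj (expo l y)) x = (\<Sum>k\<in>A. v (of_int k * q) * expo (- l) (x + of_int k * q))"
          unfolding fold_sum_def using True by (intro sum.cong) (auto simp: f_slice[OF x] cnj_expo)
        also have "\<dots> = expo (- l) x * (\<Sum>k\<in>A. v (of_int k * q) * expo (- \<gamma>) (of_int k * q))"
          by (simp only: expo_add_right e) (simp add: sum_distrib_left mult_ac)
        also have "(\<Sum>k\<in>A. v (of_int k * q) * expo (- \<gamma>) (of_int k * q)) = 0"
          using v(2) \<gamma> unfolding sum_img by blast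
        finally show ?thesis by simp
      qed (simp add: fold_sum_def f_slice[OF x])
      then have "(\<integral>x. fold_sum q S (\<lambda>y. f y * cnj (expo l y)) x \<partial>?M) = (\<integral>x. 0 \<partial>?M)"
        by (intro Bochner_Integration.integral_cong refl) simp
      then show ?thesis
        unfolding L2_inner_def using fold_sum_integral(2)[OF q Sl S integrable_inner[OF f2 square_integrable_expo[OF lm]]] by simp
    qed
    then have "L2_norm_sq (lebesgue_on S) f = 0" by (rule orthogonal_to_basis[OF basis f2])
    moreover have "L2_norm_sq (lebesgue_on S) f = V * measure lebesgue (X A)"
    proof -
      have "L2_norm_sq (lebesgue_on S) f = (\<integral>x. fold_sum q S (\<lambda>y. (cmod (f y))\<^sup>2) x \<partial>?M)"
        unfolding L2_norm_sq_def using fold_sum_integral(2)[OF q Sl S square_integrableD(2)[OF f2]] by simp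
      also have "\<dots> = (\<integral>x. V * indicator (X A) x \<partial>?M)"
      proof (intro Bochner_Integration.integral_cong refl)
        fix x assume "x \<in> space ?M"
        then have x: "x \<in> {0..<q}" by simp
        show "fold_sum q S (\<lambda>y. (cmod (f y))\<^sup>2) x = V * indicator (X A) x"
        proof (cases "x \<in> X A")
          case True
          then have "slice q S x = A" by (simp add: X_def)
          then show ?thesis using True by (simp add: fold_sum_def f_slice[OF x] V_def)
        qed (simp add: fold_sum_def f_slice[OF x])
      qed
      also have "\<dots> = V * measure ?M (X A)"
      proof -
        have "X A \<inter> {0..<q} = X A" by (auto simp: X_def)
        then show ?thesis by simp
      qed
      also have "measure ?M (X A) = measure lebesgue (X A)"
        by (rule measure_restrict_space) (auto simp: X_def)
      finally show ?thesis .
    qed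
    moreover have "measure lebesgue (X A) \<noteq> 0"
    proof -
      have "X A \<subseteq> {0..<q}" by (auto simp: X_def)
      then have "bounded (X A)" by (rule bounded_subset[rotated]) (rule bounded_subset[OF bounded_closed_interval, of _ 0 q], auto)
      then have "X A \<in> lmeasurable" using Xm[of A] by (rule bounded_set_imp_lmeasurable)
      then have "emeasure lebesgue (X A) = ennreal (measure lebesgue (X A))" by (rule emeasure_eq_measure2)
      moreover have "emeasure lebesgue (X A) \<noteq> 0"
        using A(4) Xm[of A] unfolding null_sets_def by blast
      ultimately show ?thesis by (metis ennreal_0)
    qed
    ultimately show False using V by simp
  qed
  \<comment> \<open>The conjecture asks for a set containing 0; orthogonality depends only on
    differences, so a translate serves.\<close>
  define \<Gamma>' where "\<Gamma>' = (\<lambda>\<gamma>. \<gamma> - \<gamma>\<^sub>0) ` \<Gamma>"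
  have orth': "fin_orth \<Gamma>' Y" if "fin_orth \<Gamma> Y" for Y
    unfolding fin_orth_def
  proof (intro ballI impI)
    fix x x' assume "x \<in> \<Gamma>'" "x' \<in> \<Gamma>'" "x \<noteq> x'"
    then obtain a b where ab: "a \<in> \<Gamma>" "b \<in> \<Gamma>" "x = a - \<gamma>\<^sub>0" "x' = b - \<gamma>\<^sub>0" unfolding \<Gamma>'_def by blast
    with \<open>x \<noteq> x'\<close> have "a \<noteq> b" by blast
    then have "(\<Sum>y\<in>Y. expo (a - b) y) = 0" using that ab(1,2) unfolding fin_orth_def by blast
    then show "(\<Sum>y\<in>Y. expo (x - x') y) = 0" by (simp add: ab(3,4))
  qed
  have "AE x in ?M. card (slice q S x) = p \<and> fin_orth \<Gamma>' (img (slice q S x))"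
    using good
  proof eventually_elim
    case (elim x)
    then show ?case using orth'[of "img (slice q S x)"] by simp
  qed
  moreover have "finite \<Gamma>'" unfolding \<Gamma>'_def using finG by (rule finite_imageI)
  moreover have "0 \<in> \<Gamma>'" unfolding \<Gamma>'_def by (rule image_eqI[OF _ g0]) simp
  moreover have "card \<Gamma>' = p"
    unfolding \<Gamma>'_def using card_eq by (subst card_image) (simp_all add: inj_on_def)
  moreover have "real p = ?m * T" using p by (simp add: q_def)
  ultimately have "p \<ge> 1 \<and> real p = ?m * T \<and> finite \<Gamma>' \<and> card \<Gamma>' = p \<and> 0 \<in> \<Gamma>' \<and>
    (AE x in ?M. card (slice q S x) = p \<and> fin_orth \<Gamma>' (img (slice q S x)))"
    using p1 by (intro conjI)
  then show ?thesis unfolding q_def img_def by blast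
qed

text \<open>Fibrewise inversion: \<open>\<Gamma>\<close> and each fibre have \<open>p\<close>
  elements, so orthogonality is symmetric and \<open>f\<close> on a fibre is recovered from its
  \<open>p\<close> coefficients \<open>\<Phi> \<gamma>\<close>. These are functions on
  \<open>[0, q)\<close>, approximated there by trigonometric polynomials, whose frequencies
  \<open>j / q\<close> added to those of \<open>\<Gamma>\<close> form the spectrum.\<close>

theorem spectrum_of_slices:
  assumes q: "q > 0" and S: "S \<in> lmeasurable" "bounded S"
    and \<Gamma>: "finite \<Gamma>" "card \<Gamma> = p" "p > 0"
    and slices: "\<And>x. x \<in> {0..<q} \<Longrightarrow> finite (slice q S x) \<and> card (slice q S x) = p \<and>
      fin_orth \<Gamma> ((\<lambda>k. of_int k * q) ` slice q S x)"
  shows "is_spectrum S ((\<lambda>(\<gamma>, j::int). \<gamma> + of_int j / q) ` (\<Gamma> \<times> UNIV))"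
proof -
  let ?M = "lebesgue_on {0..<q}" and ?S = "lebesgue_on S"
  have lm: "{0..<q} \<in> lmeasurable" by (intro bounded_set_imp_lmeasurable) auto
  have Sl: "S \<in> sets lebesgue" using S by (simp add: fmeasurableD)
  define h where "h = (\<lambda>(\<gamma>, j::int). \<gamma> + of_int j / q)"
  have h: "h (\<gamma>, j) = \<gamma> + of_int j / q" for \<gamma> j by (simp add: h_def)
  have expo_h: "expo (h (\<gamma>, j)) x = expo (of_int j / q) x * expo \<gamma> x" for \<gamma> j x
    by (simp add: h expo_mult add.commute)
  define img where "img x = (\<lambda>k::int. of_int k * q) ` slice q S x" for x
  have sum_img: "(\<Sum>y\<in>img x. f y) = (\<Sum>k\<in>slice q S x. f (of_int k * q))" for x and f :: "real \<Rightarrow> complex"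
    unfolding img_def using q by (subst sum.reindex) (auto simp: inj_on_def)
  have card_img: "card (img x) = card (slice q S x)" for x
    unfolding img_def using q by (intro card_image) (auto simp: inj_on_def)
  have fin: "finite (slice q S x)" and card_slice: "card (slice q S x) = p" and orth: "fin_orth \<Gamma> (img x)"
    if "x \<in> {0..<q}" for x using slices[OF that] by (simp_all add: img_def)
  have dual: "fin_orth (img x) \<Gamma>" if "x \<in> {0..<q}" for x
  proof (rule fin_orth_sym[OF \<Gamma>(1) _ _ orth[OF that]])
    show "finite (img x)" unfolding img_def using fin[OF that] by (rule finite_imageI)
    show "card \<Gamma> = card (img x)" using \<Gamma>(2) card_img card_slice[OF that] by simp
  qed
  have int_expo: "integrable ?S (expo l)" for l
    by (rule finite_measure.integrable_const_bound[OF finite_measure_lebesgue_on[OF S(1)], of _ 1]) auto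
  have transform: "ind_transform S (\<theta> + of_int j / q) = (\<integral>x. expo (of_int j / q) x * (expo \<theta> x * (\<Sum>y\<in>img x. expo \<theta> y)) \<partial>?M)"
    for \<theta> and j :: int
  proof -
    have "fold_sum q S (expo (\<theta> + of_int j / q)) x = expo (of_int j / q) x * (expo \<theta> x * (\<Sum>y\<in>img x. expo \<theta> y))" for x
    proof -
      have "fold_sum q S (expo (\<theta> + of_int j / q)) x = (\<Sum>k\<in>slice q S x. expo \<theta> (x + of_int k * q) * expo (of_int j / q) x)"
        unfolding fold_sum_def by (intro sum.cong refl) (simp only: expo_mult[symmetric] expo_slice[OF q])
      then show ?thesis by (simp only: sum_img expo_add_right sum_distrib_left mult_ac)
    qed
    then have "fold_sum q S (expo (\<theta> + of_int j / q)) = (\<lambda>x. expo (of_int j / q) x * (expo \<theta> x * (\<Sum>y\<in>img x. expo \<theta> y)))"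
      by blast
    then show ?thesis
      using fold_sum_integral(2)[OF q Sl S(2) int_expo, of "\<theta> + of_int j / q"] by (simp only: ind_transform_def)
  qed
  have tr_same: "ind_transform S (of_int j / q) = of_nat p * (\<integral>x. expo (of_int j / q) x \<partial>?M)" for j :: int
  proof -
    have "ind_transform S (0 + of_int j / q) = (\<integral>x. of_nat p * expo (of_int j / q) x \<partial>?M)"
      unfolding transform
    proof (intro Bochner_Integration.integral_cong refl)
      fix x assume "x \<in> space ?M"
      then have "x \<in> {0..<q}" by simp
      then show "expo (of_int j / q) x * (expo 0 x * (\<Sum>y\<in>img x. expo 0 y)) = of_nat p * expo (of_int j / q) x"
        by (simp add: card_img card_slice)
    qed
    then show ?thesis by simp
  qed
  have measure_S: "complex_of_real (measure lebesgue S) = of_nat p * of_real q"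
    using tr_same[of 0] q by (simp add: ind_transform_0[OF S(1)] measure_restrict_space scaleR_conv_of_real)
  then have "complex_of_real (measure lebesgue S) = of_real (real p * q)" by simp
  then have m: "measure lebesgue S = real p * q" by (simp only: of_real_eq_iff)
  have m0: "measure lebesgue S > 0" using m q \<Gamma>(3) by simp
  have tr_diff: "ind_transform S ((\<gamma> - \<gamma>') + of_int j / q) = 0" if "\<gamma> \<in> \<Gamma>" "\<gamma>' \<in> \<Gamma>" "\<gamma> \<noteq> \<gamma>'" for \<gamma> \<gamma>' and j :: int
  proof -
    have "ind_transform S ((\<gamma> - \<gamma>') + of_int j / q) = (\<integral>x. 0 \<partial>?M)"
      unfolding transform
    proof (intro Bochner_Integration.integral_cong refl)
      fix x assume "x \<in> space ?M"
      then have "x \<in> {0..<q}" by simp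
      then have "(\<Sum>y\<in>img x. expo (\<gamma> - \<gamma>') y) = 0" using orth that unfolding fin_orth_def by blast
      then show "expo (of_int j / q) x * (expo (\<gamma> - \<gamma>') x * (\<Sum>y\<in>img x. expo (\<gamma> - \<gamma>') y)) = 0" by simp
    qed
    then show ?thesis by simp
  qed
  have h_orth: "ind_transform S (h a - h b) = 0" if ab: "a \<in> \<Gamma> \<times> UNIV" "b \<in> \<Gamma> \<times> UNIV" "a \<noteq> b" for a b
  proof -
    obtain \<gamma> j \<gamma>' j' where eq: "a = (\<gamma>, j)" "b = (\<gamma>', j')" by (cases a, cases b)
    have d: "h a - h b = (\<gamma> - \<gamma>') + of_int (j - j') / q"
      by (simp add: eq h diff_divide_distrib)
    show ?thesis
    proof (cases "\<gamma> = \<gamma>'")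
      case True
      then have "j - j' \<noteq> 0" using ab(3) eq by simp
      then show ?thesis unfolding d True using tr_same[of "j - j'"] integral_expo_period[OF q, of "j - j'"] by simp
    next
      case False
      then show ?thesis unfolding d using ab eq by (intro tr_diff) auto
    qed
  qed
  \<comment> \<open>Two pairs with the same frequency would make the transform vanish at 0, where it
    is the measure of \<open>S\<close>.\<close>
  have h_inj: "inj_on h (\<Gamma> \<times> UNIV)"
  proof (rule inj_onI, rule ccontr)
    fix a b assume "a \<in> \<Gamma> \<times> UNIV" "b \<in> \<Gamma> \<times> UNIV" "h a = h b" "a \<noteq> b"
    then have "ind_transform S 0 = 0" using h_orth[of a b] by simp
    then show False using m0 by (simp add: ind_transform_0[OF S(1)])
  qed
  have complete: "\<exists>F c. finite F \<and> F \<subseteq> h ` (\<Gamma> \<times> UNIV) \<and>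
      L2_norm_sq ?S (\<lambda>y. f y - (\<Sum>i\<in>F. c i * expo i y)) < \<epsilon>"
    if f: "square_integrable ?S f" and \<epsilon>: "\<epsilon> > 0" for f \<epsilon>
  proof -
    define \<Phi> where "\<Phi> \<gamma> = fold_sum q S (\<lambda>y. f y * cnj (expo \<gamma> y))" for \<gamma>
    have \<Phi>_bound: "(cmod (\<Phi> \<gamma> x))\<^sup>2 \<le> p * fold_sum q S (\<lambda>y. (cmod (f y))\<^sup>2) x" if x: "x \<in> {0..<q}" for \<gamma> x
    proof -
      have "cmod (\<Phi> \<gamma> x) \<le> (\<Sum>k\<in>slice q S x. cmod (f (x + of_int k * q)))"
        unfolding \<Phi>_def fold_sum_def by (intro order_trans[OF norm_sum] sum_mono) (simp add: norm_mult)
      then have "(cmod (\<Phi> \<gamma> x))\<^sup>2 \<le> (\<Sum>k\<in>slice q S x. cmod (f (x + of_int k * q)))\<^sup>2"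
        by (rule power_mono) simp
      also have "\<dots> \<le> card (slice q S x) * (\<Sum>k\<in>slice q S x. (cmod (f (x + of_int k * q)))\<^sup>2)"
        by (subst mult.commute) (rule sum_squared_le_sum_of_squares)
      finally show ?thesis unfolding fold_sum_def card_slice[OF x] .
    qed
    have \<Phi>: "square_integrable ?M (\<Phi> \<gamma>)" for \<gamma>
      unfolding square_integrable_def
    proof
      have "integrable ?M (\<Phi> \<gamma>)"
        unfolding \<Phi>_def by (intro fold_sum_integral(1)[OF q Sl S(2)] integrable_inner f square_integrable_expo S)
      then show m: "\<Phi> \<gamma> \<in> borel_measurable ?M" by auto
      have "integrable ?M (\<lambda>x. p * fold_sum q S (\<lambda>y. (cmod (f y))\<^sup>2) x)"
        using fold_sum_integral(1)[OF q Sl S(2) square_integrableD(2)[OF f]] by simp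
      then show "integrable ?M (\<lambda>x. (cmod (\<Phi> \<gamma> x))\<^sup>2)"
      proof (rule Bochner_Integration.integrable_bound)
        show "(\<lambda>x. (cmod (\<Phi> \<gamma> x))\<^sup>2) \<in> borel_measurable ?M" using m by measurable
        show "AE x in ?M. norm ((cmod (\<Phi> \<gamma> x))\<^sup>2) \<le> norm (p * fold_sum q S (\<lambda>y. (cmod (f y))\<^sup>2) x)"
        proof (rule AE_I2)
          fix x assume "x \<in> space ?M"
          then have "x \<in> {0..<q}" by simp
          from \<Phi>_bound[OF this, of \<gamma>] show "norm ((cmod (\<Phi> \<gamma> x))\<^sup>2) \<le> norm (p * fold_sum q S (\<lambda>y. (cmod (f y))\<^sup>2) x)"
            by simp
        qed
      qed
    qed
    have "trig_approximable q {0..<0 + q} (\<Phi> \<gamma>)" for \<gamma>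
      by (rule trig_approximable_square_integrable[OF q]) (use \<Phi> in simp)
    then have tr: "trig_approximable q {0..<q} (\<Phi> \<gamma>)" for \<gamma> by simp
    \<comment> \<open>The divisor \<open>p + 1\<close> keeps the sum of \<open>p\<close> errors
      strictly below \<open>\<epsilon>\<close>.\<close>
    define \<eta> where "\<eta> = \<epsilon> / (p + 1)"
    have \<eta>: "\<eta> > 0" using \<epsilon> by (simp add: \<eta>_def)
    have "\<forall>\<gamma>. \<exists>P. trig_poly q P \<and> L2_norm_sq ?M (\<lambda>x. \<Phi> \<gamma> x - P x) < \<eta>"
      using tr \<eta> unfolding trig_approximable_def by blast
    then obtain P where P: "\<And>\<gamma>. trig_poly q (P \<gamma>)" "\<And>\<gamma>. L2_norm_sq ?M (\<lambda>x. \<Phi> \<gamma> x - P \<gamma> x) < \<eta>" by metis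
    have "\<forall>\<gamma>. \<exists>J c. finite J \<and> P \<gamma> = (\<lambda>x. \<Sum>k\<in>J. c k * expo (of_int k / q) x)"
      using trig_poly_sum[OF P(1)] by metis
    then obtain J c where J: "\<And>\<gamma>. finite (J \<gamma>)" "\<And>\<gamma>. P \<gamma> = (\<lambda>x. \<Sum>k\<in>J \<gamma>. c \<gamma> k * expo (of_int k / q) x)" by metis
    define D where "D = Sigma \<Gamma> J"
    have D: "finite D" "D \<subseteq> \<Gamma> \<times> UNIV" using \<Gamma>(1) J(1) by (auto simp: D_def)
    \<comment> \<open>The basis is indexed by the frequencies themselves, so coefficients indexed by
      pairs are carried over through the inverse of \<open>h\<close>.\<close>
    define C where "C l = (case the_inv_into (\<Gamma> \<times> UNIV) h l of (\<gamma>, j) \<Rightarrow> c \<gamma> j / of_nat p)" for l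
    define Q where "Q y = (\<Sum>i\<in>h ` D. C i * expo i y)" for y
    have Q: "Q y = (\<Sum>\<gamma>\<in>\<Gamma>. P \<gamma> y * expo \<gamma> y) / of_nat p" for y
    proof -
      have "Q y = (\<Sum>a\<in>D. C (h a) * expo (h a) y)"
        unfolding Q_def using inj_on_subset[OF h_inj D(2)] by (subst sum.reindex) auto
      also have "\<dots> = (\<Sum>(\<gamma>, j)\<in>Sigma \<Gamma> J. c \<gamma> j / of_nat p * (expo (of_int j / q) y * expo \<gamma> y))"
        unfolding D_def
      proof (intro sum.cong refl)
        fix a assume a: "a \<in> Sigma \<Gamma> J"
        obtain \<gamma> j where eq: "a = (\<gamma>, j)" by (cases a)
        have "the_inv_into (\<Gamma> \<times> UNIV) h (h a) = a"
          using a by (intro the_inv_into_f_f[OF h_inj]) auto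
        then have "C (h a) = c \<gamma> j / of_nat p" unfolding C_def by (simp add: eq)
        then show "C (h a) * expo (h a) y = (case a of (\<gamma>, j) \<Rightarrow> c \<gamma> j / of_nat p * (expo (of_int j / q) y * expo \<gamma> y))"
          by (simp add: eq expo_h)
      qed
      also have "\<dots> = (\<Sum>\<gamma>\<in>\<Gamma>. \<Sum>j\<in>J \<gamma>. c \<gamma> j / of_nat p * (expo (of_int j / q) y * expo \<gamma> y))"
        using \<Gamma>(1) J(1) by (subst sum.Sigma) auto
      also have "\<dots> = (\<Sum>\<gamma>\<in>\<Gamma>. P \<gamma> y * expo \<gamma> y / of_nat p)"
        by (intro sum.cong refl) (simp add: J(2) sum_distrib_left sum_distrib_right sum_divide_distrib mult_ac)
      finally show ?thesis by (simp add: sum_divide_distrib)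
    qed
    have inversion: "f (x + of_int k * q) = (\<Sum>\<gamma>\<in>\<Gamma>. \<Phi> \<gamma> x * expo \<gamma> (x + of_int k * q)) / of_nat p"
      if x: "x \<in> {0..<q}" and k: "k \<in> slice q S x" for x and k :: int
    proof -
      let ?y = "\<lambda>k::int. x + of_int k * q"
      have "(\<Sum>\<gamma>\<in>\<Gamma>. \<Phi> \<gamma> x * expo \<gamma> (?y k)) = (\<Sum>\<gamma>\<in>\<Gamma>. \<Sum>k'\<in>slice q S x. f (?y k') * (expo \<gamma> (?y k) * cnj (expo \<gamma> (?y k'))))"
        by (simp add: \<Phi>_def fold_sum_def sum_distrib_left sum_distrib_right mult_ac)
      also have "\<dots> = (\<Sum>k'\<in>slice q S x. f (?y k') * (\<Sum>\<gamma>\<in>\<Gamma>. expo \<gamma> (?y k) * cnj (expo \<gamma> (?y k'))))"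
        by (subst sum.swap) (simp add: sum_distrib_left)
      also have "\<dots> = (\<Sum>k'\<in>slice q S x. if k' = k then f (?y k) * of_nat p else 0)"
      proof (intro sum.cong refl)
        fix k' assume k': "k' \<in> slice q S x"
        have "(\<Sum>\<gamma>\<in>\<Gamma>. expo \<gamma> (?y k) * cnj (expo \<gamma> (?y k'))) = (\<Sum>\<gamma>\<in>\<Gamma>. expo (of_int k * q - of_int k' * q) \<gamma>)"
          by (simp add: expo_commute[of _ "_ + _"] expo_mult_cnj)
        also have "\<dots> = (if k' = k then of_nat p else 0)"
        proof (cases "k' = k")
          case False
          then have "of_int k * q \<noteq> of_int k' * q" using q by simp
          moreover have "of_int k * q \<in> img x" "of_int k' * q \<in> img x" using k k' by (auto simp: img_def)
          ultimately show ?thesis using dual[OF x] False unfolding fin_orth_def by simp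
        qed (simp add: \<Gamma>(2))
        finally show "f (?y k') * (\<Sum>\<gamma>\<in>\<Gamma>. expo \<gamma> (?y k) * cnj (expo \<gamma> (?y k'))) = (if k' = k then f (?y k) * of_nat p else 0)"
          by simp
      qed
      also have "\<dots> = f (?y k) * of_nat p" using fin[OF x] k by simp
      finally show ?thesis using \<Gamma>(3) by simp
    qed
    have Qsq: "square_integrable ?S Q" unfolding Q_def by (rule square_integrable_trig[OF S(1)])
    have fQ: "square_integrable ?S (\<lambda>y. f y - Q y)" by (rule square_integrable_diff[OF f Qsq])
    have "L2_norm_sq ?S (\<lambda>y. f y - Q y) = (\<integral>x. fold_sum q S (\<lambda>y. (cmod (f y - Q y))\<^sup>2) x \<partial>?M)"
      unfolding L2_norm_sq_def using fold_sum_integral(2)[OF q Sl S(2) square_integrableD(2)[OF fQ]] by simp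
    also have "\<dots> \<le> (\<integral>x. (\<Sum>\<gamma>\<in>\<Gamma>. (cmod (\<Phi> \<gamma> x - P \<gamma> x))\<^sup>2) \<partial>?M)"
    proof (rule integral_mono)
      show "integrable ?M (fold_sum q S (\<lambda>y. (cmod (f y - Q y))\<^sup>2))"
        by (rule fold_sum_integral(1)[OF q Sl S(2) square_integrableD(2)[OF fQ]])
      show "integrable ?M (\<lambda>x. \<Sum>\<gamma>\<in>\<Gamma>. (cmod (\<Phi> \<gamma> x - P \<gamma> x))\<^sup>2)"
        using square_integrable_diff[OF \<Phi> square_integrable_trig_poly[OF P(1) lm]]
        by (intro Bochner_Integration.integrable_sum) (simp add: square_integrable_def)
      fix x assume "x \<in> space ?M"
      then have x: "x \<in> {0..<q}" by simp
      let ?y = "\<lambda>k::int. x + of_int k * q"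
      have "(cmod (f (?y k) - Q (?y k)))\<^sup>2 \<le> (\<Sum>\<gamma>\<in>\<Gamma>. (cmod (\<Phi> \<gamma> x - P \<gamma> x))\<^sup>2) / p" if k: "k \<in> slice q S x" for k
      proof -
        \<comment> \<open>\<open>P \<gamma>\<close> has period \<open>q\<close>, so its value at
          \<open>x\<close> serves the whole fibre; each of the \<open>p\<close> points then carries
          at most a share \<open>1 / p\<close> of the total error.\<close>
        have "P \<gamma> (?y k) = P \<gamma> x" for \<gamma> using trig_poly_periodic[OF P(1)] q by simp
        then have "f (?y k) - Q (?y k) = (\<Sum>\<gamma>\<in>\<Gamma>. (\<Phi> \<gamma> x - P \<gamma> x) * expo \<gamma> (?y k)) / of_nat p"
          unfolding Q inversion[OF x k] by (simp add: left_diff_distrib sum_subtractf diff_divide_distrib)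
        then have "cmod (f (?y k) - Q (?y k)) = cmod (\<Sum>\<gamma>\<in>\<Gamma>. (\<Phi> \<gamma> x - P \<gamma> x) * expo \<gamma> (?y k)) / p"
          by (simp add: norm_divide)
        also have "\<dots> \<le> (\<Sum>\<gamma>\<in>\<Gamma>. cmod (\<Phi> \<gamma> x - P \<gamma> x)) / p"
          by (intro divide_right_mono order_trans[OF norm_sum] sum_mono) (auto simp: norm_mult)
        finally have "(cmod (f (?y k) - Q (?y k)))\<^sup>2 \<le> ((\<Sum>\<gamma>\<in>\<Gamma>. cmod (\<Phi> \<gamma> x - P \<gamma> x)) / p)\<^sup>2"
          by (rule power_mono) simp
        also have "\<dots> \<le> (card \<Gamma> * (\<Sum>\<gamma>\<in>\<Gamma>. (cmod (\<Phi> \<gamma> x - P \<gamma> x))\<^sup>2)) / (real p)\<^sup>2"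
          unfolding power_divide mult.commute[of "real (card \<Gamma>)"]
          by (intro divide_right_mono sum_squared_le_sum_of_squares) simp
        also have "\<dots> = (\<Sum>\<gamma>\<in>\<Gamma>. (cmod (\<Phi> \<gamma> x - P \<gamma> x))\<^sup>2) / p"
          unfolding \<Gamma>(2) by (simp add: power2_eq_square)
        finally show ?thesis .
      qed
      then have "fold_sum q S (\<lambda>y. (cmod (f y - Q y))\<^sup>2) x \<le> (\<Sum>k\<in>slice q S x. (\<Sum>\<gamma>\<in>\<Gamma>. (cmod (\<Phi> \<gamma> x - P \<gamma> x))\<^sup>2) / p)"
        unfolding fold_sum_def by (rule sum_mono)
      also have "\<dots> = (\<Sum>\<gamma>\<in>\<Gamma>. (cmod (\<Phi> \<gamma> x - P \<gamma> x))\<^sup>2)"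
        using \<Gamma>(3) by (simp add: card_slice[OF x])
      finally show "fold_sum q S (\<lambda>y. (cmod (f y - Q y))\<^sup>2) x \<le> (\<Sum>\<gamma>\<in>\<Gamma>. (cmod (\<Phi> \<gamma> x - P \<gamma> x))\<^sup>2)" .
    qed
    also have "\<dots> = (\<Sum>\<gamma>\<in>\<Gamma>. L2_norm_sq ?M (\<lambda>x. \<Phi> \<gamma> x - P \<gamma> x))"
      unfolding L2_norm_sq_def
      using square_integrable_diff[OF \<Phi> square_integrable_trig_poly[OF P(1) lm]]
      by (intro Bochner_Integration.integral_sum) (simp add: square_integrable_def)
    also have "\<dots> \<le> (\<Sum>\<gamma>\<in>\<Gamma>. \<eta>)" using P(2) by (intro sum_mono less_imp_le)
    also have "\<dots> < \<epsilon>" using \<epsilon> \<Gamma>(2) by (simp add: \<eta>_def field_simps)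
    finally have "L2_norm_sq ?S (\<lambda>y. f y - Q y) < \<epsilon>" .
    then show ?thesis
      using D unfolding Q_def by (intro exI[of _ "h ` D"] exI[of _ C]) auto
  qed
  have "L2_orthogonal_basis ?S (h ` (\<Gamma> \<times> UNIV)) expo"
    unfolding L2_orthogonal_basis_def
  proof (intro conjI ballI allI impI)
    fix l assume "l \<in> h ` (\<Gamma> \<times> UNIV)"
    show "square_integrable ?S (expo l)" by (rule square_integrable_expo[OF S(1)])
    show "L2_inner ?S (expo l) (expo l) \<noteq> 0" using m0 by (simp add: L2_inner_expo ind_transform_0[OF S(1)])
  next
    show "pairwise (\<lambda>i j. L2_inner ?S (expo i) (expo j) = 0) (h ` (\<Gamma> \<times> UNIV))"
      unfolding pairwise_def L2_inner_expo using h_orth by blast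
  next
    fix f and \<epsilon> :: real assume "square_integrable ?S f" "0 < \<epsilon>"
    from complete[OF this] show "\<exists>F c. finite F \<and> F \<subseteq> h ` (\<Gamma> \<times> UNIV) \<and>
        (\<integral>x. (cmod (f x - (\<Sum>i\<in>F. c i * expo i x)))\<^sup>2 \<partial>?S) < \<epsilon>"
      unfolding L2_norm_sq_def .
  qed
  then show ?thesis using S(1) m0 unfolding is_spectrum_def h_def by blast
qed

section \<open>The Universal Tiling Conjecture implies tiling\<close>

lemma dirac_sum_eq_distr:
  assumes "finite A"
  shows "dirac_sum A = distr (count_space A) borel (\<lambda>x. x)"
proof (rule measure_eqI)
  fix B assume "B \<in> sets (dirac_sum A)"
  then have B: "B \<in> sets borel" by simp
  have "emeasure (distr (count_space A) borel (\<lambda>x. x)) B = emeasure (count_space A) (B \<inter> A)"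
    using B by (subst emeasure_distr) auto
  also have "\<dots> = of_nat (card (B \<inter> A))"
    using assms by (subst emeasure_count_space_finite) auto
  also have "\<dots> = (\<Sum>a\<in>A. indicator B a)"
    using assms by (simp add: indicator_def sum.If_cases Int_commute)
  finally show "emeasure (dirac_sum A) B = emeasure (distr (count_space A) borel (\<lambda>x. x)) B"
    using B by (simp add: emeasure_dirac_sum)
qed simp

lemma dirac_sum_integral:
  fixes f :: "real \<Rightarrow> 'b::{banach, second_countable_topology}"
  assumes "finite A" "f \<in> borel_measurable borel"
  shows "integrable (dirac_sum A) f" "integral\<^sup>L (dirac_sum A) f = (\<Sum>a\<in>A. f a)"
proof -
  show "integrable (dirac_sum A) f"
    unfolding dirac_sum_eq_distr[OF assms(1)] using assms
    by (subst integrable_distr_eq) (auto intro: integrable_count_space)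
  show "integral\<^sup>L (dirac_sum A) f = (\<Sum>a\<in>A. f a)"
    unfolding dirac_sum_eq_distr[OF assms(1)] using assms
    by (subst integral_distr) (auto simp: lebesgue_integral_count_space_finite)
qed

lemma square_integrable_dirac_sum:
  assumes "finite A"
  shows "square_integrable (dirac_sum A) f \<longleftrightarrow> f \<in> borel_measurable borel"
proof -
  have "borel_measurable (dirac_sum A) = (borel_measurable borel :: (real \<Rightarrow> complex) set)"
    by (rule measurable_cong_sets) auto
  moreover have "integrable (dirac_sum A) (\<lambda>x. (cmod (f x))\<^sup>2)" if "f \<in> borel_measurable borel"
  proof (rule dirac_sum_integral(1)[OF assms])
    show "(\<lambda>x. (cmod (f x))\<^sup>2) \<in> borel_measurable borel" using that by measurable
  qed
  ultimately show ?thesis by (auto simp: square_integrable_def)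
qed

lemma L2_inner_dirac_sum:
  assumes "finite A" "f \<in> borel_measurable borel" "g \<in> borel_measurable borel"
  shows "L2_inner (dirac_sum A) f g = (\<Sum>a\<in>A. f a * cnj (g a))"
  unfolding L2_inner_def using assms borel_measurable_cnj_comp[OF assms(3)]
  by (intro dirac_sum_integral) auto

text \<open>Completeness over a finite set is a dimension count: with fewer characters than points
  \<open>fin_orth_annihilator\<close> gives a nonzero function orthogonal to all of them, and with
  equal numbers the dual relations invert the transform exactly.\<close>

theorem is_finite_spectrum_iff:
  assumes A: "finite A" "A \<noteq> {}"
  shows "is_finite_spectrum A Y \<longleftrightarrow> finite Y \<and> card Y = card A \<and> fin_orth Y A"
proof -
  have inner: "L2_inner (dirac_sum A) (expo y) (expo y') = (\<Sum>a\<in>A. expo (y - y') a)" for y y'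
    unfolding L2_inner_dirac_sum[OF A(1) measurable_expo measurable_expo] expo_mult_cnj ..
  show ?thesis
  proof
    assume "is_finite_spectrum A Y"
    then have Y: "finite Y" and basis: "L2_orthogonal_basis (dirac_sum A) Y expo"
      by (auto simp: is_finite_spectrum_def)
    have orth: "fin_orth Y A"
      unfolding fin_orth_def inner[symmetric] using basis_orthogonal[OF basis] by blast
    have "card Y \<le> card A" by (rule fin_orth_card_le[OF Y A orth])
    moreover have "\<not> card Y < card A"
    proof
      assume "card Y < card A"
      then obtain v where v: "\<exists>a\<in>A. v a \<noteq> 0" "\<forall>y\<in>Y. (\<Sum>a\<in>A. v a * expo (- y) a) = 0"
        using fin_orth_annihilator[OF Y A(1) orth] by blast
      \<comment> \<open>Extension of \<open>v\<close> from \<open>A\<close> to a measurable function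
        on the line.\<close>
      define f where "f x = (\<Sum>a\<in>A. v a * indicator {a} x)" for x
      have fa: "f a = v a" if "a \<in> A" for a
      proof -
        have "f a = (\<Sum>b\<in>A. if b = a then v a else 0)"
          unfolding f_def by (intro sum.cong refl) (auto simp: indicator_def)
        then show ?thesis using A(1) that by simp
      qed
      have fm: "f \<in> borel_measurable borel" unfolding f_def by measurable
      have "L2_inner (dirac_sum A) f (expo y) = 0" if "y \<in> Y" for y
      proof -
        have "L2_inner (dirac_sum A) f (expo y) = (\<Sum>a\<in>A. v a * expo (- y) a)"
          unfolding L2_inner_dirac_sum[OF A(1) fm measurable_expo]
          by (intro sum.cong refl) (simp add: fa cnj_expo)
        then show ?thesis using v(2) that by simp
      qed
      then have "L2_norm_sq (dirac_sum A) f = 0"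
        using fm A(1) by (intro orthogonal_to_basis[OF basis]) (simp_all add: square_integrable_dirac_sum)
      moreover have "L2_norm_sq (dirac_sum A) f = (\<Sum>a\<in>A. (cmod (f a))\<^sup>2)"
        unfolding L2_norm_sq_def
      proof (rule dirac_sum_integral(2)[OF A(1)])
        show "(\<lambda>x. (cmod (f x))\<^sup>2) \<in> borel_measurable borel" using fm by measurable
      qed
      ultimately have "\<forall>a\<in>A. (cmod (f a))\<^sup>2 = 0"
        by (simp only: sum_nonneg_eq_0_iff[OF A(1) zero_le_power2])
      then have "f a = 0" if "a \<in> A" for a using that by simp
      moreover obtain a where "a \<in> A" "v a \<noteq> 0" using v(1) by blast
      ultimately show False using fa[of a] by simp
    qed
    ultimately show "finite Y \<and> card Y = card A \<and> fin_orth Y A" using Y orth by simp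
  next
    assume Y: "finite Y \<and> card Y = card A \<and> fin_orth Y A"
    then have dual: "fin_orth A Y" using fin_orth_sym[of Y A] A(1) by blast
    have "L2_orthogonal_basis (dirac_sum A) Y expo"
      unfolding L2_orthogonal_basis_def
    proof (intro conjI ballI allI impI)
      fix y assume "y \<in> Y"
      show "square_integrable (dirac_sum A) (expo y)" using A(1) by (simp add: square_integrable_dirac_sum)
      show "L2_inner (dirac_sum A) (expo y) (expo y) \<noteq> 0" using A by (simp add: inner)
    next
      show "pairwise (\<lambda>i j. L2_inner (dirac_sum A) (expo i) (expo j) = 0) Y"
        using Y unfolding pairwise_def inner fin_orth_def by blast
    next
      fix f and \<epsilon> :: real assume f: "square_integrable (dirac_sum A) f" and \<epsilon>: "0 < \<epsilon>"
      have fm [measurable]: "f \<in> borel_measurable borel" using f A(1) by (simp add: square_integrable_dirac_sum)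
      define c where "c y = (\<Sum>a\<in>A. f a * cnj (expo y a)) / of_nat (card A)" for y
      have eq: "(\<Sum>y\<in>Y. c y * expo y b) = f b" if b: "b \<in> A" for b
      proof -
        have "(\<Sum>y\<in>Y. c y * expo y b) = (\<Sum>y\<in>Y. \<Sum>a\<in>A. f a * (expo y b * cnj (expo y a))) / of_nat (card A)"
          unfolding c_def sum_divide_distrib sum_distrib_right
          by (intro sum.cong refl) (simp add: mult_ac)
        also have "(\<Sum>y\<in>Y. \<Sum>a\<in>A. f a * (expo y b * cnj (expo y a))) = (\<Sum>a\<in>A. f a * (\<Sum>y\<in>Y. expo (b - a) y))"
        proof -
          have "expo y b * cnj (expo y a) = expo (b - a) y" for a y
            unfolding expo_commute[of y b] expo_commute[of y a] by (rule expo_mult_cnj)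
          then have "(\<Sum>y\<in>Y. \<Sum>a\<in>A. f a * (expo y b * cnj (expo y a))) = (\<Sum>y\<in>Y. \<Sum>a\<in>A. f a * expo (b - a) y)"
            by (simp only:)
          also have "\<dots> = (\<Sum>a\<in>A. \<Sum>y\<in>Y. f a * expo (b - a) y)" by (rule sum.swap)
          finally show ?thesis by (simp only: sum_distrib_left)
        qed
        also have "\<dots> = (\<Sum>a\<in>A. if a = b then f b * of_nat (card A) else 0)"
        proof (intro sum.cong refl)
          fix a assume a: "a \<in> A"
          show "f a * (\<Sum>y\<in>Y. expo (b - a) y) = (if a = b then f b * of_nat (card A) else 0)"
          proof (cases "a = b")
            case True
            moreover have "card Y = card A" using Y by blast
            ultimately show ?thesis by simp
          next
            case False
            then have "b \<noteq> a" by simp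
            then have "(\<Sum>y\<in>Y. expo (b - a) y) = 0" using dual[unfolded fin_orth_def] a b by simp
            then show ?thesis using False by simp
          qed
        qed
        also have "\<dots> = f b * of_nat (card A)" using A(1) b by simp
        finally show ?thesis using A by simp
      qed
      have "(\<integral>x. (cmod (f x - (\<Sum>i\<in>Y. c i * expo i x)))\<^sup>2 \<partial>dirac_sum A) = (\<Sum>a\<in>A. (cmod (f a - (\<Sum>i\<in>Y. c i * expo i a)))\<^sup>2)"
      proof (rule dirac_sum_integral(2)[OF A(1)])
        show "(\<lambda>x. (cmod (f x - (\<Sum>i\<in>Y. c i * expo i x)))\<^sup>2) \<in> borel_measurable borel" by measurable
      qed
      also have "\<dots> = 0" by (intro sum.neutral) (simp add: eq)
      finally show "\<exists>F c. finite F \<and> F \<subseteq> Y \<and> (\<integral>x. (cmod (f x - (\<Sum>i\<in>F. c i * expo i x)))\<^sup>2 \<partial>dirac_sum A) < \<epsilon>"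
        using Y \<epsilon> by (intro exI[of _ Y] exI[of _ c]) simp
    qed
    then show "is_finite_spectrum A Y" using A Y by (simp add: is_finite_spectrum_def)
  qed
qed

section \<open>Tilings by means of pointwise covering\<close>

lemma mem_translate: "y \<in> (+) t ` S \<longleftrightarrow> y - t \<in> S" for y t :: "'a::ab_group_add"
proof
  assume "y \<in> (+) t ` S"
  then obtain a where "a \<in> S" "y = t + a" by blast
  then show "y - t \<in> S" by simp
next
  assume "y - t \<in> S"
  then have "t + (y - t) \<in> (+) t ` S" by (rule imageI)
  then show "y \<in> (+) t ` S" by simp
qed

lemma tiles_int_iff:
  "tiles_int A T \<longleftrightarrow> (\<forall>k. \<forall>z\<in>T. \<forall>z'\<in>T. k - z \<in> A \<longrightarrow> k - z' \<in> A \<longrightarrow> z = z') \<and>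
    (\<forall>k. \<exists>z\<in>T. k - z \<in> A)"
proof -
  have disj: "disjoint_family_on (\<lambda>t. (+) t ` A) T \<longleftrightarrow>
      (\<forall>k. \<forall>z\<in>T. \<forall>z'\<in>T. k - z \<in> A \<longrightarrow> k - z' \<in> A \<longrightarrow> z = z')"
    unfolding disjoint_family_on_def disjoint_iff mem_translate by blast
  have cover: "(\<Union>t\<in>T. (+) t ` A) = UNIV \<longleftrightarrow> (\<forall>k. \<exists>z\<in>T. k - z \<in> A)"
    unfolding set_eq_iff UN_iff mem_translate by blast
  show ?thesis unfolding tiles_int_def disj cover by (rule refl)
qed

text \<open>Over a good \<open>x\<close>, tiling the points \<open>x + k q\<close> amounts to tiling
  the integers by the fibre of \<open>x\<close>. One set \<open>Z\<close> for all occurring fibres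
  therefore gives translations \<open>z q\<close> that do not depend on \<open>x\<close>.\<close>

theorem tiles_real_if_UTC:
  assumes UTC: "\<forall>p\<ge>1. UTC p" and spectrum: "is_spectrum S \<Lambda>" and S: "bounded S" and period: "has_period \<Lambda> T"
  shows "\<exists>\<tau>. \<tau> \<subseteq> scaled_int T UNIV \<and> tiles_real S \<tau>"
proof -
  define q where "q = 1 / T"
  have T: "T > 0" using period by (simp add: has_period_def)
  have q: "q > 0" using T by (simp add: q_def)
  let ?m = "measure lebesgue S"
  have m: "?m > 0" using spectrum by (simp add: is_spectrum_def)
  define img where "img A = (\<lambda>k::int. of_int k * q) ` A" for A
  obtain p :: nat and \<Gamma> where p: "p \<ge> 1" "real p = ?m * T" and \<Gamma>: "finite \<Gamma>" "card \<Gamma> = p" "0 \<in> \<Gamma>"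
    and good: "AE x in lebesgue_on {0..<q}. card (slice q S x) = p \<and> fin_orth \<Gamma> (img (slice q S x))"
    using spectrum_slices[OF spectrum S period] unfolding q_def[symmetric] img_def by blast
  obtain K where K: "finite K" "\<And>x. x \<in> {0..<q} \<Longrightarrow> slice q S x \<subseteq> K"
    by (rule slice_finite_range[OF q S]) blast
  define \<A> where "\<A> = {A. A \<subseteq> K \<and> card A = p \<and> fin_orth \<Gamma> (img A)}"
  have finA: "finite \<A>" by (rule finite_subset[of _ "Pow K"]) (use K(1) in \<open>auto simp: \<A>_def\<close>)
  \<comment> \<open>Scaling by the measure turns the fibre points \<open>k q\<close> into
    \<open>k / p\<close>: since \<open>p = |S| T\<close>, the products \<open>(k q) \<gamma>\<close>
    and \<open>(k / p) (|S| \<gamma>)\<close> agree.\<close>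
  define \<Gamma>' where "\<Gamma>' = (\<lambda>\<gamma>. ?m * \<gamma>) ` \<Gamma>"
  have \<Gamma>': "finite \<Gamma>'" "card \<Gamma>' = p" "0 \<in> \<Gamma>'" "\<Gamma>' \<noteq> {}"
  proof -
    show "finite \<Gamma>'" using \<Gamma>(1) by (simp add: \<Gamma>'_def)
    show "card \<Gamma>' = p" unfolding \<Gamma>'_def using m \<Gamma>(2) by (subst card_image) (simp_all add: inj_on_def)
    show "0 \<in> \<Gamma>'" unfolding \<Gamma>'_def by (rule image_eqI[OF _ \<Gamma>(3)]) simp
    then show "\<Gamma>' \<noteq> {}" by blast
  qed
  have mpq: "?m / real p = q" using p m T by (simp add: q_def)
  have slice_spectrum: "is_finite_spectrum \<Gamma>' (scaled_int (real p) A)" if A: "A \<in> \<A>" for A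
  proof -
    have finA: "finite A" using A K(1) unfolding \<A>_def by (auto intro: finite_subset)
    have "fin_orth (img A) \<Gamma>"
    proof (rule fin_orth_sym[OF \<Gamma>(1)])
      show "finite (img A)" unfolding img_def using finA by (rule finite_imageI)
      have "card (img A) = card A"
        unfolding img_def using q by (intro card_image) (simp add: inj_on_def)
      then show "card \<Gamma> = card (img A)" using A \<Gamma>(2) by (simp add: \<A>_def)
      show "fin_orth \<Gamma> (img A)" using A by (simp add: \<A>_def)
    qed
    have "fin_orth (scaled_int (real p) A) \<Gamma>'"
      unfolding fin_orth_def
    proof (intro ballI impI)
      fix x x' assume "x \<in> scaled_int (real p) A" "x' \<in> scaled_int (real p) A" "x \<noteq> x'"
      then obtain k k' where k: "k \<in> A" "k' \<in> A" "x = of_int k / p" "x' = of_int k' / p"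
        unfolding scaled_int_def by blast
      with \<open>x \<noteq> x'\<close> have "of_int k * q \<noteq> of_int k' * q" using q by auto
      moreover have "of_int k * q \<in> img A" "of_int k' * q \<in> img A" unfolding img_def using k(1,2) by blast+
      ultimately have "(\<Sum>\<gamma>\<in>\<Gamma>. expo (of_int k * q - of_int k' * q) \<gamma>) = 0"
        using \<open>fin_orth (img A) \<Gamma>\<close> unfolding fin_orth_def by blast
      moreover have "(\<Sum>y\<in>\<Gamma>'. expo (x - x') y) = (\<Sum>\<gamma>\<in>\<Gamma>. expo (x - x') (?m * \<gamma>))"
        unfolding \<Gamma>'_def using m by (subst sum.reindex) (simp_all add: inj_on_def)
      moreover have "expo (x - x') (?m * \<gamma>) = expo (of_int k * q - of_int k' * q) \<gamma>" for \<gamma>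
      proof -
        have "(x - x') * ?m = of_int k * q - of_int k' * q"
          unfolding mpq[symmetric] k(3,4) by (simp add: diff_divide_distrib left_diff_distrib)
        moreover have "2 * pi * (x - x') * (?m * \<gamma>) = 2 * pi * ((x - x') * ?m) * \<gamma>" by (simp only: mult_ac)
        ultimately show ?thesis unfolding expo_cis by (simp only:)
      qed
      ultimately show "(\<Sum>y\<in>\<Gamma>'. expo (x - x') y) = 0" by simp
    qed
    moreover have "card (scaled_int (real p) A) = p"
      unfolding scaled_int_def using p(1) A by (subst card_image) (simp_all add: inj_on_def \<A>_def)
    moreover have "finite (scaled_int (real p) A)" unfolding scaled_int_def using finA by (rule finite_imageI)
    ultimately show ?thesis using is_finite_spectrum_iff[OF \<Gamma>'(1,4)] \<Gamma>'(2) by simp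
  qed
  obtain x\<^sub>1 where x1: "x\<^sub>1 \<in> {0..<q}" "card (slice q S x\<^sub>1) = p" "fin_orth \<Gamma> (img (slice q S x\<^sub>1))"
    using AE_interval_exists[OF q good] by blast
  then have "slice q S x\<^sub>1 \<in> \<A>" using K(2) by (simp add: \<A>_def)
  have ex: "\<exists>A. is_finite_spectrum \<Gamma>' (scaled_int (real p) A)" using slice_spectrum[OF \<open>slice q S x\<^sub>1 \<in> \<A>\<close>] by (rule exI)
  \<comment> \<open>The conjecture speaks of families indexed from 1, so the finite set of fibres is
    enumerated.\<close>
  obtain f where f: "bij_betw f {1..card \<A>} \<A>" using ex_bij_betw_nat_finite_1[OF finA] by blast
  have fA: "f i \<in> \<A>" if "i \<in> {1..card \<A>}" for i using bij_betwE[OF f] that by (rule bspec)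
  have "UTC p" using UTC p(1) by simp
  then have "finite \<Gamma>' \<and> card \<Gamma>' = p \<and> 0 \<in> \<Gamma>' \<and> (\<exists>A. is_finite_spectrum \<Gamma>' (scaled_int (real p) A)) \<longrightarrow>
      (\<forall>(n::nat) A. (\<forall>i\<in>{1..n}. is_finite_spectrum \<Gamma>' (scaled_int (real p) (A i))) \<longrightarrow>
        (\<exists>Z. \<forall>i\<in>{1..n}. tiles_int (A i) Z))"
    unfolding UTC_def by (rule spec)
  then have UTC': "\<forall>(n::nat) A. (\<forall>i\<in>{1..n}. is_finite_spectrum \<Gamma>' (scaled_int (real p) (A i))) \<longrightarrow>
        (\<exists>Z. \<forall>i\<in>{1..n}. tiles_int (A i) Z)"
    by (rule mp) (intro conjI \<Gamma>'(1-3) ex)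
  have "(\<forall>i\<in>{1..card \<A>}. is_finite_spectrum \<Gamma>' (scaled_int (real p) (f i))) \<longrightarrow>
        (\<exists>Z. \<forall>i\<in>{1..card \<A>}. tiles_int (f i) Z)"
    using UTC'[THEN spec, THEN spec, of "card \<A>" f] .
  moreover have "\<forall>i\<in>{1..card \<A>}. is_finite_spectrum \<Gamma>' (scaled_int (real p) (f i))"
    by (intro ballI slice_spectrum fA)
  ultimately have "\<exists>Z. \<forall>i\<in>{1..card \<A>}. tiles_int (f i) Z" by (rule mp)
  then obtain Z where fZ: "\<forall>i\<in>{1..card \<A>}. tiles_int (f i) Z" by (rule exE)
  have Z: "tiles_int A Z" if "A \<in> \<A>" for A
  proof -
    have "A \<in> f ` {1..card \<A>}" by (subst bij_betw_imp_surj_on[OF f]) (rule that)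
    then obtain i where "A = f i" "i \<in> {1..card \<A>}" by (rule imageE)
    then show ?thesis using fZ by simp
  qed
  have "AE x in lebesgue_on {0..<q}. slice q S x \<in> \<A>"
  proof -
    have "AE x in lebesgue_on {0..<q}. x \<in> {0..<q}" by (rule AE_I2) simp
    with good show ?thesis
    proof eventually_elim
      case (elim x)
      then show ?case using K(2)[of x] by (simp add: \<A>_def)
    qed
  qed
  then have "AE x in lebesgue. x \<in> {0..<q} \<longrightarrow> slice q S x \<in> \<A>"
    by (rule AE_restrict_space_iff[THEN iffD1, rotated]) simp
  then obtain N where N0: "{x \<in> space lebesgue. \<not> (x \<in> {0..<q} \<longrightarrow> slice q S x \<in> \<A>)} \<subseteq> N"
    "emeasure lebesgue N = 0" "N \<in> sets lebesgue" by (rule AE_E)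
  have N: "N \<in> null_sets lebesgue" "{x. \<not> (x \<in> {0..<q} \<longrightarrow> slice q S x \<in> \<A>)} \<subseteq> N"
    using N0 by (auto intro: null_setsI)
  \<comment> \<open>The exceptional set concerns \<open>[0, q)\<close>; its translates by all
    multiples of \<open>q\<close> are still null together, and every \<open>y\<close> outside them
    projects to a good fibre.\<close>
  define N' where "N' = (\<Union>k::int. (+) (of_int k * q) ` N)"
  have "negligible N'"
    unfolding N'_def
  proof (rule negligible_countable_Union)
    show "countable (range (\<lambda>k::int. (+) (of_int k * q) ` N))" by simp
    show "negligible M" if "M \<in> range (\<lambda>k::int. (+) (of_int k * q) ` N)" for M
      using that N(1) negligible_translation by (auto simp: negligible_iff_null_sets)
  qed
  have slice_good: "slice q S (y - of_int \<lfloor>y / q\<rfloor> * q) \<in> \<A>" if "y \<notin> N'" for y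
  proof (rule ccontr)
    assume "\<not> ?thesis"
    then have "y - of_int \<lfloor>y / q\<rfloor> * q \<in> N" using floor_remainder[OF q, of y] N(2) by blast
    then have "of_int \<lfloor>y / q\<rfloor> * q + (y - of_int \<lfloor>y / q\<rfloor> * q) \<in> N'" unfolding N'_def by blast
    then show False using that by simp
  qed
  \<comment> \<open>Seen from the cell index of \<open>y\<close>, membership in a real translate of
    \<open>S\<close> is membership in an integer translate of the fibre.\<close>
  have slice_mem: "y - of_int z * q \<in> S \<longleftrightarrow> \<lfloor>y / q\<rfloor> - z \<in> slice q S (y - of_int \<lfloor>y / q\<rfloor> * q)" for y and z :: int
    by (simp add: slice_def algebra_simps)
  have unique: "z = z'" if "y \<notin> N'" "z \<in> Z" "z' \<in> Z" "y - of_int z * q \<in> S" "y - of_int z' * q \<in> S" for y z z'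
    using Z[OF slice_good[OF that(1)], unfolded tiles_int_iff, THEN conjunct1, rule_format, OF that(2,3)]
      that(4,5) unfolding slice_mem .
  have exists: "\<exists>z\<in>Z. y - of_int z * q \<in> S" if "y \<notin> N'" for y
    using Z[OF slice_good[OF that], unfolded tiles_int_iff, THEN conjunct2, rule_format] unfolding slice_mem .
  define \<tau> where "\<tau> = (\<lambda>z. of_int z * q) ` Z"
  have "tiles_real S \<tau>"
    unfolding tiles_real_def
  proof
    show "pairwise (\<lambda>s t. (+) s ` S \<inter> (+) t ` S \<in> null_sets lebesgue) \<tau>"
    proof (rule pairwiseI)
      fix s t assume "s \<in> \<tau>" "t \<in> \<tau>" "s \<noteq> t"
      from \<open>s \<in> \<tau>\<close> obtain z where z: "z \<in> Z" "s = of_int z * q" unfolding \<tau>_def by (rule imageE)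
      from \<open>t \<in> \<tau>\<close> obtain z' where z': "z' \<in> Z" "t = of_int z' * q" unfolding \<tau>_def by (rule imageE)
      have "z \<noteq> z'" using \<open>s \<noteq> t\<close> unfolding z(2) z'(2) by (rule contrapos_nn) simp
      have "(+) s ` S \<inter> (+) t ` S \<subseteq> N'"
      proof
        fix y assume "y \<in> (+) s ` S \<inter> (+) t ` S"
        then have "y - of_int z * q \<in> S" "y - of_int z' * q \<in> S"
          unfolding Int_iff mem_translate z(2) z'(2) by simp_all
        then show "y \<in> N'" using unique[OF _ z(1) z'(1), of y] \<open>z \<noteq> z'\<close> by (cases "y \<in> N'") simp_all
      qed
      then show "(+) s ` S \<inter> (+) t ` S \<in> null_sets lebesgue"
        using negligible_subset[OF \<open>negligible N'\<close>] by (simp add: negligible_iff_null_sets)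
    qed
    have "- (\<Union>t\<in>\<tau>. (+) t ` S) \<subseteq> N'"
    proof
      fix y assume y: "y \<in> - (\<Union>t\<in>\<tau>. (+) t ` S)"
      show "y \<in> N'"
      proof (rule ccontr)
        assume "y \<notin> N'"
        from exists[OF this] obtain z where "z \<in> Z" "y - of_int z * q \<in> S" by (rule bexE)
        from \<open>z \<in> Z\<close> have "of_int z * q \<in> \<tau>" unfolding \<tau>_def by (rule imageI)
        moreover from \<open>y - of_int z * q \<in> S\<close> have "y \<in> (+) (of_int z * q) ` S" unfolding mem_translate .
        ultimately have "y \<in> (\<Union>t\<in>\<tau>. (+) t ` S)" by (intro UN_I)
        with y show False by simp
      qed
    qed
    then show "- (\<Union>t\<in>\<tau>. (+) t ` S) \<in> null_sets lebesgue"
      using negligible_subset[OF \<open>negligible N'\<close>] by (simp add: negligible_iff_null_sets)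
  qed
  moreover have "\<tau> \<subseteq> scaled_int T UNIV"
  proof
    fix t assume "t \<in> \<tau>"
    then obtain z where "t = of_int z * q" unfolding \<tau>_def by (rule imageE)
    then have "t = of_int z / T" by (simp add: q_def)
    then show "t \<in> scaled_int T UNIV" unfolding scaled_int_def by (rule image_eqI) simp
  qed
  ultimately show ?thesis by (intro exI conjI)
qed

section \<open>Tilings of the integers by unions of residue blocks\<close>

text \<open>Whether \<open>k \<in> T\<close> is decided by the elements of \<open>T\<close> to its
  left: with \<open>b\<^sub>0\<close> the least element of \<open>B\<close>, the position
  \<open>k + b\<^sub>0\<close> is covered either by \<open>k\<close> or by some
  \<open>k + b\<^sub>0 - b\<close> with \<open>b > b\<^sub>0\<close>. A window of length
  \<open>2 * \<beta>\<close> thus determines everything to its right.\<close>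

lemma tiles_int_periodic:
  assumes B: "finite B" "B \<noteq> {}" and tiles: "tiles_int B T"
  obtains P where "P > 0" "\<And>t. t \<in> T \<longleftrightarrow> t + P \<in> T"
proof -
  have uniq: "z = z'" if "z \<in> T" "z' \<in> T" "k - z \<in> B" "k - z' \<in> B" for k z z'
    using tiles[unfolded tiles_int_iff, THEN conjunct1, rule_format, OF that] .
  have ex: "\<exists>z\<in>T. k - z \<in> B" for k
    using tiles[unfolded tiles_int_iff, THEN conjunct2, rule_format] .
  define \<beta> where "\<beta> = Max (abs ` B)"
  have \<beta>: "\<bar>b\<bar> \<le> \<beta>" if "b \<in> B" for b unfolding \<beta>_def using B(1) that by (intro Max_ge) simp_all
  have \<beta>0: "\<beta> \<ge> 0" using \<beta>[OF Min_in[OF B]] by simp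
  define b\<^sub>0 where "b\<^sub>0 = Min B"
  have b0: "b\<^sub>0 \<in> B" "\<And>b. b \<in> B \<Longrightarrow> b\<^sub>0 \<le> b" using Min_in[OF B] Min_le[OF B(1)] by (simp_all add: b\<^sub>0_def)
  have step: "k \<in> T \<longleftrightarrow> \<not> (\<exists>b\<in>B. b \<noteq> b\<^sub>0 \<and> k + b\<^sub>0 - b \<in> T)" for k
  proof
    assume k: "k \<in> T"
    show "\<not> (\<exists>b\<in>B. b \<noteq> b\<^sub>0 \<and> k + b\<^sub>0 - b \<in> T)"
    proof
      assume "\<exists>b\<in>B. b \<noteq> b\<^sub>0 \<and> k + b\<^sub>0 - b \<in> T"
      then obtain b where b: "b \<in> B" "b \<noteq> b\<^sub>0" "k + b\<^sub>0 - b \<in> T" by blast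
      have "k = k + b\<^sub>0 - b" by (rule uniq[OF k b(3), of "k + b\<^sub>0"]) (use b b0 in simp_all)
      with b(2) show False by simp
    qed
  next
    assume *: "\<not> (\<exists>b\<in>B. b \<noteq> b\<^sub>0 \<and> k + b\<^sub>0 - b \<in> T)"
    from ex[of "k + b\<^sub>0"] obtain z where z: "z \<in> T" "k + b\<^sub>0 - z \<in> B" by (rule bexE)
    have "k + b\<^sub>0 - z = b\<^sub>0"
    proof (rule ccontr)
      assume "k + b\<^sub>0 - z \<noteq> b\<^sub>0"
      moreover have "k + b\<^sub>0 - (k + b\<^sub>0 - z) \<in> T" using z(1) by simp
      ultimately show False using * z(2) by blast
    qed
    then have "k = z" by simp
    with z(1) show "k \<in> T" by simp
  qed
  \<comment> \<open>The periodicity criterion is phrased for sets of reals, hence the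
    embedding.\<close>
  let ?X = "real_of_int ` T"
  have mem: "real_of_int t \<in> ?X \<longleftrightarrow> t \<in> T" for t by (simp add: inj_image_mem_iff inj_def)
  have "\<exists>Q>0. \<forall>y. y \<in> ?X \<longleftrightarrow> y + Q \<in> ?X"
  proof (rule periodic_if_deterministic[where R = "2 * of_int \<beta> + 1" and L = "2 * of_int \<beta>"])
    fix R :: real
    have "{x - y | x y. x \<in> ?X \<and> y \<in> ?X \<and> \<bar>x - y\<bar> \<le> R} \<subseteq> real_of_int ` {- \<lceil>R\<rceil>..\<lceil>R\<rceil>}"
    proof
      fix w assume "w \<in> {x - y | x y. x \<in> ?X \<and> y \<in> ?X \<and> \<bar>x - y\<bar> \<le> R}"
      then obtain s t :: int where w: "w = of_int (s - t)" "\<bar>w\<bar> \<le> R" by auto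
      then have "\<bar>s - t\<bar> \<le> \<lceil>R\<rceil>" by linarith
      then show "w \<in> real_of_int ` {- \<lceil>R\<rceil>..\<lceil>R\<rceil>}" unfolding w(1) by (intro imageI) (simp add: abs_le_iff)
    qed
    then show "finite {x - y | x y. x \<in> ?X \<and> y \<in> ?X \<and> \<bar>x - y\<bar> \<le> R}" by (rule finite_subset) simp
  next
    fix x :: real
    from ex[of "\<lfloor>x\<rfloor> - \<beta>"] obtain z where z: "z \<in> T" "\<lfloor>x\<rfloor> - \<beta> - z \<in> B" by (rule bexE)
    have "z \<le> \<lfloor>x\<rfloor>" "\<lfloor>x\<rfloor> \<le> z + 2 * \<beta>" using \<beta>[OF z(2)] by linarith+
    then have "x - (2 * of_int \<beta> + 1) \<le> of_int z" "of_int z \<le> x" by linarith+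
    then show "\<exists>y\<in>?X. x - (2 * of_int \<beta> + 1) \<le> y \<and> y \<le> x" using mem[of z] z(1) by blast
  next
    fix u v :: real
    assume "u \<in> ?X" "v \<in> ?X" and window: "\<forall>x\<in>{- (2 * real_of_int \<beta>)..0}. u + x \<in> ?X \<longleftrightarrow> v + x \<in> ?X"
    then obtain s t where st: "u = of_int s" "v = of_int t" by blast
    have agree: "s + h \<in> T \<longleftrightarrow> t + h \<in> T" if "h \<ge> - 2 * \<beta>" for h
      using that
    proof (induction "nat (h + 2 * \<beta>)" arbitrary: h rule: less_induct)
      case less
      show ?case
      proof (cases "h \<le> 0")
        case True
        with less.prems have "real_of_int h \<in> {- (2 * real_of_int \<beta>)..0}" by simp
        from window[rule_format, OF this] show ?thesis unfolding st of_int_add[symmetric] mem .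
      next
        case False
        have "s + h + b\<^sub>0 - b \<in> T \<longleftrightarrow> t + h + b\<^sub>0 - b \<in> T" if b: "b \<in> B" "b \<noteq> b\<^sub>0" for b
        proof -
          have "b\<^sub>0 < b" using b0(2)[OF b(1)] b(2) by simp
          moreover have "- 2 * \<beta> \<le> h + b\<^sub>0 - b" using \<beta>[OF b(1)] \<beta>[OF b0(1)] False by linarith
          ultimately have "s + (h + b\<^sub>0 - b) \<in> T \<longleftrightarrow> t + (h + b\<^sub>0 - b) \<in> T"
            by (intro less.hyps) linarith+
          then show ?thesis by (simp add: algebra_simps)
        qed
        then show ?thesis unfolding step[of "s + h"] step[of "t + h"] by blast
      qed
    qed
    show "\<forall>x\<ge>- (2 * real_of_int \<beta>). u + x \<in> ?X \<longleftrightarrow> v + x \<in> ?X"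
    proof (intro allI impI)
      fix x assume x: "- (2 * real_of_int \<beta>) \<le> x"
      show "u + x \<in> ?X \<longleftrightarrow> v + x \<in> ?X"
      proof (cases "x \<in> \<int>")
        case True
        then obtain h where h: "x = of_int h" by (rule Ints_cases)
        with x have "h \<ge> - 2 * \<beta>" by linarith
        from agree[OF this] show ?thesis unfolding st h of_int_add[symmetric] mem .
      next
        \<comment> \<open>A shift by a non-integer leaves the embedded integers, so both memberships
          fail.\<close>
        case False
        have "of_int r + x \<notin> ?X" for r
        proof
          assume "of_int r + x \<in> ?X"
          then obtain r' where "of_int r + x = of_int r'" by blast
          then have "x = of_int (r' - r)" by simp
          with False show False by (metis Ints_of_int)
        qed
        then show ?thesis unfolding st by simp
      qed
    qed
  qed (use \<beta>0 in simp_all)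
  then obtain Q where Q: "Q > 0" "\<And>y. y \<in> ?X \<longleftrightarrow> y + Q \<in> ?X" by blast
  from ex[of 0] obtain t\<^sub>0 where "t\<^sub>0 \<in> T" by blast
  then have "of_int t\<^sub>0 + Q \<in> ?X" using Q(2)[of "of_int t\<^sub>0"] mem by simp
  then obtain t\<^sub>1 where "of_int t\<^sub>0 + Q = of_int t\<^sub>1" by blast
  then have Qi: "Q = of_int (t\<^sub>1 - t\<^sub>0)" by simp
  show thesis
  proof (rule that)
    show "t\<^sub>1 - t\<^sub>0 > 0" using Q(1) unfolding Qi by simp
    show "t \<in> T \<longleftrightarrow> t + (t\<^sub>1 - t\<^sub>0) \<in> T" for t
      using Q(2)[of "of_int t"] unfolding Qi of_int_add[symmetric] mem .
  qed
qed

text \<open>Interleaving: the residue class of \<open>c\<close> modulo \<open>N\<close> carries a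
  copy of \<open>A c\<close>. These are the grid cells occupied by a set whose fibres over
  \<open>N\<close> equal cells are the \<open>A c\<close>.\<close>

definition blocks :: "int \<Rightarrow> (int \<Rightarrow> int set) \<Rightarrow> int set" where
  "blocks N A = {b. b div N \<in> A (b mod N)}"

lemma mem_blocks: "N > 0 \<Longrightarrow> c \<in> {0..<N} \<Longrightarrow> N * a + c \<in> blocks N A \<longleftrightarrow> a \<in> A c"
  by (simp add: blocks_def)

lemma periodic_mult:
  fixes M :: int
  assumes "\<And>t. t \<in> T \<longleftrightarrow> t + M \<in> T"
  shows "t + M * m \<in> T \<longleftrightarrow> t \<in> T"
proof (induction m rule: int_induct[where k = 0])
  case base
  show ?case by simp
next
  case (step1 i)
  then show ?case using assms[of "t + M * i"] by (simp add: algebra_simps)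
next
  case (step2 i)
  then show ?case using assms[of "t + M * (i - 1)"] by (simp add: algebra_simps)
qed

text \<open>Fix \<open>j\<close>. The positions \<open>N y + j\<close> covered by the translate by
  \<open>t\<close> are those with \<open>y = a - (j - t) div N\<close> and
  \<open>a \<in> A ((j - t) mod N)\<close>. For \<open>t\<close> in one period of \<open>T\<close>,
  these numbers run through the residues modulo \<open>P\<close> exactly once; counting them gives
  the first claim, adding them the second.\<close>

lemma blocks_residue_sum:
  fixes N P j :: int and A :: "int \<Rightarrow> int set" and p :: nat
  assumes N: "N > 0" and P: "P > 0" and periodic: "\<And>t. t \<in> T \<longleftrightarrow> t + N * P \<in> T"
    and A: "\<And>c. c \<in> {0..<N} \<Longrightarrow> finite (A c) \<and> card (A c) = p"
    and tiles: "tiles_int (blocks N A) T"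
  shows "P = int p * int (card (T \<inter> {0..<N * P}))" (is "_ = _ * int (card ?T)")
    and "(\<Sum>t\<in>T \<inter> {0..<N * P}. \<Sum>(A ((j - t) mod N)) - int p * ((j - t) div N)) mod P = \<Sum>{0..<P} mod P"
proof -
  have uniq: "z = z'" if "z \<in> T" "z' \<in> T" "k - z \<in> blocks N A" "k - z' \<in> blocks N A" for k z z'
    using tiles[unfolded tiles_int_iff, THEN conjunct1, rule_format, OF that] .
  have ex: "\<exists>z\<in>T. k - z \<in> blocks N A" for k
    using tiles[unfolded tiles_int_iff, THEN conjunct2, rule_format] .
  have c: "x mod N \<in> {0..<N}" for x using N by simp
  have cell: "N * y + j - t \<in> blocks N A \<longleftrightarrow> y + (j - t) div N \<in> A ((j - t) mod N)" for y t
  proof -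
    have "N * y + j - t = N * (y + (j - t) div N) + (j - t) mod N"
      using mult_div_mod_eq[of N "j - t"] by (simp add: distrib_left)
    then show ?thesis using mem_blocks[OF N c, of "y + (j - t) div N" "j - t" A] by simp
  qed
  let ?D = "SIGMA t:?T. A ((j - t) mod N)"
  let ?h = "\<lambda>(t, a). (a - (j - t) div N) mod P"
  have fin: "finite ?T" by (rule finite_subset[of _ "{0..<N * P}"]) auto
  have bij: "bij_betw ?h ?D {0..<P}"
    unfolding bij_betw_def
  proof
    show "inj_on ?h ?D"
    proof (rule inj_onI)
      fix x x' assume "x \<in> ?D" "x' \<in> ?D" "?h x = ?h x'"
      moreover obtain t a t' a' where xx: "x = (t, a)" "x' = (t', a')" by (cases x, cases x')
      ultimately have t: "t \<in> T" "0 \<le> t" "t < N * P" "a \<in> A ((j - t) mod N)"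
        and t': "t' \<in> T" "0 \<le> t'" "t' < N * P" "a' \<in> A ((j - t') mod N)"
        and eq: "(a - (j - t) div N) mod P = (a' - (j - t') div N) mod P" by auto
      from eq have "P dvd (a - (j - t) div N) - (a' - (j - t') div N)" by (simp add: mod_eq_dvd_iff)
      then obtain m where m: "(a - (j - t) div N) - (a' - (j - t') div N) = P * m" by (rule dvdE)
      \<comment> \<open>Equal residues name one position, covered both by \<open>t\<close> and by a
        shift of \<open>t'\<close> by full periods.\<close>
      let ?k = "N * (a - (j - t) div N) + j"
      have k: "?k - t \<in> blocks N A" unfolding cell using t(4) by simp
      have k': "?k - (t' + N * P * m) \<in> blocks N A"
      proof -
        have "a - (j - t) div N = a' - (j - t') div N + P * m" using m by simp
        then have "?k - (t' + N * P * m) = N * (a' - (j - t') div N) + j - t'"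
          by (simp only:) (simp add: algebra_simps)
        moreover have "N * (a' - (j - t') div N) + j - t' \<in> blocks N A" unfolding cell using t'(4) by simp
        ultimately show ?thesis by (simp only:)
      qed
      have "t' + N * P * m \<in> T" using t'(1) periodic_mult[OF periodic] by simp
      from uniq[OF t(1) this k k'] have tt: "t = t' + N * P * m" .
      then have "t mod (N * P) = t' mod (N * P)" by simp
      then have "t = t'" using t t' by simp
      with tt N P have "m = 0" by simp
      with m \<open>t = t'\<close> show "x = x'" by (simp add: xx)
    qed
    show "?h ` ?D = {0..<P}"
    proof
      show "?h ` ?D \<subseteq> {0..<P}" using P by auto
      show "{0..<P} \<subseteq> ?h ` ?D"
      proof
        fix y assume y: "y \<in> {0..<P}"
        from ex[of "N * y + j"] obtain z where z: "z \<in> T" "N * y + j - z \<in> blocks N A" by (rule bexE)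
        define t m where "t = z mod (N * P)" and "m = z div (N * P)"
        have zt: "z = t + N * P * m" unfolding t_def m_def by simp
        have t: "t \<in> ?T"
          using z(1) N P periodic_mult[OF periodic, of t m] unfolding zt by (simp add: t_def)
        have "N * (y - P * m) + j - t \<in> blocks N A" using z(2) unfolding zt by (simp add: algebra_simps)
        then have "(t, y - P * m + (j - t) div N) \<in> ?D" using t unfolding cell by simp
        moreover have "?h (t, y - P * m + (j - t) div N) = y"
        proof -
          have "y - P * m + (j - t) div N - (j - t) div N = y + P * (- m)" by simp
          then show ?thesis using y by (simp only: split_conv mod_mult_self2) simp
        qed
        ultimately show "y \<in> ?h ` ?D" by (metis image_eqI)
      qed
    qed
  qed
  have fA: "finite (A (x mod N))" "card (A (x mod N)) = p" for x using A[OF c[of x]] by simp_all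
  have "card ?D = p * card ?T" using fin by (simp add: card_SigmaI fA mult.commute)
  then have "nat P = p * card ?T" using bij_betw_same_card[OF bij] by simp
  then have "int (nat P) = int (p * card ?T)" by (rule arg_cong)
  then show "P = int p * int (card ?T)" using P by simp
  have "(\<Sum>t\<in>?T. \<Sum>(A ((j - t) mod N)) - int p * ((j - t) div N)) =
      (\<Sum>t\<in>?T. \<Sum>a\<in>A ((j - t) mod N). a - (j - t) div N)"
    by (intro sum.cong refl) (simp add: sum_subtractf fA)
  also have "\<dots> = (\<Sum>(t, a)\<in>?D. a - (j - t) div N)"
    by (rule sum.Sigma) (simp_all add: fin fA)
  also have "\<dots> mod P = (\<Sum>x\<in>?D. ?h x) mod P"
    unfolding case_prod_unfold by (rule mod_sum_eq[symmetric])
  also have "(\<Sum>x\<in>?D. ?h x) = \<Sum>{0..<P}"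
    by (rule sum.reindex_bij_betw[OF bij])
  finally show "(\<Sum>t\<in>?T. \<Sum>(A ((j - t) mod N)) - int p * ((j - t) div N)) mod P = \<Sum>{0..<P} mod P" .
qed

text \<open>Passing from the residue class \<open>j - 1\<close> to \<open>j\<close>, the translate by \<open>t\<close> changes the residue sum by
  less than \<open>p\<close>, except when \<open>t \<equiv> j\<close> modulo \<open>N\<close>, where it drops by exactly \<open>p\<close>. The total change is
  a multiple of \<open>P = p \<cdot> card (T \<inter> {0..<N P})\<close> and cannot vanish for every \<open>j\<close>, so for some \<open>j\<close> every
  \<open>t\<close> must be exceptional.\<close>

lemma tiles_blocks_residue:
  fixes N :: int and A :: "int \<Rightarrow> int set" and p :: nat
  assumes N: "N > 0" and p: "p > 0"
    and A: "\<And>c. c \<in> {0..<N} \<Longrightarrow> finite (A c) \<and> card (A c) = p"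
    and close: "\<And>c c'. c \<in> {0..<N} \<Longrightarrow> c' \<in> {0..<N} \<Longrightarrow> \<bar>\<Sum>(A c) - \<Sum>(A c')\<bar> < int p"
    and ends: "\<Sum>(A 0) = \<Sum>(A (N - 1))"
    and B: "finite (blocks N A)" "blocks N A \<noteq> {}"
    and tiles: "tiles_int (blocks N A) T"
  shows "\<exists>j. \<forall>t\<in>T. N dvd t - j"
proof -
  obtain P where P: "P > 0" and per: "\<And>t. t \<in> T \<longleftrightarrow> t + P \<in> T"
    using tiles_int_periodic[OF B tiles] by blast
  have periodic: "t \<in> T \<longleftrightarrow> t + N * P \<in> T" for t
    using periodic_mult[OF per, of t N] by (simp add: mult.commute)
  define W where "W = T \<inter> {0..<N * P}"
  have finW: "finite W" unfolding W_def by (rule finite_subset[of _ "{0..<N * P}"]) auto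
  define \<sigma> where "\<sigma> x = \<Sum>(A (x mod N)) - int p * (x div N)" for x
  define F where "F j = (\<Sum>t\<in>W. \<sigma> (j - t))" for j
  note residue = blocks_residue_sum[OF N P periodic A tiles, folded W_def]
  have PW: "P = int p * int (card W)" by (rule residue(1))
  have F_mod: "F j mod P = \<Sum>{0..<P} mod P" for j unfolding F_def \<sigma>_def by (rule residue(2))
  have F_dvd: "P dvd F j - F (j - 1)" for j
    using F_mod[of j, folded F_mod[of "j - 1"]] by (rule mod_eq_dvd_iff[THEN iffD1])
  have \<sigma>_shift: "\<sigma> (x + N) = \<sigma> x - int p" for x unfolding \<sigma>_def using N by (simp add: algebra_simps)
  \<comment> \<open>A full turn through the residues lowers every summand by \<open>p\<close>, hence
    the total by \<open>P\<close>; so \<open>F\<close> cannot be constant.\<close>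
  have F_shift: "F (j + N) = F j - P" for j
  proof -
    have "F (j + N) = (\<Sum>t\<in>W. \<sigma> (j - t) - int p)"
      unfolding F_def by (intro sum.cong refl) (simp add: \<sigma>_shift[symmetric] algebra_simps)
    then show ?thesis by (simp add: F_def sum_subtractf PW)
  qed
  have "\<exists>j. F j - F (j - 1) \<noteq> 0"
  proof (rule ccontr)
    assume "\<not> ?thesis"
    then have step: "F j = F (j - 1)" for j by simp
    have "F (int n) = F 0" for n
    proof (induction n)
      case (Suc n)
      then show ?case using step[of "int (Suc n)"] by simp
    qed simp
    from this[of "nat N"] show False using F_shift[of 0] N P by simp
  qed
  then obtain j where j: "F j - F (j - 1) \<noteq> 0" by blast
  define d where "d t = \<sigma> (j - t) - \<sigma> (j - t - 1)" for t
  have d_mod: "\<bar>d t\<bar> < int p" if "(j - t) mod N \<noteq> 0" for t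
  proof -
    let ?c = "(j - t) mod N"
    have c: "0 \<le> ?c" "?c < N" using N by simp_all
    have e: "j - t - 1 = (?c - 1) + N * ((j - t) div N)" using mod_mult_div_eq[of "j - t" N] by linarith
    have "(j - t - 1) mod N = ?c - 1" unfolding e using c that by simp
    moreover have "(j - t - 1) div N = (j - t) div N"
      using arg_cong[OF e, of "\<lambda>x. x div N"] c that N by simp
    ultimately have "d t = \<Sum>(A ?c) - \<Sum>(A (?c - 1))" unfolding d_def \<sigma>_def by simp
    then show ?thesis using close[of ?c "?c - 1"] c that by simp
  qed
  have d_0: "\<bar>d t\<bar> = int p" if "(j - t) mod N = 0" for t
  proof -
    \<comment> \<open>Here \<open>j - t - 1\<close> falls into the last cell of the preceding block,
      whose element sum equals that of cell 0 by \<open>ends\<close>.\<close>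
    have e: "j - t - 1 = (N - 1) + N * ((j - t) div N - 1)"
      using mod_mult_div_eq[of "j - t" N] that by (simp add: algebra_simps)
    have "(j - t - 1) mod N = N - 1"
      unfolding e mod_mult_self2 using N by (intro mod_pos_pos_trivial) simp_all
    moreover have "(j - t - 1) div N = (j - t) div N - 1"
      using arg_cong[OF e, of "\<lambda>x. x div N"] N by simp
    ultimately have 1: "\<sigma> (j - t - 1) = \<Sum>(A (N - 1)) - int p * ((j - t) div N - 1)"
      unfolding \<sigma>_def by (simp only:)
    have "d t = - int p" unfolding d_def 1 unfolding \<sigma>_def that using ends by (simp add: algebra_simps)
    then show ?thesis by simp
  qed
  have d_le: "\<bar>d t\<bar> \<le> int p" for t using d_mod[of t] d_0[of t] by linarith
  have Fd: "F j - F (j - 1) = (\<Sum>t\<in>W. d t)"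
    unfolding F_def d_def by (simp add: sum_subtractf algebra_simps)
  have "P \<le> \<bar>F j - F (j - 1)\<bar>" using dvd_imp_le_int[OF j F_dvd] P by simp
  also have "\<dots> \<le> (\<Sum>t\<in>W. \<bar>d t\<bar>)" unfolding Fd by (rule sum_abs)
  finally have le: "(\<Sum>t\<in>W. int p) \<le> (\<Sum>t\<in>W. \<bar>d t\<bar>)" by (simp add: PW mult.commute)
  \<comment> \<open>No summand exceeds \<open>p\<close> in modulus and the total reaches
    \<open>p\<close> times their number, so none may fall short.\<close>
  have zero: "(j - t) mod N = 0" if "t \<in> W" for t
  proof (rule ccontr)
    assume "(j - t) mod N \<noteq> 0"
    then have "(\<Sum>t\<in>W. \<bar>d t\<bar>) < (\<Sum>t\<in>W. int p)"
      by (intro sum_strict_mono_ex1[OF finW]) (use d_le d_mod that in blast)+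
    with le show False by simp
  qed
  show ?thesis
  proof (intro exI ballI)
    fix t assume t: "t \<in> T"
    define r where "r = t mod (N * P)"
    have tr: "t = r + N * P * (t div (N * P))" unfolding r_def by simp
    have "r \<in> T" using t periodic_mult[OF periodic, of r "t div (N * P)"] unfolding tr[symmetric] by simp
    then have "r \<in> W" unfolding W_def r_def using N P by simp
    then have "N dvd j - r" using zero by (simp add: mod_eq_0_iff_dvd)
    then have "N dvd N * (P * (t div (N * P))) - (j - r)" by (rule dvd_diff[OF dvd_triv_left])
    moreover have "N * (P * (t div (N * P))) - (j - r) = t - j" using tr by (simp add: mult.assoc)
    ultimately show "N dvd t - j" by (simp only:)
  qed
qed

section \<open>From real tilings to the Universal Tiling Conjecture\<close>

text \<open>The tiling is sampled on a grid \<open>y + k \<delta>\<close> that avoids all overlaps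
  and gaps; on such a grid every translate of the union of cells looks like an integer translate of
  \<open>B\<close>.\<close>

lemma tiles_int_if_tiles_real:
  assumes \<delta>: "\<delta> > 0" and B: "B \<noteq> {}" and tiles: "tiles_real {x. \<lfloor>x / \<delta>\<rfloor> \<in> B} \<tau>"
  shows "\<exists>T. tiles_int B T"
proof -
  let ?S = "{x. \<lfloor>x / \<delta>\<rfloor> \<in> B}"
  obtain b where b: "b \<in> B" using B by blast
  have overlap: "negligible ((+) s ` ?S \<inter> (+) t ` ?S)" if "s \<in> \<tau>" "t \<in> \<tau>" "s \<noteq> t" for s t
    using pairwiseD[OF tiles[unfolded tiles_real_def, THEN conjunct1] that] by (simp add: negligible_iff_null_sets)
  have cover: "negligible (- (\<Union>t\<in>\<tau>. (+) t ` ?S))"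
    using tiles unfolding tiles_real_def by (simp add: negligible_iff_null_sets)
  have cell: "{t + of_int b * \<delta><..<t + (of_int b + 1) * \<delta>} \<subseteq> (+) t ` ?S" for t
  proof
    fix x assume x: "x \<in> {t + of_int b * \<delta><..<t + (of_int b + 1) * \<delta>}"
    then have "of_int b \<le> (x - t) / \<delta>" "(x - t) / \<delta> < of_int b + 1"
      using \<delta> by (simp_all add: field_simps)
    then have "\<lfloor>(x - t) / \<delta>\<rfloor> = b" by (intro floor_unique)
    then show "x \<in> (+) t ` ?S" unfolding mem_translate using b by simp
  qed
  \<comment> \<open>Translates closer than \<open>\<delta>\<close> share an interval, so the
    parameters are uniformly separated and hence countable; this makes the union of all pairwise
    overlaps null.\<close>
  have separated: "s = t" if st: "s \<in> \<tau>" "t \<in> \<tau>" "\<bar>s - t\<bar> < \<delta>" for s t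
  proof (rule ccontr)
    assume "s \<noteq> t"
    let ?I = "{max s t + of_int b * \<delta><..<min s t + (of_int b + 1) * \<delta>}"
    have "?I \<subseteq> (+) s ` ?S \<inter> (+) t ` ?S"
    proof (rule Int_greatest)
      show "?I \<subseteq> (+) s ` ?S" by (rule order_trans[OF _ cell]) auto
      show "?I \<subseteq> (+) t ` ?S" by (rule order_trans[OF _ cell]) auto
    qed
    then have "negligible ?I" by (rule negligible_subset[OF overlap[OF st(1,2) \<open>s \<noteq> t\<close>]])
    moreover have "max s t + of_int b * \<delta> < min s t + (of_int b + 1) * \<delta>"
      using st(3) by (cases "s \<le> t") (simp_all add: algebra_simps)
    ultimately show False by (metis open_greaterThanLessThan negligible_imp_sets open_not_negligible greaterThanLessThan_empty_iff not_le)
  qed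
  have "inj_on (\<lambda>t. \<lfloor>t / \<delta>\<rfloor>) \<tau>"
  proof (rule inj_onI)
    fix s t assume st: "s \<in> \<tau>" "t \<in> \<tau>" "\<lfloor>s / \<delta>\<rfloor> = \<lfloor>t / \<delta>\<rfloor>"
    then have "\<bar>s / \<delta> - t / \<delta>\<bar> < 1" by linarith
    then have "\<bar>s - t\<bar> / \<delta> < 1" using \<delta> by (simp add: abs_divide diff_divide_distrib[symmetric])
    then have "\<bar>s - t\<bar> < \<delta>" using \<delta> by simp
    then show "s = t" by (rule separated[OF st(1,2)])
  qed
  moreover have "countable ((\<lambda>t. \<lfloor>t / \<delta>\<rfloor>) ` \<tau>)" by simp
  ultimately have "countable \<tau>" by (rule countable_image_inj_on[rotated])
  let ?O = "\<lambda>(s, t). (+) s ` ?S \<inter> (+) t ` ?S"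
  let ?I = "{(s, t) \<in> \<tau> \<times> \<tau>. s \<noteq> t}"
  define N where "N = - (\<Union>t\<in>\<tau>. (+) t ` ?S) \<union> \<Union>(?O ` ?I)"
  have "negligible (\<Union>(?O ` ?I))"
  proof (rule negligible_countable_Union)
    have "countable ?I" by (rule countable_subset[of _ "\<tau> \<times> \<tau>"]) (use \<open>countable \<tau>\<close> in auto)
    then show "countable (?O ` ?I)" by (rule countable_image)
    show "negligible X" if "X \<in> ?O ` ?I" for X using that overlap by auto
  qed
  then have "negligible N" unfolding N_def using cover by (intro negligible_Un)
  \<comment> \<open>Countably many grid shifts of the bad set are null together, so some
    \<open>y\<close> keeps its whole grid out of it.\<close>
  have "negligible (\<Union>(range (\<lambda>k::int. (+) (- (of_int k * \<delta>)) ` N)))"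
  proof (rule negligible_countable_Union)
    show "negligible X" if "X \<in> range (\<lambda>k::int. (+) (- (of_int k * \<delta>)) ` N)" for X
    proof -
      from that obtain k :: int where "X = (+) (- (of_int k * \<delta>)) ` N" by (rule rangeE)
      then show ?thesis using negligible_translation[OF \<open>negligible N\<close>] by (simp only:)
    qed
  qed simp
  then have "(\<Union>(range (\<lambda>k::int. (+) (- (of_int k * \<delta>)) ` N))) \<noteq> UNIV"
    using non_negligible_UNIV by metis
  then obtain y where y: "y \<notin> (\<Union>(range (\<lambda>k::int. (+) (- (of_int k * \<delta>)) ` N)))" by blast
  have good: "y + of_int k * \<delta> \<notin> N" for k :: int
  proof
    assume "y + of_int k * \<delta> \<in> N"
    then have "y \<in> (+) (- (of_int k * \<delta>)) ` N" unfolding mem_translate by simp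
    with y show False by blast
  qed
  \<comment> \<open>The rounding of \<open>t\<close> relative to \<open>y\<close>: on the grid
    through \<open>y\<close>, the translate by \<open>t\<close> appears as the integer translate by
    \<open>z t\<close>.\<close>
  define z where "z t = - \<lfloor>(y - t) / \<delta>\<rfloor>" for t
  have grid: "k - z t \<in> B \<longleftrightarrow> y + of_int k * \<delta> \<in> (+) t ` ?S" for k t
  proof -
    have "(y + of_int k * \<delta> - t) / \<delta> = (y - t) / \<delta> + of_int k" using \<delta> by (simp add: field_simps)
    then have "\<lfloor>(y + of_int k * \<delta> - t) / \<delta>\<rfloor> = k - z t" unfolding z_def by simp
    then show ?thesis unfolding mem_translate by simp
  qed
  have "tiles_int B (z ` \<tau>)"
    unfolding tiles_int_iff
  proof (intro conjI allI ballI impI)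
    fix k r r' assume "r \<in> z ` \<tau>" "r' \<in> z ` \<tau>" and kr: "k - r \<in> B" "k - r' \<in> B"
    then obtain t t' where t: "t \<in> \<tau>" "t' \<in> \<tau>" "r = z t" "r' = z t'" by blast
    show "r = r'"
    proof (cases "t = t'")
      case True
      then show ?thesis using t by simp
    next
      case False
      have "y + of_int k * \<delta> \<in> ?O (t, t')" using kr unfolding t(3,4) grid by simp
      moreover have "(t, t') \<in> ?I" using t False by simp
      ultimately have "y + of_int k * \<delta> \<in> N" unfolding N_def by blast
      then show ?thesis using good by blast
    qed
  next
    fix k
    have "y + of_int k * \<delta> \<in> (\<Union>t\<in>\<tau>. (+) t ` ?S)" using good[of k] unfolding N_def by blast
    then obtain t where "t \<in> \<tau>" "y + of_int k * \<delta> \<in> (+) t ` ?S" by (rule UN_E)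
    then show "\<exists>r\<in>z ` \<tau>. k - r \<in> B" unfolding grid[symmetric] by blast
  qed
  then show ?thesis by blast
qed

section \<open>Translations and single cells of block tilings\<close>

lemma fin_orth_translate:
  assumes "fin_orth X Y"
  shows "fin_orth X ((+) s ` Y)"
  unfolding fin_orth_def
proof (intro ballI impI)
  fix x x' assume x: "x \<in> X" "x' \<in> X" "x \<noteq> x'"
  have "(\<Sum>y\<in>(+) s ` Y. expo (x - x') y) = expo (x - x') s * (\<Sum>y\<in>Y. expo (x - x') y)"
    by (subst sum.reindex) (simp_all add: expo_add_right sum_distrib_left)
  then show "(\<Sum>y\<in>(+) s ` Y. expo (x - x') y) = 0" using assms x unfolding fin_orth_def by simp
qed

lemma tiles_int_translate: "tiles_int ((+) s ` A) T \<Longrightarrow> tiles_int A T"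
proof -
  assume *: "tiles_int ((+) s ` A) T"
  have mem: "k - z \<in> A \<longleftrightarrow> (k + s) - z \<in> (+) s ` A" for k z by (simp add: mem_translate)
  show ?thesis
    unfolding tiles_int_iff mem
    using *[unfolded tiles_int_iff] by (intro conjI allI) (elim conjE allE, assumption)+
qed

text \<open>Along the positions \<open>N k + c + j\<close> every translate shows the same cell
  \<open>c\<close>, because \<open>t - j\<close> is a multiple of \<open>N\<close>. The quotient set
  does not mention \<open>c\<close>, so it tiles with all cells at once.\<close>

lemma tiles_int_cell_of_blocks:
  assumes N: "N > 0" and c: "c \<in> {0..<N}" and tiles: "tiles_int (blocks N A) T"
    and j: "\<And>t. t \<in> T \<Longrightarrow> N dvd t - j"
  shows "tiles_int (A c) ((\<lambda>t. (t - j) div N) ` T)"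
proof -
  let ?z = "\<lambda>t. (t - j) div N"
  have mem: "k - ?z t \<in> A c \<longleftrightarrow> N * k + c + j - t \<in> blocks N A" if "t \<in> T" for k t
  proof -
    have "t - j = N * ?z t" using j[OF that] by simp
    then have "N * k + c + j - t = N * (k - ?z t) + c" by (simp only: right_diff_distrib)
    then show ?thesis using mem_blocks[OF N c, of "k - ?z t" A] by (simp only:)
  qed
  show ?thesis
    unfolding tiles_int_iff
  proof (intro conjI allI ballI impI)
    fix k r r' assume "r \<in> ?z ` T" "r' \<in> ?z ` T" and kr: "k - r \<in> A c" "k - r' \<in> A c"
    then obtain t t' where t: "t \<in> T" "t' \<in> T" "r = ?z t" "r' = ?z t'" by blast
    have "t = t'"
      by (rule tiles[unfolded tiles_int_iff, THEN conjunct1, rule_format, OF t(1,2), of "N * k + c + j"])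
        (use kr mem t in simp_all)
    then show "r = r'" using t by simp
  next
    fix k
    obtain t where "t \<in> T" "N * k + c + j - t \<in> blocks N A"
      using tiles[unfolded tiles_int_iff, THEN conjunct2, rule_format, of "N * k + c + j"] by (rule bexE)
    then show "\<exists>r\<in>?z ` T. k - r \<in> A c" using mem by blast
  qed
qed

text \<open>The window \<open>[0, 1/p)\<close> is cut into \<open>N\<close> cells; over cell \<open>c\<close> the set consists of the translates by
  \<open>A c / p\<close>.\<close>

lemma spectral_set_blocks:
  fixes N :: int and A :: "int \<Rightarrow> int set" and p :: nat
  assumes N: "N > 0" and p: "p > 0" and \<Gamma>: "finite \<Gamma>" "card \<Gamma> = p"
    and A: "\<And>c. c \<in> {0..<N} \<Longrightarrow> finite (A c) \<and> card (A c) = p \<and> fin_orth \<Gamma> (scaled_int p (A c))"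
    and B: "finite (blocks N A)" and \<delta>_def: "\<delta> = 1 / (real_of_int N * real p)"
  shows "bounded {x. \<lfloor>x / \<delta>\<rfloor> \<in> blocks N A}" and "spectral_set {x. \<lfloor>x / \<delta>\<rfloor> \<in> blocks N A}"
proof -
  have \<delta>: "\<delta> > 0" using N p by (simp add: \<delta>_def)
  define S where "S = {x. \<lfloor>x / \<delta>\<rfloor> \<in> blocks N A}"
  have S_cells: "S = (\<Union>b\<in>blocks N A. {of_int b * \<delta>..<(of_int b + 1) * \<delta>})"
  proof -
    have floor_iff: "\<lfloor>x / \<delta>\<rfloor> = b \<longleftrightarrow> x \<in> {of_int b * \<delta>..<(of_int b + 1) * \<delta>}" for x b
      using \<delta> by (simp add: floor_eq_iff pos_le_divide_eq pos_divide_less_eq)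
    have "\<lfloor>x / \<delta>\<rfloor> \<in> blocks N A \<longleftrightarrow> (\<exists>b\<in>blocks N A. x \<in> {of_int b * \<delta>..<(of_int b + 1) * \<delta>})" for x
      by (simp only: floor_iff[symmetric]) simp
    then show ?thesis unfolding S_def UNION_eq by (intro Collect_cong)
  qed
  have bounded: "bounded S" unfolding S_cells using B by (intro bounded_UN) auto
  have meas: "S \<in> lmeasurable"
    by (rule bounded_set_imp_lmeasurable[OF bounded]) (unfold S_cells, use B in \<open>intro sets.finite_UN\<close>, auto)
  have slice: "slice (1 / p) S x = A \<lfloor>x / \<delta>\<rfloor>" "\<lfloor>x / \<delta>\<rfloor> \<in> {0..<N}" if x: "x \<in> {0..<1 / p}" for x
  proof -
    have "0 \<le> x / \<delta>" "x / \<delta> < of_int N"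
      using x N p unfolding \<delta>_def by (simp_all add: field_simps)
    then show c: "\<lfloor>x / \<delta>\<rfloor> \<in> {0..<N}" by (simp add: floor_less_iff)
    \<comment> \<open>A step of \<open>1 / p\<close> is a step of \<open>N\<close> cells, so along a
      fibre the cell within the block stays fixed and only the block index varies.\<close>
    have "(x + of_int k * (1 / p)) / \<delta> = x / \<delta> + of_int (N * k)" for k
      unfolding \<delta>_def using p by (simp add: field_simps)
    then have "\<lfloor>(x + of_int k * (1 / p)) / \<delta>\<rfloor> = N * k + \<lfloor>x / \<delta>\<rfloor>" for k
      by (simp only: floor_add_int[symmetric] add.commute)
    then show "slice (1 / p) S x = A \<lfloor>x / \<delta>\<rfloor>"
      unfolding slice_def S_def using mem_blocks[OF N c] by simp
  qed
  have "is_spectrum S ((\<lambda>(\<gamma>, j::int). \<gamma> + of_int j / (1 / p)) ` (\<Gamma> \<times> UNIV))"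
  proof (rule spectrum_of_slices[OF _ meas bounded \<Gamma> p])
    show "1 / real p > 0" using p by simp
    fix x assume x: "x \<in> {0..<1 / real p}"
    show "finite (slice (1 / p) S x) \<and> card (slice (1 / p) S x) = p \<and>
        fin_orth \<Gamma> ((\<lambda>k. of_int k * (1 / p)) ` slice (1 / p) S x)"
      using A[OF slice(2)[OF x]] unfolding slice(1)[OF x] scaled_int_def by simp
  qed
  then show "spectral_set {x. \<lfloor>x / \<delta>\<rfloor> \<in> blocks N A}"
    unfolding S_def[symmetric] spectral_set_def by (rule exI)
  show "bounded {x. \<lfloor>x / \<delta>\<rfloor> \<in> blocks N A}" unfolding S_def[symmetric] by (rule bounded)
qed

text \<open>Translating each \<open>A i\<close> normalises its element sum into \<open>[0, p)\<close>; listing the first set again in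
  the last cell makes the sums over the first and last cells agree.\<close>

theorem UTC_if_spectral_sets_tile:
  assumes tile: "\<And>S. bounded S \<Longrightarrow> spectral_set S \<Longrightarrow> \<exists>T. tiles_real S T" and p: "p \<ge> 1"
  shows "UTC p"
  unfolding UTC_def
proof (intro allI impI)
  fix \<Gamma> :: "real set" and n :: nat and A :: "nat \<Rightarrow> int set"
  assume "finite \<Gamma> \<and> card \<Gamma> = p \<and> 0 \<in> \<Gamma> \<and> (\<exists>A. is_finite_spectrum \<Gamma> (scaled_int (real p) A))"
  then have \<Gamma>: "finite \<Gamma>" "card \<Gamma> = p" "\<Gamma> \<noteq> {}" by auto
  assume "\<forall>i\<in>{1..n}. is_finite_spectrum \<Gamma> (scaled_int (real p) (A i))"
  then have spec: "finite (scaled_int p (A i))" "card (scaled_int p (A i)) = p" "fin_orth (scaled_int p (A i)) \<Gamma>"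
    if "i \<in> {1..n}" for i
    using that \<Gamma>(2) by (simp_all add: is_finite_spectrum_iff[OF \<Gamma>(1,3)])
  have inj: "inj_on (\<lambda>k. real_of_int k / p) X" for X using p by (simp add: inj_on_def)
  have A: "finite (A i)" "card (A i) = p" "fin_orth \<Gamma> (scaled_int p (A i))" if i: "i \<in> {1..n}" for i
  proof -
    show "finite (A i)" using spec(1)[OF i] unfolding scaled_int_def by (simp add: finite_image_iff inj)
    show "card (A i) = p" using spec(2)[OF i] unfolding scaled_int_def by (simp add: card_image inj)
    show "fin_orth \<Gamma> (scaled_int p (A i))"
      by (rule fin_orth_sym[OF spec(1)[OF i] \<Gamma>(1) _ spec(3)[OF i]]) (simp add: spec(2)[OF i] \<Gamma>(2))
  qed
  \<comment> \<open>Adding \<open>s i\<close> to all \<open>p\<close> elements changes their sum by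
    \<open>p * s i\<close>; this choice leaves the remainder modulo \<open>p\<close>.\<close>
  define s where "s i = - (\<Sum>(A i) div int p)" for i
  have sum_A: "\<Sum>((+) (s i) ` A i) = \<Sum>(A i) mod int p" if "i \<in> {1..n}" for i
  proof -
    have "\<Sum>((+) (s i) ` A i) = int p * s i + \<Sum>(A i)"
      using A[OF that] by (subst sum.reindex) (simp_all add: sum.distrib)
    then show ?thesis using minus_mult_div_eq_mod[of "\<Sum>(A i)" "int p"] by (simp add: s_def)
  qed
  show "\<exists>T. \<forall>i\<in>{1..n}. tiles_int (A i) T"
  proof (cases "n = 0")
    case False
    define N where "N = int n + 1"
    \<comment> \<open>Cells count from 0 and the family from 1, so cell \<open>c\<close> carries the
      set with index \<open>c + 1\<close>, except for the extra cell \<open>n\<close>.\<close>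
    define f where "f c = (if c = int n then 1 else nat c + 1)" for c :: int
    define A' where "A' c = (+) (s (f c)) ` A (f c)" for c
    have N: "N > 0" by (simp add: N_def)
    have f: "f c \<in> {1..n}" if "c \<in> {0..<N}" for c
    proof (cases "c = int n")
      case True
      then show ?thesis using False by (simp add: f_def)
    next
      case False
      then show ?thesis using that by (simp add: f_def N_def nat_less_iff Suc_le_eq)
    qed
    have A': "finite (A' c)" "card (A' c) = p" "fin_orth \<Gamma> (scaled_int p (A' c))" if "c \<in> {0..<N}" for c
    proof -
      note Af = A[OF f[OF that]]
      show "finite (A' c)" unfolding A'_def using Af(1) by (rule finite_imageI)
      show "card (A' c) = p" unfolding A'_def using Af(2) by (subst card_image) simp_all
      have "scaled_int p (A' c) = (+) (of_int (s (f c)) / p) ` scaled_int p (A (f c))"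
        unfolding scaled_int_def A'_def image_image by (simp add: add_divide_distrib)
      then show "fin_orth \<Gamma> (scaled_int p (A' c))" using fin_orth_translate[OF Af(3)] by simp
    qed
    have sum_A': "0 \<le> \<Sum>(A' c)" "\<Sum>(A' c) < int p" if "c \<in> {0..<N}" for c
      unfolding A'_def sum_A[OF f[OF that]] using p by simp_all
    have "blocks N A' \<subseteq> (\<Union>c\<in>{0..<N}. (\<lambda>a. N * a + c) ` A' c)"
    proof
      fix b assume "b \<in> blocks N A'"
      then have "b div N \<in> A' (b mod N)" by (simp add: blocks_def)
      then have "N * (b div N) + b mod N \<in> (\<lambda>a. N * a + b mod N) ` A' (b mod N)" by (rule imageI)
      then show "b \<in> (\<Union>c\<in>{0..<N}. (\<lambda>a. N * a + c) ` A' c)" using N by (intro UN_I[of "b mod N"]) simp_all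
    qed
    then have B: "finite (blocks N A')" by (rule finite_subset) (intro finite_UN_I finite_atLeastLessThan_int finite_imageI A'(1))
    have "A' 0 \<noteq> {}" using A'(2)[of 0] N p by auto
    then obtain a where "a \<in> A' 0" by blast
    then have "N * a + 0 \<in> blocks N A'" using mem_blocks[OF N, of 0 a A'] N by simp
    then have B0: "blocks N A' \<noteq> {}" by blast
    have p0: "p > 0" using p by simp
    define \<delta> where "\<delta> = 1 / (real_of_int N * real p)"
    have "finite (A' c) \<and> card (A' c) = p \<and> fin_orth \<Gamma> (scaled_int p (A' c))" if "c \<in> {0..<N}" for c
      by (intro conjI A' that)
    note spectral = spectral_set_blocks[OF N p0 \<Gamma>(1,2) this B \<delta>_def]
    from tile[OF spectral] obtain \<tau> where \<tau>: "tiles_real {x. \<lfloor>x / \<delta>\<rfloor> \<in> blocks N A'} \<tau>" by (rule exE)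
    have "\<delta> > 0" using N p0 by (simp add: \<delta>_def)
    from tiles_int_if_tiles_real[OF this B0 \<tau>] obtain T where T: "tiles_int (blocks N A') T" by (rule exE)
    have close: "\<bar>\<Sum>(A' c) - \<Sum>(A' c')\<bar> < int p" if "c \<in> {0..<N}" "c' \<in> {0..<N}" for c c'
      using sum_A'[OF that(1)] sum_A'[OF that(2)] by linarith
    have ends: "\<Sum>(A' 0) = \<Sum>(A' (N - 1))" using False by (simp add: A'_def f_def N_def)
    have "finite (A' c) \<and> card (A' c) = p" if "c \<in> {0..<N}" for c by (intro conjI A' that)
    from tiles_blocks_residue[OF N p0 this close ends B B0 T] obtain j where "\<forall>t\<in>T. N dvd t - j" by (rule exE)
    then have j: "N dvd t - j" if "t \<in> T" for t using that by (rule bspec)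
    show ?thesis
    proof (intro exI ballI)
      fix i assume i: "i \<in> {1..n}"
      \<comment> \<open>The set with index \<open>i\<close> sits in cell \<open>i - 1\<close>;
        undoing its normalising translation does not change the tiling set.\<close>
      have c: "int i - 1 \<in> {0..<N}" using i by (simp add: N_def)
      have fi: "f (int i - 1) = i"
      proof (cases i)
        case (Suc k)
        then show ?thesis using i by (simp add: f_def)
      qed (use i in simp)
      have "tiles_int ((+) (s i) ` A i) ((\<lambda>t. (t - j) div N) ` T)"
      proof -
        have "tiles_int (A' (int i - 1)) ((\<lambda>t. (t - j) div N) ` T)"
          by (rule tiles_int_cell_of_blocks[OF N c T]) (rule j)
        then show ?thesis unfolding A'_def fi .
      qed
      then show "tiles_int (A i) ((\<lambda>t. (t - j) div N) ` T)" by (rule tiles_int_translate)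
    qed
  qed simp
qed

theorem theorem1p5:
  "((\<forall>p\<ge>1. UTC p) \<longleftrightarrow>
      (\<forall>\<Omega>. bounded \<Omega> \<and> spectral_set \<Omega> \<longrightarrow> (\<exists>T. tiles_real \<Omega> T))) \<and>
   ((\<forall>p\<ge>1. UTC p) \<and>
      (\<forall>\<Omega>. bounded \<Omega> \<and> spectral_set \<Omega> \<longrightarrow> (\<exists>T. tiles_real \<Omega> T)) \<longrightarrow>
      (\<forall>\<Omega> \<Lambda> p. bounded \<Omega> \<and> \<Omega> \<in> sets lebesgue \<and> measure lebesgue \<Omega> = 1 \<and>
           is_spectrum \<Omega> \<Lambda> \<and> has_period \<Lambda> p \<longrightarrow>
         (\<exists>T. T \<subseteq> scaled_int p UNIV \<and> tiles_real \<Omega> T)))"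
proof (intro conjI iffI)
  assume UTC: "\<forall>p\<ge>1. UTC p"
  show "\<forall>\<Omega>. bounded \<Omega> \<and> spectral_set \<Omega> \<longrightarrow> (\<exists>T. tiles_real \<Omega> T)"
  proof (intro allI impI, elim conjE)
    fix \<Omega> assume \<Omega>: "bounded \<Omega>" "spectral_set \<Omega>"
    then obtain \<Lambda> where \<Lambda>: "is_spectrum \<Omega> \<Lambda>" unfolding spectral_set_def by (elim exE)
    obtain p where "has_period \<Lambda> p" by (rule spectrum_periodic[OF \<Lambda> \<Omega>(1)])
    from tiles_real_if_UTC[OF UTC \<Lambda> \<Omega>(1) this] show "\<exists>T. tiles_real \<Omega> T" by (elim exE conjE) (rule exI)
  qed
next
  assume tile: "\<forall>\<Omega>. bounded \<Omega> \<and> spectral_set \<Omega> \<longrightarrow> (\<exists>T. tiles_real \<Omega> T)"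
  show "\<forall>p\<ge>1. UTC p"
  proof (intro allI impI)
    fix p :: nat assume "p \<ge> 1"
    show "UTC p"
      by (rule UTC_if_spectral_sets_tile[OF _ \<open>p \<ge> 1\<close>]) (rule tile[rule_format], rule conjI)
  qed
next
  show "(\<forall>p\<ge>1. UTC p) \<and>
      (\<forall>\<Omega>. bounded \<Omega> \<and> spectral_set \<Omega> \<longrightarrow> (\<exists>T. tiles_real \<Omega> T)) \<longrightarrow>
      (\<forall>\<Omega> \<Lambda> p. bounded \<Omega> \<and> \<Omega> \<in> sets lebesgue \<and> measure lebesgue \<Omega> = 1 \<and>
           is_spectrum \<Omega> \<Lambda> \<and> has_period \<Lambda> p \<longrightarrow>
         (\<exists>T. T \<subseteq> scaled_int p UNIV \<and> tiles_real \<Omega> T))"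
    by (intro impI allI; elim conjE) (rule tiles_real_if_UTC)
qed

end
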